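(* The filtration $\mathrm{VR}^m_\leq(S^1;\_)$ of Vietoris–Rips metric thickenings of the circle has one persistent homology bar $[0,\infty)$ in dimension $0$, one bar $\big[\frac{2k\pi}{2k+1},\frac{(2k+2)\pi}{2k+3}\big)$ in dimension $2k+1$ for each $k\ge0$, and no bars in the remaining dimensions.
   Context: $S^1$ is the unit circle with the geodesic (arc length) metric $d_{S^1}$, of total circumference $2\pi$. $\mathcal{P}^{\mathrm{fin}}(S^1)$ is the set of finitely supported probability measures $\sum_{i=1}^n a_i\delta_{x_i}$ on $S^1$ with the 1-Wasserstein metric $d_W$: the distance between $\sum_i a_i\delta_{x_i}$ and $\sum_j a'_j\delta_{x'_j}$ is the infimum of $\sum_{i,j}\kappa_{i,j}d_{S^1}(x_i,x'_j)$ over nonnegative $\kappa_{i,j}$ with $\sum_j\kappa_{i,j}=a_i$ and $\sum_i\kappa_{i,j}=a'_j$. For $r\in\mathbb{R}$, $\mathrm{VR}^m_\leq(S^1;r)$ is the subspace of $\mathcal{P}^{\mathrm{fin}}(S^1)$ of all $\mu$ whose support has diameter at most $r$ (empty for $r<0$). For $r\le r'$ there is an inclusion $\mathrm{VR}^m_\leq(S^1;r)\hookrightarrow\mathrm{VR}^m_\leq(S^1;r')$. Persistent homology in dimension $n$ is the persistence module over $(\mathbb{R},\le)$ given by $r\mapsto H_n(\mathrm{VR}^m_\leq(S^1;r))$, singular homology with coefficients in any fixed field, with maps induced by these inclusions. Its bars are the intervals (with multiplicity) appearing in its decomposition as a direct sum of interval modules, where the interval module of an interval $J\subseteq\mathbb{R}$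 is the field at each $r\in J$ and $0$ elsewhere, with identity maps between indices in $J$. *)

theory Defs
  imports "HOL-Probability.Probability" "HOL-Homology.Homology" "HOL-Algebra.Module"
begin

section \<open>Finitely supported probability measures and the Wasserstein metric\<close>

definition fin_probs :: "'a set \<Rightarrow> 'a pmf set" where
  "fin_probs X = {\<mu>. finite (set_pmf \<mu>) \<and> set_pmf \<mu> \<subseteq> X}"

definition transport_plan :: "'a pmf \<Rightarrow> 'a pmf \<Rightarrow> ('a \<Rightarrow> 'a \<Rightarrow> real) \<Rightarrow> bool" where
  "transport_plan \<mu> \<nu> \<kappa> \<longleftrightarrow>
     (\<forall>x\<in>set_pmf \<mu>. \<forall>y\<in>set_pmf \<nu>. 0 \<le> \<kappa> x y) \<and>
     (\<forall>x\<in>set_pmf \<mu>. (\<Sum>y\<in>set_pmf \<nu>. \<kappa> x y) = pmf \<mu> x) \<and>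
     (\<forall>y\<in>set_pmf \<nu>. (\<Sum>x\<in>set_pmf \<mu>. \<kappa> x y) = pmf \<nu> y)"

text \<open>The value \<open>0\<close> for measures of infinite support is a dummy: the locale
  \<^locale>\<open>Metric_space\<close> wants distances to be nonnegative and symmetric outside the carrier as
  well.\<close>

definition wasserstein :: "('a \<Rightarrow> 'a \<Rightarrow> real) \<Rightarrow> 'a pmf \<Rightarrow> 'a pmf \<Rightarrow> real" where
  "wasserstein d \<mu> \<nu> =
     (if finite (set_pmf \<mu>) \<and> finite (set_pmf \<nu>)
      then Inf {(\<Sum>x\<in>set_pmf \<mu>. \<Sum>y\<in>set_pmf \<nu>. \<kappa> x y * d x y) | \<kappa>. transport_plan \<mu> \<nu> \<kappa>}
      else 0)"

lemma Metric_space_wasserstein: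
  assumes "Metric_space X d"
  shows "Metric_space (fin_probs X) (wasserstein d)"
proof -
  interpret D: Metric_space X d by fact
  define cost where "cost \<mu> \<nu> \<kappa> = (\<Sum>x\<in>set_pmf \<mu>. \<Sum>y\<in>set_pmf \<nu>. \<kappa> x y * d x y)"
    for \<mu> \<nu> and \<kappa> :: "'a \<Rightarrow> 'a \<Rightarrow> real"
  define W where "W \<mu> \<nu> = {cost \<mu> \<nu> \<kappa> | \<kappa>. transport_plan \<mu> \<nu> \<kappa>}" for \<mu> \<nu>
  have was: "wasserstein d \<mu> \<nu> = Inf (W \<mu> \<nu>)"
    if "finite (set_pmf \<mu>)" "finite (set_pmf \<nu>)" for \<mu> \<nu>
    using that by (simp add: wasserstein_def W_def cost_def)
  have sum1: "(\<Sum>x\<in>set_pmf \<mu>. pmf \<mu> x) = 1" if "finite (set_pmf \<mu>)" for \<mu> :: "'a pmf"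
    using that by (simp add: sum_pmf_eq_1)
  have W_ge: "0 \<le> w" if w: "w \<in> W \<mu> \<nu>" for w \<mu> \<nu>
    using that unfolding W_def cost_def transport_plan_def by (auto intro!: sum_nonneg)
  have bdd: "bdd_below (W \<mu> \<nu>)" for \<mu> \<nu>
    using W_ge by (meson bdd_below.I)
  have W_ne: "W \<mu> \<nu> \<noteq> {}" if "finite (set_pmf \<mu>)" "finite (set_pmf \<nu>)" for \<mu> \<nu>
  proof -
    have "transport_plan \<mu> \<nu> (\<lambda>x y. pmf \<mu> x * pmf \<nu> y)"
      using sum1[OF that(1)] sum1[OF that(2)]
      by (simp add: transport_plan_def flip: sum_distrib_left sum_distrib_right)
    then show ?thesis by (auto simp: W_def)
  qed
  have W_commute: "W \<mu> \<nu> \<subseteq> W \<nu> \<mu>" for \<mu> \<nu>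
  proof
    fix w assume "w \<in> W \<mu> \<nu>"
    then obtain \<kappa> where k: "transport_plan \<mu> \<nu> \<kappa>" "w = cost \<mu> \<nu> \<kappa>" by (auto simp: W_def)
    have "transport_plan \<nu> \<mu> (\<lambda>x y. \<kappa> y x)" using k(1) by (auto simp: transport_plan_def)
    moreover have "cost \<nu> \<mu> (\<lambda>x y. \<kappa> y x) = w"
      unfolding k(2) cost_def by (subst sum.swap) (simp add: D.commute)
    ultimately show "w \<in> W \<nu> \<mu>" by (auto simp: W_def)
  qed
  show ?thesis
  proof
    show "0 \<le> wasserstein d \<mu> \<nu>" for \<mu> \<nu>
    proof (cases "finite (set_pmf \<mu>) \<and> finite (set_pmf \<nu>)")
      case True
      then show ?thesis using W_ge W_ne by (auto simp: was intro!: cInf_greatest)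
    qed (auto simp: wasserstein_def)
    show "wasserstein d \<mu> \<nu> = wasserstein d \<nu> \<mu>" for \<mu> \<nu>
    proof (cases "finite (set_pmf \<mu>) \<and> finite (set_pmf \<nu>)")
      case True
      have "W \<mu> \<nu> = W \<nu> \<mu>" using W_commute by blast
      then show ?thesis using True by (simp add: was)
    qed (auto simp: wasserstein_def)
  next
    fix \<mu> \<nu> assume "\<mu> \<in> fin_probs X" "\<nu> \<in> fin_probs X"
    then have fin: "finite (set_pmf \<mu>)" "finite (set_pmf \<nu>)"
      and sub: "set_pmf \<mu> \<subseteq> X" "set_pmf \<nu> \<subseteq> X" by (auto simp: fin_probs_def)
    show "wasserstein d \<mu> \<nu> = 0 \<longleftrightarrow> \<mu> = \<nu>"
    proof
      assume eq: "\<mu> = \<nu>"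
      have "transport_plan \<mu> \<mu> (\<lambda>x y. if x = y then pmf \<mu> x else 0)"
        using fin by (simp add: transport_plan_def)
      moreover have "cost \<mu> \<mu> (\<lambda>x y. if x = y then pmf \<mu> x else 0) = 0"
        unfolding cost_def
      proof (intro sum.neutral ballI)
        fix x y assume "x \<in> set_pmf \<mu>" "y \<in> set_pmf \<mu>"
        then show "(if x = y then pmf \<mu> x else 0) * d x y = 0"
          using sub(1) D.zero by auto
      qed
      ultimately have "0 \<in> W \<mu> \<nu>" unfolding W_def eq by force
      then have "Inf (W \<mu> \<nu>) = 0" using W_ge by (metis cInf_eq_minimum)
      then show "wasserstein d \<mu> \<nu> = 0" using fin by (simp add: was)
    next
      assume zero: "wasserstein d \<mu> \<nu> = 0"
      show "\<mu> = \<nu>"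
      proof (rule ccontr)
        assume ne: "\<mu> \<noteq> \<nu>"
        have "\<exists>x. pmf \<nu> x < pmf \<mu> x"
        proof (rule ccontr)
          assume "\<nexists>x. pmf \<nu> x < pmf \<mu> x"
          then have le: "pmf \<mu> x \<le> pmf \<nu> x" for x by (simp add: not_less)
          let ?S = "set_pmf \<mu> \<union> set_pmf \<nu>"
          have s: "sum (pmf \<mu>) ?S = 1" "sum (pmf \<nu>) ?S = 1" using fin by (auto intro!: sum_pmf_eq_1)
          then have "(\<Sum>x\<in>?S. pmf \<nu> x - pmf \<mu> x) = 0" by (simp add: sum_subtractf)
          then have "\<forall>x\<in>?S. pmf \<nu> x - pmf \<mu> x = 0"
            using fin le by (subst (asm) sum_nonneg_eq_0_iff) auto
          then have "pmf \<mu> x = pmf \<nu> x" for x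
            by (metis UnCI right_minus_eq set_pmf_iff)
          then show False using ne pmf_eqI by blast
        qed
        then obtain x where x: "pmf \<nu> x < pmf \<mu> x" by blast
        then have xs: "x \<in> set_pmf \<mu>"
          by (metis not_less pmf_nonneg set_pmf_iff)
        let ?N = "set_pmf \<nu> - {x}"
        define \<delta> where "\<delta> = Min (insert 1 (d x ` ?N))"
        have \<delta>0: "\<delta> > 0"
        proof -
          have "d x y > 0" if "y \<in> ?N" for y
            using xs sub that D.zero[of x y] D.nonneg[of x y] by force
          then show ?thesis
            unfolding \<delta>_def using fin by (subst Min_gr_iff) auto
        qed
        have \<delta>: "\<delta> \<le> d x y" if "y \<in> ?N" for y
          unfolding \<delta>_def using fin that by (intro Min_le) auto
        have "\<delta> * (pmf \<mu> x - pmf \<nu> x) \<le> w" if w: "w \<in> W \<mu> \<nu>" for w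
        proof -
          obtain \<kappa> where k: "transport_plan \<mu> \<nu> \<kappa>" "w = cost \<mu> \<nu> \<kappa>"
            using w unfolding W_def by blast
          have nn: "0 \<le> \<kappa> x y" if "x \<in> set_pmf \<mu>" "y \<in> set_pmf \<nu>" for x y
            using k(1) that by (auto simp: transport_plan_def)
          have r: "(\<Sum>y\<in>set_pmf \<nu>. \<kappa> x y) = pmf \<mu> x"
            using k(1) xs by (auto simp: transport_plan_def)
          have "pmf \<mu> x - pmf \<nu> x \<le> (\<Sum>y\<in>?N. \<kappa> x y)"
          proof (cases "x \<in> set_pmf \<nu>")
            case True
            have "\<kappa> x x \<le> (\<Sum>x'\<in>set_pmf \<mu>. \<kappa> x' x)"
              using fin xs nn True by (intro member_le_sum) auto
            then have "\<kappa> x x \<le> pmf \<nu> x" using k(1) True by (auto simp: transport_plan_def)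
            then show ?thesis using r sum.remove[OF fin(2) True, of "\<kappa> x"] by linarith
          next
            case False
            then show ?thesis using r pmf_nonneg[of \<nu> x] by simp
          qed
          then have "\<delta> * (pmf \<mu> x - pmf \<nu> x) \<le> \<delta> * (\<Sum>y\<in>?N. \<kappa> x y)"
            using \<delta>0 by (intro mult_left_mono) auto
          also have "\<dots> = (\<Sum>y\<in>?N. \<kappa> x y * \<delta>)" by (simp add: sum_distrib_left mult.commute)
          also have "\<dots> \<le> (\<Sum>y\<in>?N. \<kappa> x y * d x y)"
            using \<delta> nn xs by (intro sum_mono mult_left_mono) auto
          also have "\<dots> \<le> (\<Sum>y\<in>set_pmf \<nu>. \<kappa> x y * d x y)"
            using fin nn xs by (intro sum_mono2) auto
          also have "\<dots> \<le> w"
            unfolding k(2) cost_def using fin xs nn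
            by (intro member_le_sum[of x _ "\<lambda>x. \<Sum>y\<in>set_pmf \<nu>. \<kappa> x y * d x y"])
               (auto intro!: sum_nonneg)
          finally show ?thesis .
        qed
        then have "\<delta> * (pmf \<mu> x - pmf \<nu> x) \<le> Inf (W \<mu> \<nu>)"
          using W_ne fin by (intro cInf_greatest) auto
        moreover have "0 < \<delta> * (pmf \<mu> x - pmf \<nu> x)" using \<delta>0 x by simp
        ultimately show False using zero fin by (simp add: was)
      qed
    qed
  next
    fix \<mu> \<nu> \<rho> assume "\<mu> \<in> fin_probs X" "\<nu> \<in> fin_probs X" "\<rho> \<in> fin_probs X"
    then have fin: "finite (set_pmf \<mu>)" "finite (set_pmf \<nu>)" "finite (set_pmf \<rho>)"
      and sub: "set_pmf \<mu> \<subseteq> X" "set_pmf \<nu> \<subseteq> X" "set_pmf \<rho> \<subseteq> X" by (auto simp: fin_probs_def)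
    have key: "Inf (W \<mu> \<rho>) \<le> u + v" if u: "u \<in> W \<mu> \<nu>" and v: "v \<in> W \<nu> \<rho>" for u v
    proof -
      obtain \<kappa> where k: "transport_plan \<mu> \<nu> \<kappa>" "u = cost \<mu> \<nu> \<kappa>"
        using u unfolding W_def by blast
      obtain l where l: "transport_plan \<nu> \<rho> l" "v = cost \<nu> \<rho> l"
        using v unfolding W_def by blast
      have pos: "pmf \<nu> y > 0" if "y \<in> set_pmf \<nu>" for y
        using that by (simp add: pmf_positive)
      have kn: "0 \<le> \<kappa> x y" if "x \<in> set_pmf \<mu>" "y \<in> set_pmf \<nu>" for x y
        using k(1) that by (auto simp: transport_plan_def)
      have ln: "0 \<le> l y z" if "y \<in> set_pmf \<nu>" "z \<in> set_pmf \<rho>" for y z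
        using l(1) that by (auto simp: transport_plan_def)
      have kr: "(\<Sum>y\<in>set_pmf \<nu>. \<kappa> x y) = pmf \<mu> x" if "x \<in> set_pmf \<mu>" for x
        using k(1) that by (auto simp: transport_plan_def)
      have kc: "(\<Sum>x\<in>set_pmf \<mu>. \<kappa> x y) = pmf \<nu> y" if "y \<in> set_pmf \<nu>" for y
        using k(1) that by (auto simp: transport_plan_def)
      have lr: "(\<Sum>z\<in>set_pmf \<rho>. l y z) = pmf \<nu> y" if "y \<in> set_pmf \<nu>" for y
        using l(1) that by (auto simp: transport_plan_def)
      have lc: "(\<Sum>y\<in>set_pmf \<nu>. l y z) = pmf \<rho> z" if "z \<in> set_pmf \<rho>" for z
        using l(1) that by (auto simp: transport_plan_def)
      define q where "q x y z = \<kappa> x y * l y z / pmf \<nu> y" for x y z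
      have q_z: "(\<Sum>z\<in>set_pmf \<rho>. q x y z) = \<kappa> x y" if "y \<in> set_pmf \<nu>" for x y
        using lr[OF that] pos[OF that]
        by (simp add: q_def flip: sum_divide_distrib sum_distrib_left)
      have q_x: "(\<Sum>x\<in>set_pmf \<mu>. q x y z) = l y z" if "y \<in> set_pmf \<nu>" for y z
        using kc[OF that] pos[OF that]
        by (simp add: q_def flip: sum_divide_distrib sum_distrib_right)
      have q_nn: "0 \<le> q x y z" if "x \<in> set_pmf \<mu>" "y \<in> set_pmf \<nu>" "z \<in> set_pmf \<rho>" for x y z
        using kn ln that by (simp add: q_def)
      define t where "t x z = (\<Sum>y\<in>set_pmf \<nu>. q x y z)" for x z
      have "transport_plan \<mu> \<rho> t"
        unfolding transport_plan_def
      proof (intro conjI ballI)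
        fix x z assume "x \<in> set_pmf \<mu>" "z \<in> set_pmf \<rho>"
        then show "0 \<le> t x z" unfolding t_def by (intro sum_nonneg q_nn)
      next
        fix x assume x: "x \<in> set_pmf \<mu>"
        have "(\<Sum>z\<in>set_pmf \<rho>. t x z) = (\<Sum>y\<in>set_pmf \<nu>. \<Sum>z\<in>set_pmf \<rho>. q x y z)"
          unfolding t_def by (rule sum.swap)
        then show "(\<Sum>z\<in>set_pmf \<rho>. t x z) = pmf \<mu> x" using kr[OF x] by (simp add: q_z)
      next
        fix z assume z: "z \<in> set_pmf \<rho>"
        have "(\<Sum>x\<in>set_pmf \<mu>. t x z) = (\<Sum>y\<in>set_pmf \<nu>. \<Sum>x\<in>set_pmf \<mu>. q x y z)"
          unfolding t_def by (rule sum.swap)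
        then show "(\<Sum>x\<in>set_pmf \<mu>. t x z) = pmf \<rho> z" using lc[OF z] by (simp add: q_x)
      qed
      then have "Inf (W \<mu> \<rho>) \<le> cost \<mu> \<rho> t"
        using bdd by (intro cInf_lower) (auto simp: W_def)
      also have "cost \<mu> \<rho> t = (\<Sum>x\<in>set_pmf \<mu>. \<Sum>z\<in>set_pmf \<rho>. \<Sum>y\<in>set_pmf \<nu>. q x y z * d x z)"
        by (simp add: cost_def t_def sum_distrib_right)
      also have "\<dots> \<le> (\<Sum>x\<in>set_pmf \<mu>. \<Sum>z\<in>set_pmf \<rho>. \<Sum>y\<in>set_pmf \<nu>. q x y z * d x y + q x y z * d y z)"
      proof (intro sum_mono)
        fix x y z assume a: "x \<in> set_pmf \<mu>" "z \<in> set_pmf \<rho>" "y \<in> set_pmf \<nu>"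
        then have "d x z \<le> d x y + d y z" using sub by (intro D.triangle) auto
        then show "q x y z * d x z \<le> q x y z * d x y + q x y z * d y z"
          using mult_left_mono[OF _ q_nn[OF a(1) a(3) a(2)]] by (simp flip: distrib_left)
      qed
      also have "\<dots> = (\<Sum>x\<in>set_pmf \<mu>. \<Sum>z\<in>set_pmf \<rho>. \<Sum>y\<in>set_pmf \<nu>. q x y z * d x y)
                   + (\<Sum>x\<in>set_pmf \<mu>. \<Sum>z\<in>set_pmf \<rho>. \<Sum>y\<in>set_pmf \<nu>. q x y z * d y z)"
        by (simp add: sum.distrib)
      also have "(\<Sum>x\<in>set_pmf \<mu>. \<Sum>z\<in>set_pmf \<rho>. \<Sum>y\<in>set_pmf \<nu>. q x y z * d x y)
          = (\<Sum>x\<in>set_pmf \<mu>. \<Sum>y\<in>set_pmf \<nu>. (\<Sum>z\<in>set_pmf \<rho>. q x y z) * d x y)"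
        unfolding sum_distrib_right by (intro sum.cong refl sum.swap)
      also have "\<dots> = u" by (simp add: q_z k(2) cost_def)
      also have "(\<Sum>x\<in>set_pmf \<mu>. \<Sum>z\<in>set_pmf \<rho>. \<Sum>y\<in>set_pmf \<nu>. q x y z * d y z)
          = (\<Sum>z\<in>set_pmf \<rho>. \<Sum>x\<in>set_pmf \<mu>. \<Sum>y\<in>set_pmf \<nu>. q x y z * d y z)"
        by (rule sum.swap)
      also have "\<dots> = (\<Sum>z\<in>set_pmf \<rho>. \<Sum>y\<in>set_pmf \<nu>. (\<Sum>x\<in>set_pmf \<mu>. q x y z) * d y z)"
        unfolding sum_distrib_right by (intro sum.cong refl sum.swap)
      also have "\<dots> = (\<Sum>z\<in>set_pmf \<rho>. \<Sum>y\<in>set_pmf \<nu>. l y z * d y z)" by (simp add: q_x)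
      also have "\<dots> = v" unfolding l(2) cost_def by (rule sum.swap)
      finally show ?thesis .
    qed
    have "Inf (W \<mu> \<rho>) - u \<le> Inf (W \<nu> \<rho>)" if "u \<in> W \<mu> \<nu>" for u
      using key[OF that] W_ne fin by (intro cInf_greatest) (auto simp: algebra_simps)
    then have "Inf (W \<mu> \<rho>) - Inf (W \<nu> \<rho>) \<le> Inf (W \<mu> \<nu>)"
      using W_ne fin by (intro cInf_greatest) (auto simp: algebra_simps)
    then show "wasserstein d \<mu> \<rho> \<le> wasserstein d \<mu> \<nu> + wasserstein d \<nu> \<rho>"
      using fin by (simp add: was)
  qed
qed


section \<open>Vietoris--Rips metric thickenings\<close>

definition diam :: "('a \<Rightarrow> 'a \<Rightarrow> real) \<Rightarrow> 'a set \<Rightarrow> real" where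
  "diam d S = Sup {d x y | x y. x \<in> S \<and> y \<in> S}"

definition VR_thickening :: "'a set \<Rightarrow> ('a \<Rightarrow> 'a \<Rightarrow> real) \<Rightarrow> real \<Rightarrow> 'a pmf topology" where
  "VR_thickening X d r =
     subtopology (Metric_space.mtopology (fin_probs X) (wasserstein d))
       {\<mu> \<in> fin_probs X. diam d (set_pmf \<mu>) \<le> r}"

abbreviation circle :: "complex set" where
  "circle \<equiv> sphere 0 1"

text \<open>\<^const>\<open>Arg\<close> takes values in \<open>(-\<pi>, \<pi>]\<close>, so this is the length of the shorter arc
  between two points of the unit circle.\<close>

definition circle_dist :: "complex \<Rightarrow> complex \<Rightarrow> real" where
  "circle_dist x y = \<bar>Arg (x / y)\<bar>"

lemma Metric_space_circle: "Metric_space circle circle_dist"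
proof
  show "0 \<le> circle_dist x y" for x y by (simp add: circle_dist_def)
  show "circle_dist x y = circle_dist y x" for x y
  proof -
    have "circle_dist y x = \<bar>Arg (inverse (x / y))\<bar>" by (simp add: circle_dist_def)
    also have "\<dots> = \<bar>Arg (x / y)\<bar>" by (subst Arg_inverse) simp
    finally show ?thesis by (simp add: circle_dist_def)
  qed
  have cis_Arg1: "cis (Arg z) = z" if "norm z = 1" for z
    using that by (metis cis_Arg div_by_1 norm_eq_zero of_real_1 scaleR_one sgn_eq zero_neq_one)
  show "circle_dist x y = 0 \<longleftrightarrow> x = y" if "x \<in> circle" "y \<in> circle" for x y
  proof
    have n: "norm (x / y) = 1" using that by (simp add: norm_divide)
    have y: "y \<noteq> 0" using that by auto
    show "x = y" if "circle_dist x y = 0"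
      using cis_Arg1[OF n] y that by (simp add: circle_dist_def)
    show "circle_dist x y = 0" if "x = y"
      using y that by (simp add: circle_dist_def Arg_eq_0)
  qed
  show "circle_dist x z \<le> circle_dist x y + circle_dist y z"
    if "x \<in> circle" "y \<in> circle" "z \<in> circle" for x y z
  proof -
    define a where "a = Arg (x / y)"
    define b where "b = Arg (y / z)"
    have nz: "y \<noteq> 0" using that by auto
    have "cis a = x / y" "cis b = y / z"
      unfolding a_def b_def using that by (simp_all add: cis_Arg1 norm_divide)
    then have c: "cis (a + b) = x / z" using nz by (simp flip: cis_mult)
    show ?thesis
    proof (cases "\<bar>a + b\<bar> < pi")
      case True
      then have "Arg (x / z) = a + b" by (subst c[symmetric], intro cis_Arg_unique) (auto simp: abs_less_iff)
      then show ?thesis by (simp add: circle_dist_def flip: a_def b_def)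
    next
      case False
      have "\<bar>Arg (x / z)\<bar> \<le> pi" using Arg_bounded[of "x / z"] by auto
      then show ?thesis using False by (simp add: circle_dist_def flip: a_def b_def)
    qed
  qed
qed


section \<open>Singular homology with coefficients in a field\<close>

text \<open>The library's singular chains have integer coefficients. The definitions below are
  the same as in \<^theory>\<open>HOL-Homology.Simplices\<close>, but with coefficients in \<open>'k\<close>; the singular
  simplices, their faces and their images under maps are those of the library.\<close>

type_synonym ('a, 'k) fchain = "((nat \<Rightarrow> real) \<Rightarrow> 'a) \<Rightarrow>\<^sub>0 'k"

definition fchain_set :: "nat \<Rightarrow> 'a topology \<Rightarrow> ('a, 'k::field) fchain set" where
  "fchain_set p X = {c. Poly_Mapping.keys c \<subseteq> singular_simplex_set p X}"

definition fchain_smult :: "'k::field \<Rightarrow> ('a, 'k) fchain \<Rightarrow> ('a, 'k) fchain" where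
  "fchain_smult a c = Poly_Mapping.map ((*) a) c"

definition fchain_boundary :: "nat \<Rightarrow> ('a, 'k::field) fchain \<Rightarrow> ('a, 'k) fchain" where
  "fchain_boundary p c =
     (if p = 0 then 0
      else \<Sum>s\<in>Poly_Mapping.keys c. \<Sum>i\<le>p.
             Poly_Mapping.single (singular_face p i s) ((-1) ^ i * Poly_Mapping.lookup c s))"

definition fchain_map :: "nat \<Rightarrow> ('a \<Rightarrow> 'b) \<Rightarrow> ('a, 'k::field) fchain \<Rightarrow> ('b, 'k) fchain" where
  "fchain_map p g c =
     (\<Sum>s\<in>Poly_Mapping.keys c. Poly_Mapping.single (simplex_map p g s) (Poly_Mapping.lookup c s))"

definition fcycles :: "nat \<Rightarrow> 'a topology \<Rightarrow> ('a, 'k::field) fchain set" where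
  "fcycles p X = {c \<in> fchain_set p X. fchain_boundary p c = 0}"

definition fboundaries :: "nat \<Rightarrow> 'a topology \<Rightarrow> ('a, 'k::field) fchain set" where
  "fboundaries p X = fchain_boundary (Suc p) ` fchain_set (Suc p) X"

text \<open>Vector spaces over \<open>'k\<close> are \<^typ>\<open>('k, 'v) module\<close> records. Such a record extends a ring
  record, whose fields \<^const>\<open>mult\<close> and \<^const>\<open>one\<close> play no role for a vector space.

  Elements of homology are cosets of the space of boundaries. Boundaries are added again in the
  scalar multiple because \<open>0\<close> times a coset is only the set \<open>{0}\<close>.\<close>

definition fhomology :: "nat \<Rightarrow> 'a topology \<Rightarrow> ('k::field, ('a, 'k) fchain set) module" where
  "fhomology p X =
     \<lparr>carrier = {{z + b | b. b \<in> fboundaries p X} | z. z \<in> fcycles p X},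
      mult = undefined, one = undefined,
      zero = fboundaries p X,
      add = (\<lambda>S T. {s + t | s t. s \<in> S \<and> t \<in> T}),
      smult = (\<lambda>a S. {fchain_smult a s + b | s b. s \<in> S \<and> b \<in> fboundaries p X})\<rparr>"

text \<open>The map induced by a continuous \<open>g\<close> into \<open>Y\<close>; it sends the class of \<open>z\<close> to the class of
  its image chain.\<close>

definition fhom_induced ::
  "nat \<Rightarrow> 'b topology \<Rightarrow> ('a \<Rightarrow> 'b) \<Rightarrow> ('a, 'k::field) fchain set \<Rightarrow> ('b, 'k) fchain set" where
  "fhom_induced p Y g S = {fchain_map p g s + b | s b. s \<in> S \<and> b \<in> fboundaries p Y}"


section \<open>Persistence modules over the reals\<close>

text \<open>Only the maps \<open>pmap M r s\<close> with \<open>r \<le> s\<close>, on the carrier of \<open>pspace M r\<close>, are relevant.\<close>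

record ('k, 'v) pers_module =
  pspace :: "real \<Rightarrow> ('k, 'v) module"
  pmap :: "real \<Rightarrow> real \<Rightarrow> 'v \<Rightarrow> 'v"

definition linear_iso :: "('k, 'v) module \<Rightarrow> ('k, 'w) module \<Rightarrow> ('v \<Rightarrow> 'w) \<Rightarrow> bool" where
  "linear_iso V W f \<longleftrightarrow>
     f \<in> iso (add_monoid V) (add_monoid W) \<and>
     (\<forall>a. \<forall>v\<in>carrier V. f (a \<odot>\<^bsub>V\<^esub> v) = a \<odot>\<^bsub>W\<^esub> f v)"

definition pers_isomorphic :: "('k, 'v) pers_module \<Rightarrow> ('k, 'w) pers_module \<Rightarrow> bool" where
  "pers_isomorphic M N \<longleftrightarrow>
     (\<exists>\<eta>. (\<forall>r. linear_iso (pspace M r) (pspace N r) (\<eta> r)) \<and>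
          (\<forall>r s. r \<le> s \<longrightarrow>
             (\<forall>v\<in>carrier (pspace M r). \<eta> s (pmap M r s v) = pmap N r s (\<eta> r v))))"

definition interval_module :: "real set \<Rightarrow> ('k::field, 'k) pers_module" where
  "interval_module J =
     \<lparr>pspace = (\<lambda>r. \<lparr>carrier = (if r \<in> J then UNIV else {0}),
                     mult = undefined, one = undefined,
                     zero = 0, add = (+), smult = (*)\<rparr>),
      pmap = (\<lambda>r s v. if r \<in> J \<and> s \<in> J then v else 0)\<rparr>"

definition pers_direct_sum ::
  "'i set \<Rightarrow> ('i \<Rightarrow> ('k, 'v) pers_module) \<Rightarrow> ('k, 'i \<Rightarrow> 'v) pers_module" where
  "pers_direct_sum I M =
     \<lparr>pspace = (\<lambda>r. \<lparr>carrier = {f \<in> \<Pi>\<^sub>E i\<in>I. carrier (pspace (M i) r).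
                                  finite {i \<in> I. f i \<noteq> zero (pspace (M i) r)}},
                     mult = undefined, one = undefined,
                     zero = (\<lambda>i\<in>I. zero (pspace (M i) r)),
                     add = (\<lambda>f g. \<lambda>i\<in>I. add (pspace (M i) r) (f i) (g i)),
                     smult = (\<lambda>a f. \<lambda>i\<in>I. smult (pspace (M i) r) a (f i))\<rparr>),
      pmap = (\<lambda>r s f. \<lambda>i\<in>I. pmap (M i) r s (f i))\<rparr>"

text \<open>The bars of \<open>M\<close> are the intervals \<open>J i\<close> for \<open>i \<in> I\<close>; the indexing accounts for
  multiplicities.\<close>

definition has_bars :: "('k::field, 'v) pers_module \<Rightarrow> 'i set \<Rightarrow> ('i \<Rightarrow> real set) \<Rightarrow> bool" where
  "has_bars M I J \<longleftrightarrow>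
     (\<forall>i\<in>I. is_interval (J i) \<and> J i \<noteq> {}) \<and>
     pers_isomorphic M (pers_direct_sum I (\<lambda>i. interval_module (J i)))"

text \<open>The persistent homology of a filtration by subspaces of a common space, so that the
  inclusions are given by the identity function.\<close>

definition persistent_homology ::
  "'k::field itself \<Rightarrow> nat \<Rightarrow> (real \<Rightarrow> 'a topology) \<Rightarrow> ('k, ('a, 'k) fchain set) pers_module"
  where
  "persistent_homology _ n F =
     \<lparr>pspace = (\<lambda>r. fhomology n (F r)), pmap = (\<lambda>r s. fhom_induced n (F s) id)\<rparr>"

end

theory Submission
  imports Defs "HOL-Computational_Algebra.Fundamental_Theorem_Algebra"
begin

text \<open>
  Put \<open>n = 2k + 1\<close>. The odd moments \<open>\<integral> z\<^sup>j d\<mu>\<close> with \<open>j \<le> n\<close> are coordinates of a map from the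
  thickening to a real vector space of dimension \<open>2k + 2\<close>. It is natural in \<open>r\<close>, and it avoids the
  origin for \<open>r < (2k + 2)\<pi>/(2k + 3)\<close>: the support of \<open>\<mu>\<close> then has so few alternations with its antipode that
  an odd trigonometric polynomial of degree at most \<open>n\<close> is positive on it.

  The point is that this map is a homotopy equivalence onto the punctured space as soon as
  \<open>r \<ge> 2k\<pi>/(2k + 1)\<close>. An odd trigonometric polynomial \<open>f\<close> of degree at most \<open>n\<close> is given by a
  complex polynomial with \<open>n\<close> roots. The average of the harmonic measures of these roots is the
  derivative of a monotone map \<open>\<rho>\<close> of the circle that commutes with the antipode and jumps by at
  least \<open>\<pi>/n\<close> at every sign change of \<open>f\<close>; so \<open>\<rho>\<close> moves the set \<open>f > 0\<close> into a set of diameter at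
  most \<open>\<pi> - \<pi>/n = 2k\<pi>/(2k + 1)\<close>, and the straight-line homotopy from the identity to \<open>\<rho>\<close> does not
  increase diameters beyond \<open>r\<close>. Pushing a measure on \<open>f > 0\<close> forward along \<open>\<rho>\<close> gives the homotopy
  inverse. If \<open>f\<close> is the polynomial whose coefficients are the moments of \<open>\<mu>\<close>, then
  \<open>\<integral> f d\<mu> > 0\<close>, so \<open>\<mu>\<close> can be deformed linearly to its positive part \<open>f\<^sup>+\<mu>\<close> and moved by \<open>\<rho>\<close> from
  there. Since \<open>f\<^sup>+\<close> vanishes where \<open>\<rho>\<close> jumps, everything is continuous.

  For \<open>r \<ge> \<pi>\<close> the thickening is convex. The homology of punctured space over a field is computed
  from the integral chain operators of the library, extended linearly.
\<close>

section \<open>Linear extension of integral chain operators\<close>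

text \<open>The right endpoint of a bar comes from a count. Along a half turn from a support point
  to its antipode the number of label changes is odd, and each uses up an angle of at least
  \<open>\<epsilon> = pi - r\<close>. So \<open>pi < (2 * k + 3) * \<epsilon>\<close> leaves at most
  \<open>2 * k + 1\<close> changes, which a product of that many sines realises. The same count with
  \<open>\<epsilon> = pi / n\<close> shows that moments do not vanish while a measure is being
  collapsed.

  The obstacle is continuity: supports jump, and \<open>\<rho>\<close> jumps both in the angle and
  in the coefficients. The Wasserstein topology is therefore described by integrals of continuous
  functions, so that a homotopy only needs continuous integrals. The inverse map also needs, for
  each form, a measure on its positive set that depends continuously on the form; a fixed measure on
  roots of unity, weighted by the positive part of the form, provides it.

  Neither the moment map nor the chosen generator of punctured space depends on \<open>r\<close>.
  One linear functional therefore serves a whole bar, and the structure maps become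
  identities.\<close>

definition fchain_of_int :: "'a chain \<Rightarrow> ('a, 'k::field) fchain" where
  "fchain_of_int c = Poly_Mapping.map of_int c"

text \<open>Operators are encoded by their integral versions \<open>T\<close>, of which only the
  values on single simplices enter. Identities checked there for integral chains pass to
  coefficients in \<open>'k\<close> through \<open>fext_cong\<close>.\<close>

definition fext :: "('a chain \<Rightarrow> 'b chain) \<Rightarrow> ('a, 'k::field) fchain \<Rightarrow> ('b, 'k) fchain" where
  "fext T c = (\<Sum>s\<in>Poly_Mapping.keys c.
     fchain_smult (Poly_Mapping.lookup c s) (fchain_of_int (T (frag_of s))))"

text \<open>Additivity phrased with differences, the form in which \<open>frag_induction\<close> and
  the integral chain lemmas are stated.\<close>

definition subtractive :: "('a::minus \<Rightarrow> 'b::minus) \<Rightarrow> bool" where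
  "subtractive T \<longleftrightarrow> (\<forall>x y. T (x - y) = T x - T y)"

lemma lookup_fchain_of_int [simp]:
  "Poly_Mapping.lookup (fchain_of_int c) s = of_int (Poly_Mapping.lookup c s)"
  by (simp add: fchain_of_int_def map.rep_eq when_def)

lemma lookup_fchain_smult [simp]:
  "Poly_Mapping.lookup (fchain_smult a c) s = a * Poly_Mapping.lookup c s"
  by (simp add: fchain_smult_def map.rep_eq when_def)

lemma lookup_fext:
  "Poly_Mapping.lookup (fext T c) t =
     (\<Sum>s\<in>Poly_Mapping.keys c. Poly_Mapping.lookup c s * of_int (Poly_Mapping.lookup (T (frag_of s)) t))"
  by (simp add: fext_def lookup_sum)

lemma lookup_fext_superset:
  assumes "finite K" "Poly_Mapping.keys c \<subseteq> K"
  shows "Poly_Mapping.lookup (fext T c) t =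
     (\<Sum>s\<in>K. Poly_Mapping.lookup c s * of_int (Poly_Mapping.lookup (T (frag_of s)) t))"
  unfolding lookup_fext using assms
  by (intro sum.mono_neutral_left) (auto simp: in_keys_iff)

lemma fext_0 [simp]: "fext T 0 = 0"
  by (simp add: fext_def)

lemma fext_add: "fext T (x + y) = fext T x + fext T y"
proof (rule poly_mapping_eqI)
  fix t
  let ?K = "Poly_Mapping.keys x \<union> Poly_Mapping.keys y"
  have *: "finite ?K" "Poly_Mapping.keys x \<subseteq> ?K" "Poly_Mapping.keys y \<subseteq> ?K" "Poly_Mapping.keys (x + y) \<subseteq> ?K"
    using keys_add[of x y] by auto
  show "Poly_Mapping.lookup (fext T (x + y)) t = Poly_Mapping.lookup (fext T x + fext T y) t"
    by (simp add: lookup_fext_superset[OF *(1,4)] lookup_fext_superset[OF *(1,2)]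
        lookup_fext_superset[OF *(1,3)] lookup_add distrib_right sum.distrib)
qed

lemma fext_smult: "fext T (fchain_smult a x) = fchain_smult a (fext T x)"
proof (rule poly_mapping_eqI)
  fix t
  have *: "Poly_Mapping.keys (fchain_smult a x) \<subseteq> Poly_Mapping.keys x"
    by (auto simp: in_keys_iff)
  show "Poly_Mapping.lookup (fext T (fchain_smult a x)) t = Poly_Mapping.lookup (fchain_smult a (fext T x)) t"
    unfolding lookup_fext_superset[OF finite_keys *] lookup_fchain_smult
    by (simp add: lookup_fext sum_distrib_left mult.assoc)
qed

lemma fchain_smult_add_left: "fchain_smult (a + b) x = fchain_smult a x + fchain_smult b x"
  by (rule poly_mapping_eqI) (simp add: lookup_add distrib_right)

lemma fchain_smult_smult: "fchain_smult a (fchain_smult b x) = fchain_smult (a * b) x"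
  by (rule poly_mapping_eqI) (simp add: mult.assoc)

lemma fchain_smult_0 [simp]: "fchain_smult 0 x = 0" "fchain_smult a 0 = 0"
  by (rule poly_mapping_eqI, simp)+

lemma fchain_smult_1 [simp]: "fchain_smult 1 x = x"
  by (rule poly_mapping_eqI) simp

lemma fchain_smult_minus1: "fchain_smult (- 1) x = - x"
  by (rule poly_mapping_eqI) simp

lemma fchain_smult_diff: "fchain_smult a (x - y) = fchain_smult a x - fchain_smult a y"
  by (rule poly_mapping_eqI) (simp add: lookup_minus right_diff_distrib)

lemma fext_minus: "fext T (- x) = - fext T x"
  using fext_smult[of T "-1" x] by (simp add: fchain_smult_minus1)

lemma fext_diff: "fext T (x - y) = fext T x - fext T y"
  using fext_add[of T x "- y"] by (simp add: fext_minus)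

lemma fext_sum: "fext T (sum f I) = (\<Sum>i\<in>I. fext T (f i))"
  by (induction I rule: infinite_finite_induct) (auto simp: fext_add)

lemma fchain_of_int_diff: "fchain_of_int (x - y) = fchain_of_int x - fchain_of_int y"
  by (rule poly_mapping_eqI) (simp add: lookup_minus)

lemma fchain_of_int_0 [simp]: "fchain_of_int 0 = 0"
  by (rule poly_mapping_eqI) simp

lemma fchain_of_int_frag_of: "fchain_of_int (frag_of s) = Poly_Mapping.single s 1"
  by (rule poly_mapping_eqI) (simp add: lookup_single when_def)

lemma fext_single: "fext T (Poly_Mapping.single s a) = fchain_smult a (fchain_of_int (T (frag_of s)))"
  by (auto simp: fext_def)

lemma subtractive_0:
  fixes T :: "'a::group_add \<Rightarrow> 'b::group_add"
  assumes "subtractive T" shows "T 0 = 0"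
proof -
  have "T (0 - 0) = T 0 - T 0" using assms unfolding subtractive_def by blast
  then show ?thesis by simp
qed

lemma fext_fchain_of_int:
  assumes "subtractive T"
  shows "fext T (fchain_of_int x) = fchain_of_int (T x)"
proof -
  have "Poly_Mapping.keys x \<subseteq> UNIV" by simp
  then show ?thesis
  proof (induction x rule: frag_induction)
    case zero
    then show ?case by (simp add: subtractive_0[OF assms])
  next
    case (one x)
    then show ?case by (simp add: fchain_of_int_frag_of fext_single)
  next
    case (diff a b)
    then show ?case using assms by (simp add: fchain_of_int_diff fext_diff subtractive_def)
  qed
qed

text \<open>\<open>T (frag_of s)\<close> is a combination of simplices, and additivity of
  \<open>S\<close> is what expands \<open>S\<close> over it.\<close>

lemma fext_fext:
  assumes "subtractive S"
  shows "fext S (fext T c) = fext (\<lambda>x. S (T x)) c"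
  by (simp add: fext_def[of T] fext_def[of "\<lambda>x. S (T x)"] fext_sum fext_smult fext_fchain_of_int[OF assms])

lemma fext_cong:
  assumes "\<And>s. s \<in> Poly_Mapping.keys c \<Longrightarrow> S (frag_of s) = T (frag_of s)"
  shows "fext S c = fext T c"
  unfolding fext_def using assms by (intro sum.cong) auto

lemma fext_op_diff: "fext (\<lambda>x. S x - T x) c = fext S c - fext T c"
  by (rule poly_mapping_eqI) (simp add: lookup_fext lookup_minus right_diff_distrib sum_subtractf)

lemma fext_id [simp]: "fext (\<lambda>x. x) c = c"
proof (rule poly_mapping_eqI)
  fix t
  have "Poly_Mapping.lookup (fext (\<lambda>x. x) c) t = (\<Sum>s\<in>Poly_Mapping.keys c. if s = t then Poly_Mapping.lookup c s else 0)"
    unfolding lookup_fext by (intro sum.cong) (auto simp: lookup_single)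
  then show "Poly_Mapping.lookup (fext (\<lambda>x. x) c) t = Poly_Mapping.lookup c t"
    by (auto simp: sum.delta' in_keys_iff)
qed

lemma keys_fext:
  "Poly_Mapping.keys (fext T c) \<subseteq> (\<Union>s\<in>Poly_Mapping.keys c. Poly_Mapping.keys (T (frag_of s)))"
proof
  fix t assume "t \<in> Poly_Mapping.keys (fext T c)"
  then have "(\<Sum>s\<in>Poly_Mapping.keys c. Poly_Mapping.lookup c s * of_int (Poly_Mapping.lookup (T (frag_of s)) t)) \<noteq> 0"
    by (simp add: in_keys_iff lookup_fext)
  then obtain s where s: "s \<in> Poly_Mapping.keys c"
      "Poly_Mapping.lookup c s * of_int (Poly_Mapping.lookup (T (frag_of s)) t) \<noteq> 0"
    by (meson sum.neutral)
  then have "Poly_Mapping.lookup (T (frag_of s)) t \<noteq> 0" by auto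
  then show "t \<in> (\<Union>s\<in>Poly_Mapping.keys c. Poly_Mapping.keys (T (frag_of s)))"
    using s(1) by (meson UN_I in_keys_iff)
qed

lemma fchain_set_fext:
  assumes "c \<in> fchain_set p X" "\<And>s. singular_simplex p X s \<Longrightarrow> singular_chain q Y (T (frag_of s))"
  shows "fext T c \<in> fchain_set q Y"
proof -
  have "t \<in> singular_simplex_set q Y" if t: "t \<in> Poly_Mapping.keys (fext T c)" for t
  proof -
    obtain s where s: "s \<in> Poly_Mapping.keys c" "t \<in> Poly_Mapping.keys (T (frag_of s))"
      using subsetD[OF keys_fext t] by (rule UN_E)
    have "singular_simplex p X s" using assms(1) s(1) by (auto simp: fchain_set_def)
    from assms(2)[OF this] show ?thesis using s(2) unfolding singular_chain_def by (rule subsetD)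
  qed
  then show ?thesis by (auto simp: fchain_set_def)
qed

lemma fchain_boundary_eq_fext:
  fixes c :: "('a, 'k::field) fchain"
  shows "fchain_boundary p c = fext (chain_boundary p) c"
proof (cases "p = 0")
  case True
  then show ?thesis by (intro poly_mapping_eqI) (simp add: fchain_boundary_def lookup_fext chain_boundary_def)
next
  case False
  have "(\<Sum>i\<le>p. Poly_Mapping.single (singular_face p i s) ((- 1) ^ i * a)) =
       fchain_smult a (fchain_of_int (chain_boundary p (frag_of s)))" for s :: "(nat \<Rightarrow> real) \<Rightarrow> 'a" and a :: 'k
  proof (rule poly_mapping_eqI)
    fix t
    have "Poly_Mapping.lookup (\<Sum>i\<le>p. Poly_Mapping.single (singular_face p i s) ((- 1) ^ i * a)) t
       = (\<Sum>i\<le>p. a * of_int ((-1)^i * Poly_Mapping.lookup (frag_of (singular_face p i s)) t))"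
      unfolding lookup_sum by (intro sum.cong refl) (auto simp: lookup_single when_def)
    also have "\<dots> = Poly_Mapping.lookup (fchain_smult a (fchain_of_int (chain_boundary p (frag_of s)))) t"
      using False by (simp add: chain_boundary_of lookup_sum sum_distrib_left of_int_sum)
    finally show "Poly_Mapping.lookup (\<Sum>i\<le>p. Poly_Mapping.single (singular_face p i s) ((- 1) ^ i * a)) t = \<dots>" .
  qed
  then show ?thesis using False by (simp add: fchain_boundary_def fext_def)
qed

lemma fchain_map_eq_fext:
  fixes c :: "('a, 'k::field) fchain"
  shows "fchain_map p g c = fext (chain_map p g) c"
proof -
  have "Poly_Mapping.single (simplex_map p g s) a = fchain_smult a (fchain_of_int (chain_map p g (frag_of s)))"
    for s and a :: 'k
    by (rule poly_mapping_eqI) (simp add: fchain_of_int_frag_of lookup_single when_def)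
  then show ?thesis by (simp add: fchain_map_def fext_def)
qed

lemma subtractive_chain_boundary [simp]: "subtractive (chain_boundary p)"
  by (simp add: subtractive_def chain_boundary_diff)

lemma subtractive_chain_map [simp]: "subtractive (chain_map p g)"
  by (simp add: subtractive_def chain_map_diff)

lemma fchain_map_linear:
  "fchain_map p g (x + y) = fchain_map p g x + fchain_map p g y"
  "fchain_map p g (x - y) = fchain_map p g x - fchain_map p g y"
  "fchain_map p g (- x) = - fchain_map p g x"
  "fchain_map p g (fchain_smult a x) = fchain_smult a (fchain_map p g x)"
  "fchain_map p g 0 = 0"
  by (simp_all add: fchain_map_eq_fext fext_add fext_diff fext_minus fext_smult)

lemma fchain_boundary_linear:
  "fchain_boundary p (x + y) = fchain_boundary p x + fchain_boundary p y"
  "fchain_boundary p (x - y) = fchain_boundary p x - fchain_boundary p y"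
  "fchain_boundary p (- x) = - fchain_boundary p x"
  "fchain_boundary p (fchain_smult a x) = fchain_smult a (fchain_boundary p x)"
  "fchain_boundary p 0 = 0"
  by (simp_all add: fchain_boundary_eq_fext fext_add fext_diff fext_minus fext_smult)

lemma fchain_set_closed:
  "0 \<in> fchain_set p X"
  "x \<in> fchain_set p X \<Longrightarrow> y \<in> fchain_set p X \<Longrightarrow> x + y \<in> fchain_set p X"
  "x \<in> fchain_set p X \<Longrightarrow> y \<in> fchain_set p X \<Longrightarrow> x - y \<in> fchain_set p X"
  "x \<in> fchain_set p X \<Longrightarrow> - x \<in> fchain_set p X"
  "x \<in> fchain_set p X \<Longrightarrow> fchain_smult a x \<in> fchain_set p X"
proof -
  have iff: "c \<in> fchain_set p X \<longleftrightarrow> (\<forall>s. \<not> singular_simplex p X s \<longrightarrow> Poly_Mapping.lookup c s = 0)"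
    for c :: "('a, 'k::field) fchain"
    by (auto simp: fchain_set_def in_keys_iff subset_iff)
  show "0 \<in> fchain_set p X"
    "x \<in> fchain_set p X \<Longrightarrow> y \<in> fchain_set p X \<Longrightarrow> x + y \<in> fchain_set p X"
    "x \<in> fchain_set p X \<Longrightarrow> y \<in> fchain_set p X \<Longrightarrow> x - y \<in> fchain_set p X"
    "x \<in> fchain_set p X \<Longrightarrow> - x \<in> fchain_set p X"
    "x \<in> fchain_set p X \<Longrightarrow> fchain_smult a x \<in> fchain_set p X"
    by (simp_all add: iff lookup_add lookup_minus)
qed

lemma fchain_set_mono:
  "x \<in> fchain_set p (subtopology X S) \<Longrightarrow> S \<subseteq> T \<Longrightarrow> x \<in> fchain_set p (subtopology X T)"
  unfolding fchain_set_def using singular_simplex_mono by blast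

lemma fchain_set_subtopology:
  "x \<in> fchain_set p (subtopology X S) \<Longrightarrow> x \<in> fchain_set p X"
  unfolding fchain_set_def by (auto simp: singular_simplex_subtopology)

lemma fchain_set_Int:
  "x \<in> fchain_set p (subtopology X S) \<Longrightarrow> x \<in> fchain_set p (subtopology X T)
   \<Longrightarrow> x \<in> fchain_set p (subtopology X (S \<inter> T))"
  unfolding fchain_set_def by (auto simp: singular_simplex_subtopology subset_iff)

lemma fchain_set_boundary:
  "x \<in> fchain_set p X \<Longrightarrow> fchain_boundary p x \<in> fchain_set (p - 1) X"
  unfolding fchain_boundary_eq_fext
proof (erule fchain_set_fext)
  fix s assume "singular_simplex p X s"
  then show "singular_chain (p - 1) X (chain_boundary p (frag_of s))"
    using singular_chain_boundary[of p X "frag_of s"] by (simp add: singular_chain_of)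
qed

lemma fchain_set_map:
  "x \<in> fchain_set p X \<Longrightarrow> continuous_map X Y g \<Longrightarrow> fchain_map p g x \<in> fchain_set p Y"
  unfolding fchain_map_eq_fext
  by (erule fchain_set_fext) (simp add: singular_chain_of singular_simplex_simplex_map)

lemma fchain_boundary_boundary:
  assumes "x \<in> fchain_set (Suc p) X"
  shows "fchain_boundary p (fchain_boundary (Suc p) x) = 0"
proof -
  have "fchain_boundary p (fchain_boundary (Suc p) x) = fext (\<lambda>x. 0) x"
    unfolding fchain_boundary_eq_fext fext_fext[OF subtractive_chain_boundary]
  proof (rule fext_cong)
    fix s assume "s \<in> Poly_Mapping.keys x"
    then have "singular_chain (Suc p) X (frag_of s)" using assms by (auto simp: fchain_set_def singular_chain_of)
    then show "chain_boundary p (chain_boundary (Suc p) (frag_of s)) = 0"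
      by (rule chain_boundary_boundary_alt)
  qed
  then show ?thesis by (simp add: fext_def)
qed

lemma fchain_boundary_map:
  assumes "x \<in> fchain_set p X"
  shows "fchain_boundary p (fchain_map p g x) = fchain_map (p - 1) g (fchain_boundary p x)"
  unfolding fchain_boundary_eq_fext fchain_map_eq_fext
    fext_fext[OF subtractive_chain_boundary] fext_fext[OF subtractive_chain_map]
proof (rule fext_cong)
  fix s assume "s \<in> Poly_Mapping.keys x"
  then have "singular_chain p X (frag_of s)" using assms by (auto simp: fchain_set_def singular_chain_of)
  then show "chain_boundary p (chain_map p g (frag_of s)) = chain_map (p - 1) g (chain_boundary p (frag_of s))"
    using chain_boundary_chain_map by (metis One_nat_def)
qed

lemma fchain_map_compose: "fchain_map p (h \<circ> g) x = fchain_map p h (fchain_map p g x)"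
  unfolding fchain_map_eq_fext fext_fext[OF subtractive_chain_map]
  by (rule fext_cong) (simp add: chain_map_compose)

lemma fchain_map_id:
  assumes "x \<in> fchain_set p X"
  shows "fchain_map p id x = x"
proof -
  have "fchain_map p id x = fext (\<lambda>x. x) x"
    unfolding fchain_map_eq_fext
  proof (rule fext_cong)
    fix s assume "s \<in> Poly_Mapping.keys x"
    then have "singular_simplex p X s" using assms by (auto simp: fchain_set_def)
    then show "chain_map p id (frag_of s) = frag_of s"
      by (metis chain_map_of simplex_map_id_gen id_apply)
  qed
  then show ?thesis by simp
qed

section \<open>Cycles and boundaries\<close>

lemma fboundaries_closed:
  "0 \<in> fboundaries p X"
  "x \<in> fboundaries p X \<Longrightarrow> y \<in> fboundaries p X \<Longrightarrow> x + y \<in> fboundaries p X"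
  "x \<in> fboundaries p X \<Longrightarrow> y \<in> fboundaries p X \<Longrightarrow> x - y \<in> fboundaries p X"
  "x \<in> fboundaries p X \<Longrightarrow> - x \<in> fboundaries p X"
  "x \<in> fboundaries p X \<Longrightarrow> fchain_smult a x \<in> fboundaries p X"
proof -
  show "0 \<in> fboundaries p X"
    unfolding fboundaries_def using fchain_boundary_linear(5) fchain_set_closed(1) by (metis image_eqI)
  show "x \<in> fboundaries p X \<Longrightarrow> y \<in> fboundaries p X \<Longrightarrow> x + y \<in> fboundaries p X"
    unfolding fboundaries_def by (auto simp: fchain_set_closed(2) simp flip: fchain_boundary_linear)
  show "x \<in> fboundaries p X \<Longrightarrow> y \<in> fboundaries p X \<Longrightarrow> x - y \<in> fboundaries p X"
    unfolding fboundaries_def by (auto simp: fchain_set_closed(3) simp flip: fchain_boundary_linear)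
  show "x \<in> fboundaries p X \<Longrightarrow> - x \<in> fboundaries p X"
    unfolding fboundaries_def by (auto simp: fchain_set_closed(4) simp flip: fchain_boundary_linear)
  show "x \<in> fboundaries p X \<Longrightarrow> fchain_smult a x \<in> fboundaries p X"
    unfolding fboundaries_def by (auto simp: fchain_set_closed(5) simp flip: fchain_boundary_linear)
qed

lemma fcycles_closed:
  "0 \<in> fcycles p X"
  "x \<in> fcycles p X \<Longrightarrow> y \<in> fcycles p X \<Longrightarrow> x + y \<in> fcycles p X"
  "x \<in> fcycles p X \<Longrightarrow> y \<in> fcycles p X \<Longrightarrow> x - y \<in> fcycles p X"
  "x \<in> fcycles p X \<Longrightarrow> - x \<in> fcycles p X"
  "x \<in> fcycles p X \<Longrightarrow> fchain_smult a x \<in> fcycles p X"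
  by (auto simp: fcycles_def fchain_boundary_linear fchain_set_closed)

lemma fboundaries_subset_fcycles: "fboundaries p X \<subseteq> fcycles p X"
proof
  fix x assume "x \<in> fboundaries p X"
  then obtain d where "d \<in> fchain_set (Suc p) X" "x = fchain_boundary (Suc p) d"
    by (auto simp: fboundaries_def)
  then show "x \<in> fcycles p X"
    using fchain_boundary_boundary[of d p X] fchain_set_boundary[of d "Suc p" X] by (simp add: fcycles_def)
qed

lemma fcycles_map:
  "x \<in> fcycles p X \<Longrightarrow> continuous_map X Y g \<Longrightarrow> fchain_map p g x \<in> fcycles p Y"
  by (auto simp: fcycles_def fchain_set_map fchain_boundary_map fchain_map_linear)

lemma fboundaries_map:
  assumes "x \<in> fboundaries p X" "continuous_map X Y g"
  shows "fchain_map p g x \<in> fboundaries p Y"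
proof -
  obtain d where d: "d \<in> fchain_set (Suc p) X" "x = fchain_boundary (Suc p) d"
    using assms(1) by (auto simp: fboundaries_def)
  then have "fchain_map p g x = fchain_boundary (Suc p) (fchain_map (Suc p) g d)"
    by (simp add: fchain_boundary_map)
  then show ?thesis using d assms(2) by (auto simp: fboundaries_def fchain_set_map)
qed

section \<open>Homotopy invariance\<close>

abbreviation simplex_top :: "nat \<Rightarrow> (nat \<Rightarrow> real) topology" where
  "simplex_top p \<equiv> subtopology (powertop_real UNIV) (standard_simplex p)"

abbreviation unit_top :: "real topology" where
  "unit_top \<equiv> top_of_set {0..1}"

abbreviation id_chain :: "nat \<Rightarrow> (nat \<Rightarrow> real) chain" where
  "id_chain p \<equiv> frag_of (restrict id (standard_simplex p))"

text \<open>A natural operator is determined by its value on the identity simplex. Here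
  \<open>d\<close> is that value, a chain on the model cylinder, carried to each simplex
  \<open>\<sigma>\<close> by \<open>\<sigma>\<close> times the identity.\<close>

definition prism_op :: "nat \<Rightarrow> ((nat \<Rightarrow> real) \<times> real) chain \<Rightarrow> 'a chain \<Rightarrow> ('a \<times> real) chain" where
  "prism_op p d = frag_extend (\<lambda>\<sigma>. chain_map (Suc p) (map_prod \<sigma> id) d)"

lemma contractible_space_star:
  fixes S :: "(nat \<Rightarrow> real) set"
  assumes "a \<in> S" and seg: "\<And>x t. x \<in> S \<Longrightarrow> 0 \<le> t \<Longrightarrow> t \<le> 1 \<Longrightarrow> (\<lambda>i. (1 - t) * x i + t * a i) \<in> S"
  shows "contractible_space (subtopology (powertop_real UNIV) S)"
proof -
  let ?X = "subtopology (powertop_real UNIV) S"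
  let ?h = "\<lambda>(t, x). (\<lambda>i. (1 - t) * x i + t * a i)"
  have "continuous_map (prod_topology unit_top ?X) (powertop_real UNIV) ?h"
    unfolding continuous_map_componentwise_UNIV
  proof
    fix i
    have "continuous_map (prod_topology unit_top ?X) euclideanreal (\<lambda>z. fst z)"
      using continuous_map_fst continuous_map_into_fulltopology by blast
    moreover have "continuous_map ?X euclideanreal (\<lambda>x. x i)"
      by (intro continuous_map_from_subtopology continuous_map_product_projection) auto
    then have "continuous_map (prod_topology unit_top ?X) euclideanreal ((\<lambda>x. x i) \<circ> snd)"
      using continuous_map_compose continuous_map_snd by blast
    ultimately show "continuous_map (prod_topology unit_top ?X) euclideanreal (\<lambda>z. ?h z i)"
      by (auto simp: case_prod_unfold o_def intro!: continuous_intros)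
  qed
  moreover have "?h \<in> topspace (prod_topology unit_top ?X) \<rightarrow> S"
    using seg by auto
  ultimately have "continuous_map (prod_topology unit_top ?X) ?X ?h"
    by (simp add: continuous_map_in_subtopology)
  then show ?thesis
    unfolding contractible_space_def homotopic_with_def by (intro exI[of _ a] exI[of _ ?h]) auto
qed

lemma contractible_simplex_top: "contractible_space (simplex_top p)"
proof -
  obtain a where a: "a \<in> standard_simplex p" using nonempty_standard_simplex by blast
  show ?thesis
    using a convex_standard_simplex by (intro contractible_space_star[of a]) auto
qed

lemma contractible_cylinder: "contractible_space (prod_topology (simplex_top p) unit_top)"
  by (simp add: contractible_space_prod_topology contractible_simplex_top convex_imp_contractible)

text \<open>The contraction moves \<open>c\<close> to a constant chain. In positive degree that
  chain lives in a one-point subspace, where cycles bound; in degree 0 the augmentation condition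
  \<open>aug\<close> makes it vanish.\<close>

lemma contractible_cycle_bounds:
  fixes X :: "'a topology"
  assumes X: "contractible_space X" and c: "singular_chain p X c" "chain_boundary p c = 0"
    and aug: "p = 0 \<Longrightarrow> (\<forall>a::'a. chain_map 0 (\<lambda>x. a) c = 0)"
  obtains d where "singular_chain (Suc p) X d" "chain_boundary (Suc p) d = c"
proof -
  obtain a where hom: "homotopic_with (\<lambda>x. True) X X id (\<lambda>x. a)"
    using X by (auto simp: contractible_space_def)
  then have "homotopic_with (\<lambda>h. h \<in> {} \<rightarrow> {}) X X id (\<lambda>x. a)"
    by simp
  then have "homologous_rel p X {} (chain_map p id c) (chain_map p (\<lambda>x. a) c)"
    by (rule homotopic_imp_homologous_rel_chain_maps) (use c in \<open>simp add: singular_cycle\<close>)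
  moreover have "chain_map p id c = c"
    using c(1) by (metis chain_map_id_gen id_apply)
  moreover have "singular_relboundary p X {} (chain_map p (\<lambda>x. a) c)"
  proof (cases "p = 0")
    case True
    then show ?thesis using aug by simp
  next
    case False
    show ?thesis
    proof (cases "topspace X = {}")
      case True
      then have "c = 0" using c(1) by (simp add: singular_chain_empty)
      then show ?thesis by simp
    next
      case False
      then have a: "a \<in> topspace X"
        using homotopic_with_imp_continuous_maps[OF hom] by (auto simp: continuous_map_def)
      let ?Y = "subtopology X {a}"
      have Y: "topspace ?Y = {a}" using a by auto
      have "continuous_map X ?Y (\<lambda>x. a)" using a by (simp add: continuous_map_in_subtopology)
      then have "singular_relcycle p ?Y {} (chain_map p (\<lambda>x. a) c)"
        using c by (simp add: singular_cycle singular_chain_chain_map chain_boundary_chain_map)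
      then have "singular_relboundary p ?Y {} (chain_map p (\<lambda>x. a) c)"
        using singular_boundary_eq_cycle_singleton[OF Y] \<open>p \<noteq> 0\<close> by simp
      then show ?thesis by (metis singular_boundary_mono subset_UNIV subtopology_UNIV)
    qed
  qed
  ultimately have "singular_relboundary p X {} c"
    unfolding homologous_rel_def using singular_relboundary_add by (metis diff_add_cancel)
  then show ?thesis using that by (auto simp: singular_boundary)
qed

section \<open>Prism operators on singular chains\<close>

lemma singular_chain_prism_op:
  assumes "singular_chain (Suc p) (prod_topology (simplex_top p) unit_top) d" "singular_chain p X c"
  shows "singular_chain (Suc p) (prod_topology X unit_top) (prism_op p d c)"
  unfolding prism_op_def
proof (rule singular_chain_extend)
  fix \<sigma> assume "\<sigma> \<in> Poly_Mapping.keys c"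
  then have "continuous_map (simplex_top p) X \<sigma>"
    using assms(2) by (auto simp: singular_chain_def singular_simplex_def)
  then have "continuous_map (prod_topology (simplex_top p) unit_top) (prod_topology X unit_top) (map_prod \<sigma> id)"
    by (simp add: map_prod_def continuous_map_prod_top)
  then show "singular_chain (Suc p) (prod_topology X unit_top) (chain_map (Suc p) (map_prod \<sigma> id) d)"
    using assms(1) singular_chain_chain_map by blast
qed

lemma prism_op_0 [simp]: "prism_op p d 0 = 0" "prism_op p 0 c = 0"
  by (simp_all add: prism_op_def frag_extend_eq_0)

lemma prism_op_diff: "prism_op p d (x - y) = prism_op p d x - prism_op p d y"
  by (simp add: prism_op_def frag_extend_diff)

lemma prism_op_natural:
  assumes d: "singular_chain (Suc p) (prod_topology (simplex_top p) unit_top) d" and c: "singular_chain p X c"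
  shows "chain_map (Suc p) (map_prod g id) (prism_op p d c) = prism_op p d (chain_map p g c)"
  using c unfolding singular_chain_def
proof (induction c rule: frag_induction)
  case (one \<sigma>)
  have "chain_map (Suc p) (map_prod g id) (chain_map (Suc p) (map_prod \<sigma> id) d) =
        chain_map (Suc p) (map_prod g id \<circ> map_prod \<sigma> id) d"
    by (simp add: chain_map_compose)
  also have "\<dots> = chain_map (Suc p) (map_prod (simplex_map p g \<sigma>) id) d"
    by (rule chain_map_eq[OF d]) (auto simp: simplex_map_def)
  finally show ?case by (simp only: prism_op_def frag_extend_of chain_map_of)
qed (auto simp: prism_op_diff chain_map_diff)

lemma singular_chain_id_chain: "singular_chain p (simplex_top p) (id_chain p)"
proof -
  have "continuous_map (simplex_top p) (simplex_top p) (restrict id (standard_simplex p))"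
    by (rule continuous_map_eq[OF continuous_map_id]) auto
  then show ?thesis by (simp add: singular_chain_of singular_simplex_def)
qed

text \<open>All terms are natural in \<open>\<sigma>\<close>, so the homotopy formula on the
  identity simplex implies it on every simplex. In degree 0 the truncated \<open>p - 1\<close> does
  no harm because \<open>chain_boundary 0\<close> is zero.\<close>

lemma chain_boundary_prism_op:
  assumes d: "singular_chain (Suc p) (prod_topology (simplex_top p) unit_top) d"
    and d0: "p > 0 \<Longrightarrow> singular_chain p (prod_topology (simplex_top (p - 1)) unit_top) d0"
    and eq: "chain_boundary (Suc p) d = chain_map p (\<lambda>x. (x, 1)) (id_chain p) - chain_map p (\<lambda>x. (x, 0)) (id_chain p)
               - prism_op (p - 1) d0 (chain_boundary p (id_chain p))"
    and c: "singular_chain p X c"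
  shows "chain_boundary (Suc p) (prism_op p d c) = chain_map p (\<lambda>x. (x, 1)) c - chain_map p (\<lambda>x. (x, 0)) c
               - prism_op (p - 1) d0 (chain_boundary p c)"
  using c unfolding singular_chain_def
proof (induction c rule: frag_induction)
  case (one \<sigma>)
  then have \<sigma>: "singular_simplex p X \<sigma>" by simp
  then have r: "restrict \<sigma> (standard_simplex p) = \<sigma>"
    by (simp add: singular_simplex_def extensional_restrict)
  have j: "chain_map p (map_prod \<sigma> id) (chain_map p (\<lambda>x. (x, s)) (id_chain p)) = chain_map p (\<lambda>x. (x, s)) (frag_of \<sigma>)" for s
    by (simp add: simplex_map_def fun_eq_iff restrict_def frag_of_eq)
  have i: "chain_map p \<sigma> (id_chain p) = frag_of \<sigma>"
  proof -
    have "simplex_map p \<sigma> (restrict id (standard_simplex p)) = restrict \<sigma> (standard_simplex p)"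
      by (auto simp: simplex_map_def)
    then show ?thesis using r by simp
  qed
  note sid = singular_chain_id_chain[of p]
  have n: "chain_map p (map_prod \<sigma> id) (prism_op (p - 1) d0 (chain_boundary p (id_chain p)))
     = prism_op (p - 1) d0 (chain_boundary p (frag_of \<sigma>))"
  proof (cases "p = 0")
    case False
    have "singular_chain (p - 1) (simplex_top p) (chain_boundary p (id_chain p))"
      using singular_chain_boundary[OF sid] by simp
    from prism_op_natural[OF _ this, of d0 \<sigma>] False d0
    have "chain_map p (map_prod \<sigma> id) (prism_op (p - 1) d0 (chain_boundary p (id_chain p)))
       = prism_op (p - 1) d0 (chain_map (p - 1) \<sigma> (chain_boundary p (id_chain p)))" by simp
    also have "chain_map (p - 1) \<sigma> (chain_boundary p (id_chain p)) = chain_boundary p (frag_of \<sigma>)"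
      using chain_boundary_chain_map[OF sid, of \<sigma>] i by simp
    finally show ?thesis .
  qed (simp add: chain_boundary_def)
  have "chain_boundary (Suc p) (prism_op p d (frag_of \<sigma>)) = chain_map p (map_prod \<sigma> id) (chain_boundary (Suc p) d)"
    using chain_boundary_chain_map[OF d] by (simp add: prism_op_def)
  then show ?case
    unfolding eq chain_map_diff j n .
next
  case (diff a b)
  then show ?case by (simp add: prism_op_diff chain_boundary_diff chain_map_diff)
qed simp

lemma singular_chain_cylinder_end:
  assumes "singular_chain p X c" "0 \<le> s" "s \<le> 1"
  shows "singular_chain p (prod_topology X unit_top) (chain_map p (\<lambda>x. (x, s)) c)"
proof (rule singular_chain_chain_map[OF assms(1)])
  show "continuous_map X (prod_topology X unit_top) (\<lambda>x. (x, s))"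
    using assms(2,3) by (simp add: continuous_map_pairwise o_def)
qed

text \<open>Acyclic models: the chains \<^term>\<open>D p\<close> exist since cylinders over simplices are contractible.\<close>

lemma prism_chains_exist:
  obtains D where
    "\<And>p. singular_chain (Suc p) (prod_topology (simplex_top p) unit_top) (D p)"
    "\<And>p (X::'a topology) c. singular_chain p X c \<Longrightarrow>
       chain_boundary (Suc p) (prism_op p (D p) c) = chain_map p (\<lambda>x. (x, 1)) c - chain_map p (\<lambda>x. (x, 0)) c
               - prism_op (p - 1) (D (p - 1)) (chain_boundary p c)"
proof -
  define T where "T p = prod_topology (simplex_top p) unit_top" for p
  define E where "E p c = chain_map p (\<lambda>x. (x, 1::real)) c - chain_map p (\<lambda>x. (x, 0)) c"
    for p and c :: "(nat \<Rightarrow> real) chain"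
  \<comment> \<open>The clause on cycles is stated for topologies on
    \<open>nat \<Rightarrow> real\<close>, a type fixed during the induction: it is applied to the
    boundary of \<open>id_chain\<close>, which lives in a standard simplex. The given type
    \<open>'a\<close> returns at the end through \<open>chain_boundary_prism_op\<close>.\<close>
  define P where "P p d \<longleftrightarrow> singular_chain (Suc p) (T p) d \<and>
      (\<forall>(X::(nat \<Rightarrow> real) topology) c. singular_chain p X c \<longrightarrow> chain_boundary p c = 0
          \<longrightarrow> chain_boundary (Suc p) (prism_op p d c) = E p c)" for p d
  define Q where "Q p d d' \<longleftrightarrow> chain_boundary (Suc (Suc p)) d' =
       E (Suc p) (id_chain (Suc p)) - prism_op p d (chain_boundary (Suc p) (id_chain (Suc p)))" for p d d'
  have E_chain: "singular_chain p (prod_topology X unit_top) (E p c)" if "singular_chain p X c" for p X c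
    unfolding E_def using that by (intro singular_chain_diff singular_chain_cylinder_end) auto
  have E_boundary: "chain_boundary p (E p c) = E (p - 1) (chain_boundary p c)" if "singular_chain p X c" for p X c
    unfolding E_def by (simp add: chain_boundary_diff chain_boundary_chain_map[OF that])
  have base: "\<exists>d. P 0 d \<and> chain_boundary (Suc 0) d = E 0 (id_chain 0)"
  proof -
    obtain d where d: "singular_chain (Suc 0) (T 0) d" "chain_boundary (Suc 0) d = E 0 (id_chain 0)"
    proof (rule contractible_cycle_bounds[of "T 0" 0 "E 0 (id_chain 0)"])
      show "contractible_space (T 0)" unfolding T_def by (rule contractible_cylinder)
      show "singular_chain 0 (T 0) (E 0 (id_chain 0))"
        unfolding T_def by (intro E_chain singular_chain_id_chain)
      show "chain_boundary 0 (E 0 (id_chain 0)) = 0" by (simp add: chain_boundary_def)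
      show "\<forall>a. chain_map 0 (\<lambda>x. a) (E 0 (id_chain 0)) = 0"
        unfolding E_def by (simp add: chain_map_diff simplex_map_def)
    qed auto
    have "chain_boundary (Suc 0) (prism_op 0 d c) = E 0 c" if "singular_chain 0 X c" for X :: "(nat \<Rightarrow> real) topology" and c
      using chain_boundary_prism_op[of 0 d 0 X c] d that by (simp add: T_def E_def)
    then show ?thesis using d by (auto simp: P_def)
  qed
  have step: "\<exists>d'. P (Suc p) d' \<and> Q p d d'" if Pd: "P p d" for p d
  proof -
    let ?i = "id_chain (Suc p)"
    let ?e = "E (Suc p) ?i - prism_op p d (chain_boundary (Suc p) ?i)"
    have bi: "singular_chain p (simplex_top (Suc p)) (chain_boundary (Suc p) ?i)"
      using singular_chain_boundary_alt singular_chain_id_chain by blast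
    have "chain_boundary p (chain_boundary (Suc p) ?i) = 0"
      using chain_boundary_boundary_alt singular_chain_id_chain by blast
    \<comment> \<open>The boundary of \<open>?i\<close> is a cycle, so its correction term
      disappears; this makes \<open>?e\<close> a cycle in a contractible cylinder.\<close>
    then have b: "chain_boundary (Suc p) (prism_op p d (chain_boundary (Suc p) ?i)) = E p (chain_boundary (Suc p) ?i)"
      using Pd bi unfolding P_def by blast
    obtain d' where d': "singular_chain (Suc (Suc p)) (T (Suc p)) d'" "chain_boundary (Suc (Suc p)) d' = ?e"
    proof (rule contractible_cycle_bounds[of "T (Suc p)" "Suc p" ?e])
      show "contractible_space (T (Suc p))" unfolding T_def by (rule contractible_cylinder)
      show "singular_chain (Suc p) (T (Suc p)) ?e"
        unfolding T_def using Pd bi unfolding P_def T_def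
        by (intro singular_chain_diff E_chain singular_chain_id_chain singular_chain_prism_op) auto
      show "chain_boundary (Suc p) ?e = 0"
        using E_boundary[OF singular_chain_id_chain, of "Suc p"] by (simp add: chain_boundary_diff b)
    qed auto
    have "chain_boundary (Suc (Suc p)) (prism_op (Suc p) d' c) = E (Suc p) c"
      if "singular_chain (Suc p) X c" "chain_boundary (Suc p) c = 0" for X :: "(nat \<Rightarrow> real) topology" and c
      using chain_boundary_prism_op[of "Suc p" d' d X c] d' Pd that by (simp add: T_def E_def P_def)
    then show ?thesis using d' by (auto simp: P_def Q_def)
  qed
  obtain d0 where d0: "P 0 d0" "chain_boundary (Suc 0) d0 = E 0 (id_chain 0)" using base by blast
  \<comment> \<open>\<open>Q\<close> ties each chain to its predecessor only, so the formula in
    degree 0 is carried along as an initial condition.\<close>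
  define P' where "P' p d \<longleftrightarrow> P p d \<and> (p = 0 \<longrightarrow> chain_boundary (Suc 0) d = E 0 (id_chain 0))" for p d
  have "\<exists>D. \<forall>p. P' p (D p) \<and> Q p (D p) (D (Suc p))"
    by (rule dependent_nat_choice) (use d0 step in \<open>auto simp: P'_def\<close>)
  then obtain D where D: "\<And>p. P' p (D p)" "\<And>p. Q p (D p) (D (Suc p))" by blast
  show thesis
  proof (rule that[of D])
    show *: "singular_chain (Suc p) (prod_topology (simplex_top p) unit_top) (D p)" for p
      using D(1)[of p] by (simp add: P'_def P_def T_def)
    fix p and X :: "'a topology" and c
    assume c: "singular_chain p X c"
    show "chain_boundary (Suc p) (prism_op p (D p) c) = chain_map p (\<lambda>x. (x, 1)) c - chain_map p (\<lambda>x. (x, 0)) c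
               - prism_op (p - 1) (D (p - 1)) (chain_boundary p c)"
    proof (rule chain_boundary_prism_op[OF * _ _ c])
      show "singular_chain p (prod_topology (simplex_top (p - 1)) unit_top) (D (p - 1))" if "p > 0"
        using *[of "p - 1"] that by simp
      show "chain_boundary (Suc p) (D p) = chain_map p (\<lambda>x. (x, 1)) (id_chain p) - chain_map p (\<lambda>x. (x, 0)) (id_chain p)
               - prism_op (p - 1) (D (p - 1)) (chain_boundary p (id_chain p))"
      proof (cases p)
        case 0
        then show ?thesis using D(1)[of 0] by (simp add: P'_def E_def chain_boundary_def)
      next
        case (Suc q)
        then show ?thesis using D(2)[of q] by (simp add: Q_def E_def)
      qed
    qed
  qed
qed

text \<open>Composing the prism operators with the homotopy gives an integral chain homotopy. After
  linear extension its correction term is applied to the boundary of \<open>z\<close>, which is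
  zero.\<close>

theorem fhomology_homotopic:
  assumes hom: "homotopic_with (\<lambda>h. True) X Y f g" and z: "z \<in> fcycles p X"
  shows "fchain_map p g z - fchain_map p f z \<in> fboundaries p Y"
proof -
  obtain h where h: "continuous_map (prod_topology unit_top X) Y h"
      "\<And>x. h (0, x) = f x" "\<And>x. h (1, x) = g x"
    using hom by (auto simp: homotopic_with_def)
  obtain D where D:
    "\<And>p. singular_chain (Suc p) (prod_topology (simplex_top p) unit_top) (D p)"
    "\<And>p (X::'a topology) c. singular_chain p X c \<Longrightarrow>
       chain_boundary (Suc p) (prism_op p (D p) c) = chain_map p (\<lambda>x. (x, 1)) c - chain_map p (\<lambda>x. (x, 0)) c
               - prism_op (p - 1) (D (p - 1)) (chain_boundary p c)"
    using prism_chains_exist by metis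
  have hc: "continuous_map (prod_topology X unit_top) Y (\<lambda>(x, t). h (t, x))"
  proof -
    have "continuous_map (prod_topology X unit_top) (prod_topology unit_top X) (\<lambda>(x, t). (t, x))"
      using homeomorphic_map_swap homeomorphic_imp_continuous_map by blast
    then show ?thesis
      using continuous_map_compose[OF _ h(1)] by (fastforce simp: o_def case_prod_unfold)
  qed
  let ?h = "\<lambda>(x, t). h (t, x)"
  define K where "K p c = chain_map (Suc p) ?h (prism_op p (D p) c)" for p c
  have K: "subtractive (K p)" for p
    by (simp add: subtractive_def K_def prism_op_diff chain_map_diff)
  have K_chain: "singular_chain (Suc p) Y (K p c)" if "singular_chain p X c" for p c
    unfolding K_def by (rule singular_chain_chain_map[OF singular_chain_prism_op[OF D(1) that] hc])
  have K_boundary: "chain_boundary (Suc p) (K p c) = chain_map p g c - chain_map p f c - chain_map p ?h (prism_op (p - 1) (D (p - 1)) (chain_boundary p c))"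
    if c: "singular_chain p X c" for c
  proof -
    have "chain_boundary (Suc p) (K p c) = chain_map p ?h (chain_boundary (Suc p) (prism_op p (D p) c))"
      unfolding K_def using chain_boundary_chain_map[OF singular_chain_prism_op[OF D(1) c]] by simp
    moreover have "chain_map p ?h (chain_map p (\<lambda>x. (x, s)) c) = chain_map p (\<lambda>x. h (s, x)) c" for s
      using fun_cong[OF chain_map_compose[of p ?h "\<lambda>x. (x, s)"], of c] by (simp add: o_def)
    ultimately show ?thesis using D(2)[OF c] by (simp add: chain_map_diff h)
  qed
  define R where "R c = chain_map p ?h (prism_op (p - 1) (D (p - 1)) c)" for c
  have R: "subtractive R" by (simp add: subtractive_def R_def prism_op_diff chain_map_diff)
  have zc: "z \<in> fchain_set p X" "fext (chain_boundary p) z = 0"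
    using z by (auto simp: fcycles_def fchain_boundary_eq_fext)
  have "fchain_boundary (Suc p) (fext (K p) z) = fext (\<lambda>c. chain_map p g c - chain_map p f c - R (chain_boundary p c)) z"
    unfolding fchain_boundary_eq_fext fext_fext[OF subtractive_chain_boundary]
  proof (rule fext_cong)
    fix s assume "s \<in> Poly_Mapping.keys z"
    then have "singular_chain p X (frag_of s)" using zc by (auto simp: fchain_set_def singular_chain_of)
    then show "chain_boundary (Suc p) (K p (frag_of s)) = chain_map p g (frag_of s) - chain_map p f (frag_of s) - R (chain_boundary p (frag_of s))"
      using K_boundary unfolding R_def by blast
  qed
  also have "\<dots> = fchain_map p g z - fchain_map p f z - fext R (fext (chain_boundary p) z)"
    by (simp only: fext_op_diff fchain_map_eq_fext fext_fext[OF R])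
  also have "\<dots> = fchain_map p g z - fchain_map p f z" by (simp add: zc)
  finally show ?thesis
    unfolding fboundaries_def using fchain_set_fext[OF zc(1), of "Suc p" Y "K p"] K_chain
    by (metis image_eqI singular_chain_of)
qed

section \<open>Reduced cycles and the homology of spheres\<close>

definition augmentation :: "('s \<Rightarrow>\<^sub>0 'k::comm_ring_1) \<Rightarrow> 'k" where
  "augmentation c = (\<Sum>s\<in>Poly_Mapping.keys c. Poly_Mapping.lookup c s)"

lemma augmentation_superset:
  "finite K \<Longrightarrow> Poly_Mapping.keys c \<subseteq> K \<Longrightarrow> augmentation c = (\<Sum>s\<in>K. Poly_Mapping.lookup c s)"
  unfolding augmentation_def by (intro sum.mono_neutral_left) (auto simp: in_keys_iff)

lemma augmentation_0 [simp]: "augmentation 0 = 0"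
  by (simp add: augmentation_def)

lemma augmentation_single [simp]: "augmentation (Poly_Mapping.single s a) = a"
  by (simp add: augmentation_def)

lemma augmentation_add: "augmentation (x + y) = augmentation x + augmentation y"
proof -
  let ?K = "Poly_Mapping.keys x \<union> Poly_Mapping.keys y"
  have *: "finite ?K" "Poly_Mapping.keys x \<subseteq> ?K" "Poly_Mapping.keys y \<subseteq> ?K" "Poly_Mapping.keys (x + y) \<subseteq> ?K"
    using keys_add[of x y] by auto
  show ?thesis
    by (simp add: augmentation_superset[OF *(1,4)] augmentation_superset[OF *(1,2)]
        augmentation_superset[OF *(1,3)] lookup_add sum.distrib)
qed

lemma augmentation_uminus: "augmentation (- x) = - augmentation x"
  using augmentation_add[of x "- x"] by (simp add: eq_neg_iff_add_eq_0 add.commute)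

lemma augmentation_diff: "augmentation (x - y) = augmentation x - augmentation y"
  using augmentation_add[of x "- y"] by (simp add: augmentation_uminus)

lemma augmentation_smult: "augmentation (fchain_smult a x) = a * augmentation x"
proof -
  have *: "Poly_Mapping.keys (fchain_smult a x) \<subseteq> Poly_Mapping.keys x"
    by (auto simp: in_keys_iff)
  show ?thesis
    unfolding augmentation_superset[OF finite_keys *] by (simp add: augmentation_def sum_distrib_left)
qed

lemma augmentation_sum: "augmentation (sum f I) = (\<Sum>i\<in>I. augmentation (f i))"
  by (induction I rule: infinite_finite_induct) (auto simp: augmentation_add)

lemma augmentation_fchain_of_int: "augmentation (fchain_of_int x) = of_int (augmentation x)"
proof -
  have *: "Poly_Mapping.keys (fchain_of_int x) \<subseteq> Poly_Mapping.keys x"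
    by (auto simp: in_keys_iff)
  show ?thesis
    unfolding augmentation_superset[OF finite_keys *] by (simp add: augmentation_def)
qed

lemma augmentation_fext:
  "augmentation (fext T c) = (\<Sum>s\<in>Poly_Mapping.keys c. Poly_Mapping.lookup c s * of_int (augmentation (T (frag_of s))))"
  unfolding fext_def by (simp add: augmentation_sum augmentation_smult augmentation_fchain_of_int)

lemma augmentation_fchain_map [simp]: "augmentation (fchain_map p g c) = augmentation c"
  unfolding fchain_map_eq_fext augmentation_fext by (simp add: augmentation_def)

lemma augmentation_fchain_boundary: "augmentation (fchain_boundary (Suc 0) c) = 0"
  unfolding fchain_boundary_eq_fext augmentation_fext
  by (intro sum.neutral) (simp add: chain_boundary_of augmentation_diff)

text \<open>Reduced homology, so that contractible spaces have none in any degree and suspension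
  shifts degrees starting from two points.\<close>

definition rcycles :: "nat \<Rightarrow> 'a topology \<Rightarrow> ('a, 'k::field) fchain set" where
  "rcycles p X = {c \<in> fcycles p X. p = 0 \<longrightarrow> augmentation c = 0}"

lemma rcycles_map:
  "x \<in> rcycles p X \<Longrightarrow> continuous_map X Y g \<Longrightarrow> fchain_map p g x \<in> rcycles p Y"
  using fcycles_map[of x p X Y g] by (simp add: rcycles_def)

lemma rcycles_boundary:
  assumes "x \<in> fchain_set (Suc p) X" "fchain_boundary (Suc p) x \<in> fchain_set p Y"
  shows "fchain_boundary (Suc p) x \<in> rcycles p Y"
  using assms fchain_boundary_boundary augmentation_fchain_boundary
  by (auto simp: rcycles_def fcycles_def)

lemma fboundaries_subset_rcycles: "fboundaries p X \<subseteq> rcycles p X"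
proof
  fix x assume "x \<in> fboundaries p X"
  then obtain d where "d \<in> fchain_set (Suc p) X" "x = fchain_boundary (Suc p) d"
    by (auto simp: fboundaries_def)
  then show "x \<in> rcycles p X"
    using rcycles_boundary fchain_set_boundary by fastforce
qed

abbreviation const_simplex :: "nat \<Rightarrow> 'a \<Rightarrow> (nat \<Rightarrow> real) \<Rightarrow> 'a" where
  "const_simplex p a \<equiv> restrict (\<lambda>x. a) (standard_simplex p)"

lemma const_simplex_in_fchain_set:
  assumes "a \<in> topspace X" shows "Poly_Mapping.single (const_simplex p a) b \<in> fchain_set p X"
  using assms by (auto simp: fchain_set_def singular_simplex_def)

lemma fchain_map_const:
  fixes c :: "('c, 'b::field) fchain" and a :: 'a
  shows "fchain_map p (\<lambda>x. a) c = Poly_Mapping.single (const_simplex p a) (augmentation c)"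
proof -
  have "simplex_map p (\<lambda>x. a) s = const_simplex p a" for s :: "(nat \<Rightarrow> real) \<Rightarrow> 'c"
    by (auto simp: simplex_map_def)
  moreover have "(\<Sum>s\<in>K. Poly_Mapping.single t (f s)) = Poly_Mapping.single t (sum f K)"
    for K and f :: "((nat \<Rightarrow> real) \<Rightarrow> 'c) \<Rightarrow> 'b" and t :: "(nat \<Rightarrow> real) \<Rightarrow> 'a"
    by (induction K rule: infinite_finite_induct) (auto simp: single_add)
  ultimately show ?thesis
    unfolding fchain_map_def augmentation_def by simp
qed

text \<open>The \<open>p + 1\<close> faces coincide and carry alternating signs: they cancel for odd
  \<open>p\<close>, and one survives for even \<open>p > 0\<close>.\<close>

lemma fchain_boundary_const_simplex:
  "fchain_boundary p (Poly_Mapping.single (const_simplex p a) b) =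
     (if p = 0 \<or> odd p then 0 else Poly_Mapping.single (const_simplex (p - 1) a) b)"
proof -
  let ?X = "discrete_topology {a}"
  have "chain_boundary p (frag_of (const_simplex p a)) =
     (if p = 0 \<or> odd p then 0 else frag_of (const_simplex (p - 1) a))"
    by (subst chain_boundary_of_singleton[of ?X]) (auto simp: singular_chain_of singular_simplex_singleton[of ?X a])
  then show ?thesis
    unfolding fchain_boundary_eq_fext fext_single
    by (auto simp: fchain_of_int_frag_of poly_mapping_eq_iff fun_eq_iff lookup_single when_def)
qed

text \<open>A contraction replaces \<open>z\<close> by a multiple of a constant simplex. In odd
  degree this is the boundary of the next constant simplex; in positive even degree it is a cycle
  only with coefficient 0; in degree 0 the coefficient is the augmentation.\<close>

theorem rcycles_contractible:
  assumes X: "contractible_space X" and z: "z \<in> rcycles p X"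
  shows "z \<in> fboundaries p X"
proof -
  obtain a where hom: "homotopic_with (\<lambda>x. True) X X id (\<lambda>x. a)"
    using X by (auto simp: contractible_space_def)
  have zc: "z \<in> fchain_set p X" "z \<in> fcycles p X" "fchain_boundary p z = 0" using z by (auto simp: rcycles_def fcycles_def)
  have c: "continuous_map X X (\<lambda>x. a)" using homotopic_with_imp_continuous_maps[OF hom] by simp
  have "fchain_map p (\<lambda>x. a) z \<in> fboundaries p X"
  proof (cases "topspace X = {} \<or> p = 0")
    case True
    then have "fchain_map p (\<lambda>x. a) z = 0"
    proof
      assume "topspace X = {}"
      then have "singular_simplex_set p X = {}" using singular_simplex_empty[of X p] by blast
      then have "Poly_Mapping.keys z \<subseteq> {}" using zc(1) unfolding fchain_set_def by blast
      then have "z = 0" by simp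
      then show ?thesis by (simp add: fchain_map_linear)
    next
      assume "p = 0"
      then show ?thesis using z by (simp add: fchain_map_const rcycles_def)
    qed
    then show ?thesis by (simp add: fboundaries_closed)
  next
    case False
    then have a: "a \<in> topspace X" using c by (auto simp: continuous_map_def)
    show ?thesis
    proof (cases "odd p")
      case True
      have "fchain_map p (\<lambda>x. a) z = fchain_boundary (Suc p) (Poly_Mapping.single (const_simplex (Suc p) a) (augmentation z))"
        unfolding fchain_boundary_const_simplex fchain_map_const using True by simp
      then show ?thesis
        using const_simplex_in_fchain_set[OF a] by (auto simp: fboundaries_def)
    next
      case e: False
      have "fchain_boundary p (fchain_map p (\<lambda>x. a) z) = 0"
        using fchain_boundary_map[OF zc(1)] zc(3) by (simp add: fchain_map_linear)
      then have "Poly_Mapping.single (const_simplex (p - 1) a) (augmentation z) = 0"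
        using e False by (simp add: fchain_map_const fchain_boundary_const_simplex)
      then have "augmentation z = 0" by (metis lookup_single_eq lookup_zero)
      then show ?thesis by (simp add: fchain_map_const fboundaries_closed)
    qed
  qed
  from fboundaries_closed(3)[OF this fhomology_homotopic[OF hom zc(2)]]
  show ?thesis using fchain_map_id[OF zc(1)] by simp
qed

text \<open>Reduced homology of a \<open>q\<close>-sphere: one-dimensional in degree
  \<open>q\<close>, zero elsewhere. It is said with cycles and boundaries so that chains serve
  directly as witnesses; the type argument fixes the field.\<close>

definition sphere_like :: "'k::field itself \<Rightarrow> nat \<Rightarrow> 'a topology \<Rightarrow> bool" where
  "sphere_like _ q X \<longleftrightarrow>
     (\<forall>p. p \<noteq> q \<longrightarrow> rcycles p X \<subseteq> (fboundaries p X :: ('a, 'k) fchain set)) \<and>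
     (\<exists>z0\<in>rcycles q X. z0 \<notin> (fboundaries q X :: ('a, 'k) fchain set) \<and>
        (\<forall>z\<in>rcycles q X. \<exists>a. z - fchain_smult a z0 \<in> fboundaries q X))"

lemma fchain_map_homotopic_id:
  assumes "homotopic_with (\<lambda>h. True) X X (g \<circ> f) id" "z \<in> fcycles p X"
  shows "z - fchain_map p g (fchain_map p f z) \<in> fboundaries p X"
  using fhomology_homotopic[OF assms] assms(2) fchain_map_id[of z p X]
  by (simp add: fchain_map_compose fcycles_def)

lemma sphere_like_homotopy_equivalent:
  assumes S: "sphere_like TYPE('k::field) q X"
    and f: "continuous_map X Y f" and g: "continuous_map Y X g"
    and gf: "homotopic_with (\<lambda>h. True) X X (g \<circ> f) id"
    and fg: "homotopic_with (\<lambda>h. True) Y Y (f \<circ> g) id"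
  shows "sphere_like TYPE('k) q Y"
proof -
  have cyc: "z \<in> fcycles p Z" if "z \<in> rcycles p Z" for z p and Z :: "'z topology"
    using that by (simp add: rcycles_def)
  have *: "z \<in> fboundaries p Y" if "z \<in> rcycles p Y" "fchain_map p g z \<in> fboundaries p X" for p and z :: "('b, 'k) fchain"
    using fboundaries_closed(2)[OF fchain_map_homotopic_id[OF fg cyc[OF that(1)]] fboundaries_map[OF that(2) f]] by simp
  obtain z0 :: "('a, 'k) fchain" where z0: "z0 \<in> rcycles q X" "z0 \<notin> fboundaries q X"
     "\<And>z. z \<in> rcycles q X \<Longrightarrow> \<exists>a. z - fchain_smult a z0 \<in> fboundaries q X"
    using S unfolding sphere_like_def by blast
  show ?thesis
    unfolding sphere_like_def
  proof (intro conjI allI impI subsetI bexI[of _ "fchain_map q f z0"] ballI)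
    fix p and z :: "('b, 'k) fchain" assume "p \<noteq> q" "z \<in> rcycles p Y"
    then show "z \<in> fboundaries p Y"
      using * rcycles_map[OF _ g] S unfolding sphere_like_def by blast
  next
    show "fchain_map q f z0 \<in> rcycles q Y" using z0 f by (simp add: rcycles_map)
    show "fchain_map q f z0 \<notin> fboundaries q Y"
    proof
      assume "fchain_map q f z0 \<in> fboundaries q Y"
      from fboundaries_closed(2)[OF fchain_map_homotopic_id[OF gf cyc[OF z0(1)]] fboundaries_map[OF this g]]
      show False using z0(2) by simp
    qed
    fix z :: "('b, 'k) fchain" assume z: "z \<in> rcycles q Y"
    obtain a where a: "fchain_map q g z - fchain_smult a z0 \<in> fboundaries q X"
      using z0(3) rcycles_map[OF z g] by blast
    from fboundaries_closed(2)[OF fchain_map_homotopic_id[OF fg cyc[OF z]] fboundaries_map[OF this f]]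
    have "z - fchain_smult a (fchain_map q f z0) \<in> fboundaries q Y"
      by (simp add: fchain_map_linear)
    then show "\<exists>a. z - fchain_smult a (fchain_map q f z0) \<in> fboundaries q Y" by blast
  qed
qed

section \<open>Subdivision and the Mayer--Vietoris argument\<close>

definition fsubdiv :: "nat \<Rightarrow> nat \<Rightarrow> ('a, 'k::field) fchain \<Rightarrow> ('a, 'k) fchain" where
  "fsubdiv m p = fext (singular_subdivision p ^^ m)"

lemma subtractive_subdivision: "subtractive (singular_subdivision p ^^ m)"
  by (simp add: subtractive_def singular_subdivision_power_diff)

lemma singular_chain_subdivision_power:
  "singular_chain p X c \<Longrightarrow> singular_chain p X ((singular_subdivision p ^^ m) c)"
  by (induction m) (auto simp: singular_chain_singular_subdivision)

lemma chain_boundary_subdivision_power: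
  "singular_chain p X c \<Longrightarrow>
     chain_boundary p ((singular_subdivision p ^^ m) c) = (singular_subdivision (p - 1) ^^ m) (chain_boundary p c)"
  by (induction m) (auto simp: chain_boundary_singular_subdivision[OF singular_chain_subdivision_power])

lemma fsubdiv_linear:
  "fsubdiv m p (x + y) = fsubdiv m p x + fsubdiv m p y"
  "fsubdiv m p (x - y) = fsubdiv m p x - fsubdiv m p y"
  "fsubdiv m p (fchain_smult a x) = fchain_smult a (fsubdiv m p x)"
  by (simp_all add: fsubdiv_def fext_add fext_diff fext_smult)

lemma fchain_set_fsubdiv:
  assumes "c \<in> fchain_set p X" shows "fsubdiv m p c \<in> fchain_set p X"
  unfolding fsubdiv_def
  by (rule fchain_set_fext[OF assms]) (simp add: singular_chain_subdivision_power singular_chain_of)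

lemma fchain_boundary_fsubdiv:
  assumes "c \<in> fchain_set p X"
  shows "fchain_boundary p (fsubdiv m p c) = fsubdiv m (p - 1) (fchain_boundary p c)"
  unfolding fsubdiv_def fchain_boundary_eq_fext fext_fext[OF subtractive_subdivision]
    fext_fext[OF subtractive_chain_boundary]
proof (rule fext_cong)
  fix s assume "s \<in> Poly_Mapping.keys c"
  then have "singular_chain p X (frag_of s)" using assms by (auto simp: fchain_set_def singular_chain_of)
  then show "chain_boundary p ((singular_subdivision p ^^ m) (frag_of s)) =
      (singular_subdivision (p - 1) ^^ m) (chain_boundary p (frag_of s))"
    by (rule chain_boundary_subdivision_power)
qed

lemma fsubdiv_homologous:
  fixes z :: "('a, 'k::field) fchain"
  assumes "z \<in> fcycles p X"
  shows "fsubdiv m p z - z \<in> fboundaries p X"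
proof -
  obtain h where h:
        "\<And>p. h p 0 = (0 :: 'a chain)"
        "\<And>p c1 c2. h p (c1-c2) = h p c1 - h p c2"
        "\<And>p X c. singular_chain p X c \<Longrightarrow> singular_chain (Suc p) X (h p c)"
        "\<And>p X c. singular_chain p X c
                 \<Longrightarrow> chain_boundary (Suc p) (h p c) + h (p - Suc 0) (chain_boundary p c)
                   = (singular_subdivision p ^^ m) c - c"
    using chain_homotopic_iterated_singular_subdivision[where n = m and 'a = 'a] by blast
  have sub: "subtractive (h q)" for q by (simp add: subtractive_def h)
  have z: "z \<in> fchain_set p X" "fchain_boundary p z = 0" using assms by (auto simp: fcycles_def)
  have "fchain_boundary (Suc p) (fext (h p) z) = fext (\<lambda>c. (singular_subdivision p ^^ m) c - c - h (p - 1) (chain_boundary p c)) z"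
    unfolding fchain_boundary_eq_fext fext_fext[OF subtractive_chain_boundary]
  proof (rule fext_cong)
    fix s assume "s \<in> Poly_Mapping.keys z"
    then have "singular_chain p X (frag_of s)" using z by (auto simp: fchain_set_def singular_chain_of)
    from h(4)[OF this]
    show "chain_boundary (Suc p) (h p (frag_of s)) =
      (singular_subdivision p ^^ m) (frag_of s) - frag_of s - h (p - 1) (chain_boundary p (frag_of s))"
      by (simp add: algebra_simps)
  qed
  also have "\<dots> = fsubdiv m p z - z"
  proof -
    have "fext (\<lambda>c. h (p - 1) (chain_boundary p c)) z = 0"
      using fext_fext[OF sub, of "p - 1" "chain_boundary p" z] z(2) by (simp add: fchain_boundary_eq_fext)
    then show ?thesis unfolding fext_op_diff fsubdiv_def by simp
  qed
  finally show ?thesis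
    unfolding fboundaries_def using fchain_set_fext[OF z(1), of "Suc p" X "h p"] h(3)
    by (simp add: singular_chain_of image_iff) metis
qed

lemma fchain_split:
  fixes c :: "('a, 'k::field) fchain"
  assumes "Poly_Mapping.keys c \<subseteq> A \<union> B"
  obtains a b where "c = a + b" "Poly_Mapping.keys a \<subseteq> A" "Poly_Mapping.keys b \<subseteq> B"
proof -
  let ?K = "Poly_Mapping.keys c"
  let ?s = "\<lambda>s. Poly_Mapping.single s (Poly_Mapping.lookup c s)"
  have eq: "c = (\<Sum>s\<in>?K. ?s s)"
    by (rule poly_mapping_eqI) (auto simp: lookup_sum lookup_single when_def sum.delta' in_keys_iff)
  also have "\<dots> = (\<Sum>s\<in>?K \<inter> A. ?s s) + (\<Sum>s\<in>?K - A. ?s s)"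
    by (simp add: sum.Int_Diff)
  finally have "c = (\<Sum>s\<in>?K \<inter> A. ?s s) + (\<Sum>s\<in>?K - A. ?s s)" .
  moreover have "Poly_Mapping.keys (\<Sum>s\<in>L. ?s s) \<subseteq> L" for L
    using keys_sum[of ?s L] by (force split: if_splits)
  then have "Poly_Mapping.keys (\<Sum>s\<in>?K \<inter> A. ?s s) \<subseteq> ?K \<inter> A" "Poly_Mapping.keys (\<Sum>s\<in>?K - A. ?s s) \<subseteq> ?K - A"
    by blast+
  ultimately show thesis using assms that by blast
qed

lemma fsubdiv_small:
  assumes UV: "openin X U" "openin X V" "topspace X \<subseteq> U \<union> V" and c: "c \<in> fchain_set p X"
  obtains m a b where "fsubdiv m p c = a + b" "a \<in> fchain_set p (subtopology X U)" "b \<in> fchain_set p (subtopology X V)"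
proof -
  have "\<exists>n. \<forall>m f. n \<le> m \<longrightarrow> f \<in> Poly_Mapping.keys ((singular_subdivision p ^^ m) (frag_of s))
                      \<longrightarrow> (\<exists>V' \<in> {U,V}. f \<in> (standard_simplex p) \<rightarrow> V')" if "s \<in> Poly_Mapping.keys c" for s
  proof -
    have "singular_chain p X (frag_of s)" using that c by (auto simp: fchain_set_def singular_chain_of)
    from sufficient_iterated_singular_subdivision_exists[of "{U,V}" X p, OF _ _ this] UV
    show ?thesis by (metis Union_insert Union_empty Un_empty_right insert_iff singletonD)
  qed
  then obtain n where n: "\<And>s m f. s \<in> Poly_Mapping.keys c \<Longrightarrow> n s \<le> m \<Longrightarrow>
       f \<in> Poly_Mapping.keys ((singular_subdivision p ^^ m) (frag_of s))
                      \<Longrightarrow> (\<exists>V' \<in> {U,V}. f \<in> (standard_simplex p) \<rightarrow> V')" by metis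
  \<comment> \<open>Each simplex of \<open>c\<close> has its own threshold \<open>n s\<close>; the
    sum dominates all of them.\<close>
  define m where "m = (\<Sum>s\<in>Poly_Mapping.keys c. n s)"
  have m: "n s \<le> m" if "s \<in> Poly_Mapping.keys c" for s
    unfolding m_def using that by (intro member_le_sum) auto
  have "Poly_Mapping.keys (fsubdiv m p c) \<subseteq> singular_simplex_set p (subtopology X U) \<union> singular_simplex_set p (subtopology X V)"
  proof
    fix f assume f: "f \<in> Poly_Mapping.keys (fsubdiv m p c)"
    then have X: "singular_simplex p X f" using fchain_set_fsubdiv[OF c, of m] by (auto simp: fchain_set_def)
    obtain s where s: "s \<in> Poly_Mapping.keys c" "f \<in> Poly_Mapping.keys ((singular_subdivision p ^^ m) (frag_of s))"
      using subsetD[OF keys_fext f[unfolded fsubdiv_def]] by (rule UN_E)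
    from n[OF s(1) m[OF s(1)] s(2)] X
    show "f \<in> singular_simplex_set p (subtopology X U) \<union> singular_simplex_set p (subtopology X V)"
      by (auto simp: singular_simplex_subtopology)
  qed
  then obtain a b where "fsubdiv m p c = a + b" "a \<in> fchain_set p (subtopology X U)" "b \<in> fchain_set p (subtopology X V)"
    by (rule fchain_split) (auto simp: fchain_set_def)
  then show thesis by (rule that)
qed

lemma fboundaries_subtopology: "z \<in> fboundaries p (subtopology X S) \<Longrightarrow> z \<in> fboundaries p X"
  unfolding fboundaries_def using fchain_set_subtopology by blast

lemma rcycles_mono:
  "z \<in> rcycles p (subtopology X S) \<Longrightarrow> S \<subseteq> T \<Longrightarrow> z \<in> rcycles p (subtopology X T)"
  unfolding rcycles_def fcycles_def using fchain_set_mono by blast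

lemma fboundaryE:
  assumes "z \<in> fboundaries p X"
  obtains d where "d \<in> fchain_set (Suc p) X" "fchain_boundary (Suc p) d = z"
  using assms by (auto simp: fboundaries_def)

text \<open>Mayer--Vietoris for a cover by two contractible open sets, written out with chains.\<close>

theorem sphere_like_suspension:
  assumes UV: "openin X U" "openin X V" "topspace X \<subseteq> U \<union> V"
    and U: "contractible_space (subtopology X U)" and V: "contractible_space (subtopology X V)"
    and ne: "x0 \<in> topspace X" "x0 \<in> U" "x0 \<in> V"
    and S: "sphere_like TYPE('k::field) q (subtopology X (U \<inter> V))"
  shows "sphere_like TYPE('k) (Suc q) X"
proof -
  let ?U = "subtopology X U" and ?V = "subtopology X V" and ?W = "subtopology X (U \<inter> V)"
  obtain e0 :: "('a, 'k) fchain" where e0: "e0 \<in> rcycles q ?W" "e0 \<notin> fboundaries q ?W"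
     "\<And>z. z \<in> rcycles q ?W \<Longrightarrow> \<exists>a. z - fchain_smult a e0 \<in> fboundaries q ?W"
    using S unfolding sphere_like_def by blast
  \<comment> \<open>\<open>A\<close> and \<open>B\<close> fill the generator of the overlap on the
    two sides. Their difference will generate degree \<open>Suc q\<close>, like two hemispheres
    glued along an equator.\<close>
  obtain A where A: "A \<in> fchain_set (Suc q) ?U" "fchain_boundary (Suc q) A = e0"
    using rcycles_contractible[OF U rcycles_mono[OF e0(1) Int_lower1]] by (rule fboundaryE)
  obtain B where B: "B \<in> fchain_set (Suc q) ?V" "fchain_boundary (Suc q) B = e0"
    using rcycles_contractible[OF V rcycles_mono[OF e0(1) Int_lower2]] by (rule fboundaryE)
  have glue: "a + b \<in> fboundaries p X"
    if "a \<in> rcycles p ?U" "b \<in> rcycles p ?V" for p and a b :: "('a, 'k) fchain"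
    using rcycles_contractible[OF U that(1)] rcycles_contractible[OF V that(2)] fboundaries_subtopology
      fboundaries_closed(2) by blast
  have inX: "x \<in> fchain_set p X" if "x \<in> fchain_set p (subtopology X T)" for x :: "('a, 'k) fchain" and p T
    using fchain_set_subtopology that by blast
  have inU: "x \<in> fchain_set p ?U" and inV: "x \<in> fchain_set p ?V" if "x \<in> fchain_set p ?W" for x :: "('a, 'k) fchain" and p
    using fchain_set_mono[OF that] by auto
  have unsub: "z \<in> fboundaries p X" if "z \<in> rcycles p X" "fsubdiv m p z \<in> fboundaries p X"
    for m p and z :: "('a, 'k) fchain"
    using fboundaries_closed(3)[OF that(2) fsubdiv_homologous[of z p X m]] that(1) by (simp add: rcycles_def)
  have dec: "\<exists>m a b. fsubdiv m p z = a + b \<and> a \<in> fchain_set p ?U \<and> b \<in> fchain_set p ?V"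
    if "z \<in> fchain_set p X" for p and z :: "('a, 'k) fchain"
    using fsubdiv_small[OF UV that] by metis
  \<comment> \<open>The connecting homomorphism on chains: after subdivision the two halves of a
    cycle have opposite boundaries, which therefore lie in the overlap.\<close>
  have conn: "\<exists>m a b. fsubdiv m (Suc p) z = a + b \<and> a \<in> fchain_set (Suc p) ?U \<and> b \<in> fchain_set (Suc p) ?V
      \<and> fchain_boundary (Suc p) a \<in> rcycles p ?W \<and> fchain_boundary (Suc p) b = - fchain_boundary (Suc p) a"
    if "z \<in> rcycles (Suc p) X" for p and z :: "('a, 'k) fchain"
  proof -
    have z: "z \<in> fchain_set (Suc p) X" "fchain_boundary (Suc p) z = 0" using that by (auto simp: rcycles_def fcycles_def)
    obtain m a b where ab: "fsubdiv m (Suc p) z = a + b" "a \<in> fchain_set (Suc p) ?U" "b \<in> fchain_set (Suc p) ?V"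
      using dec[OF z(1)] by blast
    have "fchain_boundary (Suc p) a + fchain_boundary (Suc p) b = 0"
      using fchain_boundary_fsubdiv[OF z(1), of m] ab(1) z(2) by (simp add: fchain_boundary_linear fsubdiv_def)
    then have b: "fchain_boundary (Suc p) b = - fchain_boundary (Suc p) a"
      by (simp add: eq_neg_iff_add_eq_0 add.commute)
    have "fchain_boundary (Suc p) a \<in> fchain_set p ?U" using fchain_set_boundary[OF ab(2)] by simp
    moreover have "fchain_boundary (Suc p) a \<in> fchain_set p ?V"
      using fchain_set_boundary[OF fchain_set_closed(4)[OF ab(3)]] b by (simp add: fchain_boundary_linear)
    ultimately have "fchain_boundary (Suc p) a \<in> fchain_set p ?W" by (rule fchain_set_Int)
    then show ?thesis using rcycles_boundary[OF ab(2)] ab b by blast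
  qed
  have vanish: "z \<in> fboundaries p X" if "z \<in> rcycles p X" "p \<noteq> Suc q" for p and z :: "('a, 'k) fchain"
  proof (cases p)
    case 0
    then have "z \<in> fchain_set 0 X" using that(1) by (simp add: rcycles_def fcycles_def)
    from dec[OF this]
    obtain m a b where ab: "fsubdiv m 0 z = a + b" "a \<in> fchain_set 0 ?U" "b \<in> fchain_set 0 ?V" by blast
    \<comment> \<open>\<open>a\<close> and \<open>b\<close> have opposite augmentations; a multiple
      of the point \<open>x0\<close> of the overlap moves the excess from one side to the
      other.\<close>
    define \<kappa> where "\<kappa> = Poly_Mapping.single (const_simplex 0 x0) (augmentation a)"
    have \<kappa>: "\<kappa> \<in> fchain_set 0 ?U" "\<kappa> \<in> fchain_set 0 ?V"
      unfolding \<kappa>_def using ne by (auto intro: const_simplex_in_fchain_set)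
    have "fsubdiv m 0 z - z \<in> fboundaries 0 X" using fsubdiv_homologous[of z 0 X m] that(1) 0 by (simp add: rcycles_def)
    then have "augmentation (fsubdiv m 0 z - z) = 0"
      using fboundaries_subset_rcycles[of 0 X] by (auto simp: rcycles_def)
    moreover have "augmentation z = 0" using that(1) 0 by (simp add: rcycles_def)
    ultimately have "augmentation a + augmentation b = 0"
      unfolding ab(1) by (simp add: augmentation_diff augmentation_add)
    then have "a - \<kappa> \<in> rcycles 0 ?U" "b + \<kappa> \<in> rcycles 0 ?V"
      using ab \<kappa> by (auto simp: rcycles_def fcycles_def fchain_set_closed fchain_boundary_def
          augmentation_diff augmentation_add \<kappa>_def add.commute)
    from glue[OF this] have "fsubdiv m 0 z \<in> fboundaries 0 X" by (simp add: ab)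
    then show ?thesis using unsub that(1) 0 by blast
  next
    case (Suc p')
    have zS: "z \<in> rcycles (Suc p') X" using that(1) Suc by simp
    obtain m a b where ab: "fsubdiv m (Suc p') z = a + b" "a \<in> fchain_set (Suc p') ?U" "b \<in> fchain_set (Suc p') ?V"
      "fchain_boundary (Suc p') a \<in> rcycles p' ?W" "fchain_boundary (Suc p') b = - fchain_boundary (Suc p') a"
      using conn[OF zS] by blast
    have "fchain_boundary (Suc p') a \<in> fboundaries p' ?W"
      using S ab(4) that(2) Suc unfolding sphere_like_def by blast
    then obtain e where e: "e \<in> fchain_set (Suc p') ?W" "fchain_boundary (Suc p') e = fchain_boundary (Suc p') a"
      by (rule fboundaryE)
    have "a - e \<in> rcycles (Suc p') ?U" "b + e \<in> rcycles (Suc p') ?V"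
      using ab e inU[OF e(1)] inV[OF e(1)]
      by (auto simp: rcycles_def fcycles_def fchain_set_closed fchain_boundary_linear)
    from glue[OF this] have "fsubdiv m (Suc p') z \<in> fboundaries (Suc p') X" by (simp add: ab)
    then show ?thesis using unsub that(1) Suc by blast
  qed
  define z0 where "z0 = A - B"
  have z0: "z0 \<in> rcycles (Suc q) X"
    unfolding z0_def using A B by (auto simp: rcycles_def fcycles_def fchain_set_closed inX fchain_boundary_linear)
  have span: "\<exists>a. z - fchain_smult a z0 \<in> fboundaries (Suc q) X" if z: "z \<in> rcycles (Suc q) X" for z
  proof -
    obtain m a b where ab: "fsubdiv m (Suc q) z = a + b" "a \<in> fchain_set (Suc q) ?U" "b \<in> fchain_set (Suc q) ?V"
      "fchain_boundary (Suc q) a \<in> rcycles q ?W" "fchain_boundary (Suc q) b = - fchain_boundary (Suc q) a"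
      using conn[OF z] by blast
    obtain l where "fchain_boundary (Suc q) a - fchain_smult l e0 \<in> fboundaries q ?W"
      using e0(3)[OF ab(4)] by blast
    then obtain e where e: "e \<in> fchain_set (Suc q) ?W" "fchain_boundary (Suc q) e = fchain_boundary (Suc q) a - fchain_smult l e0"
      by (rule fboundaryE)
    have "a - fchain_smult l A - e \<in> rcycles (Suc q) ?U" "b + fchain_smult l B + e \<in> rcycles (Suc q) ?V"
      using ab e inU[OF e(1)] inV[OF e(1)] A B
      by (auto simp: rcycles_def fcycles_def fchain_set_closed fchain_boundary_linear)
    from glue[OF this] have "fsubdiv m (Suc q) z - fchain_smult l z0 \<in> fboundaries (Suc q) X"
      by (simp add: ab z0_def fchain_smult_diff algebra_simps)
    from fboundaries_closed(3)[OF this fsubdiv_homologous[of z "Suc q" X m]] z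
    have "z - fchain_smult l z0 \<in> fboundaries (Suc q) X" by (simp add: rcycles_def algebra_simps)
    then show ?thesis by blast
  qed
  have nontriv: "z0 \<notin> fboundaries (Suc q) X"
  proof
    assume "z0 \<in> fboundaries (Suc q) X"
    then obtain d where d: "d \<in> fchain_set (Suc (Suc q)) X" "fchain_boundary (Suc (Suc q)) d = z0" by (rule fboundaryE)
    obtain m a b where ab: "fsubdiv m (Suc (Suc q)) d = a + b" "a \<in> fchain_set (Suc (Suc q)) ?U" "b \<in> fchain_set (Suc (Suc q)) ?V"
      using dec[OF d(1)] by blast
    \<comment> \<open>If \<open>z0\<close> bounded, \<open>w\<close> would lie in \<open>U\<close>
      by this expression and in \<open>V\<close> by the one in \<open>w'\<close>; it would then fill
      a subdivision of \<open>e0\<close> inside the overlap.\<close>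
    define w where "w = fsubdiv m (Suc q) A - fchain_boundary (Suc (Suc q)) a"
    have "fsubdiv m (Suc q) z0 = fchain_boundary (Suc (Suc q)) a + fchain_boundary (Suc (Suc q)) b"
      using fchain_boundary_fsubdiv[OF d(1), of m] d(2) ab(1) by (simp add: fchain_boundary_linear)
    then have w': "w = fsubdiv m (Suc q) B + fchain_boundary (Suc (Suc q)) b"
      by (simp add: w_def z0_def fsubdiv_linear algebra_simps)
    have "w \<in> fchain_set (Suc q) ?U"
      unfolding w_def using fchain_set_boundary[OF ab(2)] fchain_set_fsubdiv[OF A(1)] by (simp add: fchain_set_closed)
    moreover have "w \<in> fchain_set (Suc q) ?V"
      unfolding w' using fchain_set_boundary[OF ab(3)] fchain_set_fsubdiv[OF B(1)] by (simp add: fchain_set_closed)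
    ultimately have w: "w \<in> fchain_set (Suc q) ?W" by (rule fchain_set_Int)
    have "fchain_boundary (Suc q) w = fsubdiv m q e0"
      unfolding w_def using fchain_boundary_fsubdiv[OF A(1), of m] A(2) fchain_boundary_boundary[OF ab(2)]
      by (simp add: fchain_boundary_linear)
    then have "fsubdiv m q e0 \<in> fboundaries q ?W" unfolding fboundaries_def using w by (metis image_eqI)
    then have "e0 \<in> fboundaries q ?W"
      using fboundaries_closed(3)[OF _ fsubdiv_homologous[of e0 q ?W m]] e0(1) by (fastforce simp: rcycles_def)
    then show False using e0(2) by simp
  qed
  show ?thesis
    unfolding sphere_like_def using vanish z0 nontriv span by blast
qed

text \<open>The start of the suspensions. A chain lying on both sides vanishes, so subdivided cycles
  split into cycles, and the difference of one point on each side is the generator.\<close>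

theorem sphere_like_0_disjoint:
  assumes UV: "openin X U" "openin X V" "topspace X \<subseteq> U \<union> V" "U \<inter> V = {}"
    and U: "contractible_space (subtopology X U)" and V: "contractible_space (subtopology X V)"
    and ne: "u \<in> U" "v \<in> V"
  shows "sphere_like TYPE('k::field) 0 X"
proof -
  let ?U = "subtopology X U" and ?V = "subtopology X V"
  have disj: "x = 0" if "x \<in> fchain_set p ?U" "x \<in> fchain_set p ?V" for x :: "('a, 'k) fchain" and p
  proof -
    have "singular_simplex_set p (subtopology X {}) = {}"
      using singular_simplex_empty[of "subtopology X {}" p] by auto
    then have "Poly_Mapping.keys x \<subseteq> {}"
      using fchain_set_Int[OF that] unfolding UV(4) fchain_set_def by blast
    then show ?thesis by simp
  qed
  have uv: "u \<in> topspace X" "v \<in> topspace X" using UV ne openin_subset by blast+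
  have glue: "a + b \<in> fboundaries p X"
    if "a \<in> rcycles p ?U" "b \<in> rcycles p ?V" for p and a b :: "('a, 'k) fchain"
    using rcycles_contractible[OF U that(1)] rcycles_contractible[OF V that(2)] fboundaries_subtopology
      fboundaries_closed(2) by blast
  have unsub: "z - w \<in> fboundaries p X" if "z \<in> rcycles p X" "fsubdiv m p z - w \<in> fboundaries p X"
    for m p and z w :: "('a, 'k) fchain"
    using fboundaries_closed(3)[OF that(2) fsubdiv_homologous[of z p X m]] that(1) by (simp add: rcycles_def)
  have dec: "\<exists>m a b. fsubdiv m p z = a + b \<and> a \<in> fchain_set p ?U \<and> b \<in> fchain_set p ?V"
    if "z \<in> fchain_set p X" for p and z :: "('a, 'k) fchain"
    using fsubdiv_small[OF UV(1-3) that] by metis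
  define ku :: "('a, 'k) fchain" where "ku = Poly_Mapping.single (const_simplex 0 u) 1"
  define kv :: "('a, 'k) fchain" where "kv = Poly_Mapping.single (const_simplex 0 v) 1"
  have ku: "ku \<in> fchain_set 0 ?U" "augmentation ku = 1" and kv: "kv \<in> fchain_set 0 ?V" "augmentation kv = 1"
    unfolding ku_def kv_def using ne uv by (auto intro: const_simplex_in_fchain_set)
  have aug_sub: "augmentation (fsubdiv m 0 z) = augmentation z" if "z \<in> fchain_set 0 X" for m and z :: "('a, 'k) fchain"
  proof -
    have "z \<in> fcycles 0 X" using that by (simp add: fcycles_def fchain_boundary_def)
    from fsubdiv_homologous[OF this, of m] have "augmentation (fsubdiv m 0 z - z) = 0"
      using fboundaries_subset_rcycles[of 0 X] by (auto simp: rcycles_def)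
    then show ?thesis by (simp add: augmentation_diff)
  qed
  have pos: "z \<in> fboundaries p X" if z: "z \<in> rcycles p X" "p \<noteq> 0" for p and z :: "('a, 'k) fchain"
  proof -
    obtain p' where p: "p = Suc p'" using z(2) by (cases p) auto
    have zc: "z \<in> fchain_set p X" "fchain_boundary p z = 0" using z by (auto simp: rcycles_def fcycles_def)
    obtain m a b where ab: "fsubdiv m p z = a + b" "a \<in> fchain_set p ?U" "b \<in> fchain_set p ?V"
      using dec[OF zc(1)] by blast
    have s: "fchain_boundary p a + fchain_boundary p b = 0"
      using fchain_boundary_fsubdiv[OF zc(1), of m] ab(1) zc(2) by (simp add: fchain_boundary_linear fsubdiv_def)
    then have b: "fchain_boundary p a = fchain_boundary p (- b)"
      by (simp add: fchain_boundary_linear eq_neg_iff_add_eq_0)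
    have "fchain_boundary p a = 0"
      using disj[of "fchain_boundary p a" "p - 1"] fchain_set_boundary[OF ab(2)]
        fchain_set_boundary[OF fchain_set_closed(4)[OF ab(3)]] b by simp
    then have "a \<in> rcycles p ?U" "b \<in> rcycles p ?V"
      using ab s p by (auto simp: rcycles_def fcycles_def)
    from glue[OF this] have "fsubdiv m p z - 0 \<in> fboundaries p X" by (simp add: ab)
    from unsub[OF z(1) this] show ?thesis by simp
  qed
  have z0: "ku - kv \<in> rcycles 0 X"
    using ku kv fchain_set_subtopology[OF ku(1)] fchain_set_subtopology[OF kv(1)]
    by (auto simp: rcycles_def fcycles_def fchain_set_closed augmentation_diff fchain_boundary_def)
  have span: "\<exists>a. z - fchain_smult a (ku - kv) \<in> fboundaries 0 X" if z: "z \<in> rcycles 0 X" for z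
  proof -
    have zc: "z \<in> fchain_set 0 X" "augmentation z = 0" using z by (auto simp: rcycles_def fcycles_def)
    obtain m a b where ab: "fsubdiv m 0 z = a + b" "a \<in> fchain_set 0 ?U" "b \<in> fchain_set 0 ?V"
      using dec[OF zc(1)] by blast
    let ?l = "augmentation a"
    have "augmentation b = - ?l"
      using aug_sub[OF zc(1), of m] ab(1) zc(2) by (simp add: augmentation_add eq_neg_iff_add_eq_0 add.commute)
    then have "a - fchain_smult ?l ku \<in> rcycles 0 ?U" "b + fchain_smult ?l kv \<in> rcycles 0 ?V"
      using ab ku kv
      by (auto simp: rcycles_def fcycles_def fchain_set_closed fchain_boundary_def augmentation_diff augmentation_add augmentation_smult)
    from glue[OF this] have "fsubdiv m 0 z - fchain_smult ?l (ku - kv) \<in> fboundaries 0 X"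
      by (simp add: ab fchain_smult_diff algebra_simps)
    from unsub[OF z this] show ?thesis by blast
  qed
  have nontriv: "ku - kv \<notin> fboundaries 0 X"
  proof
    assume "ku - kv \<in> fboundaries 0 X"
    then obtain d where d: "d \<in> fchain_set (Suc 0) X" "fchain_boundary (Suc 0) d = ku - kv" by (rule fboundaryE)
    obtain m a b where ab: "fsubdiv m (Suc 0) d = a + b" "a \<in> fchain_set (Suc 0) ?U" "b \<in> fchain_set (Suc 0) ?V"
      using dec[OF d(1)] by blast
    define w where "w = fsubdiv m 0 ku - fchain_boundary (Suc 0) a"
    have "fsubdiv m 0 (ku - kv) = fchain_boundary (Suc 0) a + fchain_boundary (Suc 0) b"
      using fchain_boundary_fsubdiv[OF d(1), of m] d(2) ab(1) by (simp add: fchain_boundary_linear)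
    then have w': "w = fsubdiv m 0 kv + fchain_boundary (Suc 0) b"
      by (simp add: w_def fsubdiv_linear algebra_simps)
    have "w \<in> fchain_set 0 ?U"
      unfolding w_def using fchain_set_boundary[OF ab(2)] fchain_set_fsubdiv[OF ku(1)] by (simp add: fchain_set_closed)
    moreover have "w \<in> fchain_set 0 ?V"
      unfolding w' using fchain_set_boundary[OF ab(3)] fchain_set_fsubdiv[OF kv(1)] by (simp add: fchain_set_closed)
    ultimately have "w = 0" by (rule disj)
    then have "augmentation (fsubdiv m 0 ku) = 0"
      by (simp add: w_def augmentation_fchain_boundary)
    then show False using aug_sub[OF fchain_set_subtopology[OF ku(1)], of m] ku(2) by simp
  qed
  show ?thesis
    unfolding sphere_like_def using pos z0 nontriv span by blast
qed

section \<open>Punctured Euclidean spaces\<close>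

text \<open>Finitely many coordinates inside \<open>nat \<Rightarrow> real\<close>: all dimensions
  share one type, so the induction on the dimension can compare them.\<close>

definition punctured_set :: "nat \<Rightarrow> (nat \<Rightarrow> real) set" where
  "punctured_set m = {x. (\<forall>i\<ge>m. x i = 0) \<and> (\<exists>i. x i \<noteq> 0)}"

abbreviation punctured_space :: "nat \<Rightarrow> (nat \<Rightarrow> real) topology" where
  "punctured_space m \<equiv> subtopology (powertop_real UNIV) (punctured_set m)"

lemma openin_coordinate:
  assumes "open T" shows "openin (powertop_real UNIV) {x. x i \<in> T}"
proof -
  have "continuous_map (powertop_real UNIV) euclideanreal (\<lambda>x. x i)"
    by (rule continuous_map_product_projection) auto
  from openin_continuous_map_preimage[OF this, of T] assms show ?thesis by simp
qed

text \<open>Removing a closed half of the last axis leaves a set that is star-shaped about a point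
  of the other half. The two sets obtained in this way cover, and their overlap retracts to the
  punctured space of one dimension less.\<close>

lemma sphere_like_punctured: "sphere_like TYPE('k::field) m (punctured_space (Suc m))"
proof (induction m)
  case 0
  let ?U = "{x \<in> punctured_set 1. x 0 \<in> {0<..}}" and ?V = "{x \<in> punctured_set 1. x 0 \<in> {..<0}}"
  let ?e = "\<lambda>s::real. (\<lambda>i::nat. if i = 0 then s else 0)"
  have sub: "subtopology (punctured_space 1) ?U = subtopology (powertop_real UNIV) ?U"
    "subtopology (punctured_space 1) ?V = subtopology (powertop_real UNIV) ?V"
    by (simp_all add: subtopology_subtopology Int_def)
  show ?case
    unfolding One_nat_def[symmetric]
  proof (rule sphere_like_0_disjoint[of _ ?U ?V "?e 1" "?e (-1)"])
    have "openin (punctured_space 1) (punctured_set 1 \<inter> {x. x 0 \<in> T})" if "open T" for T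
      using openin_coordinate[OF that] by (rule openin_subtopology_Int2)
    from this[of "{0<..}"] this[of "{..<0}"]
    show "openin (punctured_space 1) ?U" "openin (punctured_space 1) ?V"
      by (simp_all add: Int_def)
    show "topspace (punctured_space 1) \<subseteq> ?U \<union> ?V"
    proof
      fix x assume "x \<in> topspace (punctured_space 1)"
      then have x: "x \<in> punctured_set 1" by simp
      then obtain i where "x i \<noteq> 0" "\<not> i \<ge> 1" by (auto simp: punctured_set_def)
      then have "x 0 \<noteq> 0" by (cases i) auto
      then show "x \<in> ?U \<union> ?V" using x by auto
    qed
    show "?U \<inter> ?V = {}" by auto
    have pu: "1 * a + 0 > 0 \<Longrightarrow> (1 - t) * a + t > 0" if "0 \<le> t" "t \<le> 1" for a t :: real
      using that by (cases "t = 1") (auto simp: add_pos_nonneg)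
    show "contractible_space (subtopology (punctured_space 1) ?U)"
      unfolding sub
    proof (rule contractible_space_star[of "?e 1"])
      show "?e 1 \<in> ?U" by (auto simp: punctured_set_def)
      fix x t assume x: "x \<in> ?U" and t: "0 \<le> t" "t \<le> (1::real)"
      then have "(1 - t) * x 0 + t * 1 > 0" using pu[OF t, of "x 0"] by simp
      then show "(\<lambda>i. (1 - t) * x i + t * ?e 1 i) \<in> ?U"
        using x by (auto simp: punctured_set_def intro!: exI[of _ 0])
    qed
    show "contractible_space (subtopology (punctured_space 1) ?V)"
      unfolding sub
    proof (rule contractible_space_star[of "?e (-1)"])
      show "?e (-1) \<in> ?V" by (auto simp: punctured_set_def)
      fix x t assume x: "x \<in> ?V" and t: "0 \<le> t" "t \<le> (1::real)"
      then have "(1 - t) * x 0 + t * (-1) < 0" using pu[OF t, of "- x 0"] by simp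
      then show "(\<lambda>i. (1 - t) * x i + t * ?e (-1) i) \<in> ?V"
        using x by (auto simp: punctured_set_def intro!: exI[of _ 0])
    qed
    show "?e 1 \<in> ?U" "?e (-1) \<in> ?V" by (auto simp: punctured_set_def)
  qed
next
  case (Suc m)
  let ?P = "punctured_set (Suc (Suc m))"
  let ?U = "{x \<in> ?P. (\<exists>i\<le>m. x i \<noteq> 0) \<or> x (Suc m) > 0}" and ?V = "{x \<in> ?P. (\<exists>i\<le>m. x i \<noteq> 0) \<or> x (Suc m) < 0}"
  let ?W = "{x \<in> ?P. \<exists>i\<le>m. x i \<noteq> 0}"
  let ?X = "punctured_space (Suc (Suc m))"
  let ?e = "\<lambda>s::real. (\<lambda>i::nat. if i = Suc m then s else 0)"
  have sub: "subtopology ?X ?U = subtopology (powertop_real UNIV) ?U"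
    "subtopology ?X ?V = subtopology (powertop_real UNIV) ?V"
    "subtopology ?X (?U \<inter> ?V) = subtopology (powertop_real UNIV) ?W"
    by (simp_all add: subtopology_subtopology Int_def) (auto intro!: arg_cong[where f = "subtopology _"])
  have op: "openin ?X {x \<in> ?P. (\<exists>i\<le>m. x i \<noteq> 0) \<or> x (Suc m) \<in> T}" if "open T" for T :: "real set"
  proof -
    have "openin (powertop_real UNIV) ((\<Union>i\<in>{..m}. {x. x i \<in> - {0}}) \<union> {x. x (Suc m) \<in> T})"
      using that by (intro openin_Un openin_Union) (auto intro: openin_coordinate[of "- {0}", simplified] openin_coordinate)
    then have "openin ?X (?P \<inter> ((\<Union>i\<in>{..m}. {x. x i \<in> - {0}}) \<union> {x. x (Suc m) \<in> T}))"
      by (rule openin_subtopology_Int2)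
    moreover have "?P \<inter> ((\<Union>i\<in>{..m}. {x. x i \<in> - {0}}) \<union> {x. x (Suc m) \<in> T}) = {x \<in> ?P. (\<exists>i\<le>m. x i \<noteq> 0) \<or> x (Suc m) \<in> T}"
      by auto
    ultimately show ?thesis by simp
  qed
  have nz: "\<exists>i\<le>m. (1 - t) * x i + t * ?e s i \<noteq> 0" if "t < 1" "\<exists>i\<le>m. x i \<noteq> 0" for x and t s :: real
    using that by fastforce
  show ?case
  proof (rule sphere_like_suspension[of _ ?U ?V "\<lambda>i. if i = 0 then 1 else 0"])
    show "openin ?X ?U" "openin ?X ?V" using op[of "{0<..}"] op[of "{..<0}"] by simp_all
    show "topspace ?X \<subseteq> ?U \<union> ?V"
    proof
      fix x assume "x \<in> topspace ?X"
      then have x: "x \<in> ?P" by simp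
      then obtain i where "x i \<noteq> 0" "\<not> i \<ge> Suc (Suc m)" by (auto simp: punctured_set_def)
      then have "(\<exists>i\<le>m. x i \<noteq> 0) \<or> x (Suc m) \<noteq> 0" by (metis le_Suc_eq not_less_eq_eq)
      then show "x \<in> ?U \<union> ?V" using x by force
    qed
    have star: "(\<lambda>i. (1 - t) * x i + t * ?e s i) \<in> ?P" 
      if x: "x \<in> ?P" and t: "0 \<le> t" "t \<le> (1::real)" and s: "s \<noteq> 0" "(\<exists>i\<le>m. x i \<noteq> 0) \<or> x (Suc m) * s > 0" for x t s
    proof -
      have "\<exists>i. (1 - t) * x i + t * ?e s i \<noteq> 0"
      proof (cases "t < 1 \<and> (\<exists>i\<le>m. x i \<noteq> 0)")
        case True
        then show ?thesis using nz[of t x s] by blast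
      next
        case False
        have "(1 - t) * x (Suc m) + t * s \<noteq> 0"
        proof (cases "t = 1")
          case False
          then have p: "x (Suc m) * s > 0" "t < 1" using s t \<open>\<not> (t < 1 \<and> (\<exists>i\<le>m. x i \<noteq> 0))\<close> by auto
          then have "(1 - t) * (x (Suc m) * s) + t * (s * s) > 0"
            using t mult_pos_pos[OF _ p(1), of "1 - t"] by (simp add: add_pos_nonneg)
          then have "((1 - t) * x (Suc m) + t * s) * s > 0" by (simp add: algebra_simps)
          then show ?thesis by auto
        qed (use s in simp)
        then show ?thesis by (intro exI[of _ "Suc m"]) simp
      qed
      then show ?thesis using x by (auto simp: punctured_set_def)
    qed
    have pu: "(1 - t) * a + t > 0" if "0 \<le> t" "t \<le> 1" "a > 0 \<or> t = 1" for a t :: real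
      using that by (cases "t = 1") (auto simp: add_pos_nonneg)
    show "contractible_space (subtopology ?X ?U)"
      unfolding sub
    proof (rule contractible_space_star[of "?e 1"])
      show "?e 1 \<in> ?U" by (auto simp: punctured_set_def)
      fix x t assume x: "x \<in> ?U" and t: "0 \<le> t" "t \<le> (1::real)"
      have "(\<exists>i\<le>m. (1 - t) * x i + t * ?e 1 i \<noteq> 0) \<or> (1 - t) * x (Suc m) + t * ?e 1 (Suc m) > 0"
      proof (cases "t < 1 \<and> (\<exists>i\<le>m. x i \<noteq> 0)")
        case True
        then show ?thesis using nz[of t x 1] by blast
      next
        case False
        then show ?thesis using pu[OF t, of "x (Suc m)"] x t by force
      qed
      then show "(\<lambda>i. (1 - t) * x i + t * ?e 1 i) \<in> ?U"
        using star[of x t 1] x t by auto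
    qed
    show "contractible_space (subtopology ?X ?V)"
      unfolding sub
    proof (rule contractible_space_star[of "?e (-1)"])
      show "?e (-1) \<in> ?V" by (auto simp: punctured_set_def)
      fix x t assume x: "x \<in> ?V" and t: "0 \<le> t" "t \<le> (1::real)"
      have "(\<exists>i\<le>m. (1 - t) * x i + t * ?e (-1) i \<noteq> 0) \<or> (1 - t) * x (Suc m) + t * ?e (-1) (Suc m) < 0"
      proof (cases "t < 1 \<and> (\<exists>i\<le>m. x i \<noteq> 0)")
        case True
        then show ?thesis using nz[of t x "-1"] by blast
      next
        case False
        then show ?thesis using pu[OF t, of "- x (Suc m)"] x t by force
      qed
      then show "(\<lambda>i. (1 - t) * x i + t * ?e (-1) i) \<in> ?V"
        using star[of x t "-1"] x t by auto
    qed
    show "(\<lambda>i. if i = 0 then 1 else 0) \<in> topspace ?X" "(\<lambda>i. if i = 0 then 1 else 0) \<in> ?U" "(\<lambda>i. if i = 0 then 1 else 0) \<in> ?V"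
      by (auto simp: punctured_set_def)
    \<comment> \<open>In the overlap the first \<open>m + 1\<close> coordinates do not all vanish,
      so the last one can be scaled to zero.\<close>
    let ?f = "\<lambda>x::nat \<Rightarrow> real. \<lambda>i. if i \<le> m then x i else 0"
    let ?Y = "punctured_space (Suc m)"
    let ?Z = "subtopology (powertop_real UNIV) ?W"
    have YW: "punctured_set (Suc m) \<subseteq> ?W"
      unfolding punctured_set_def by auto (metis not_less_eq_eq)
    have idc: "continuous_map ?Y ?Z id"
      using YW by (auto simp: continuous_map_in_subtopology continuous_map_from_subtopology)
    have "continuous_map ?Z (powertop_real UNIV) ?f"
      unfolding continuous_map_componentwise_UNIV
      by (auto intro!: continuous_map_from_subtopology continuous_map_product_projection)
    then have fc: "continuous_map ?Z ?Y ?f"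
      by (auto simp: continuous_map_in_subtopology punctured_set_def)
    have fid: "homotopic_with (\<lambda>h. True) ?Z ?Z (id \<circ> ?f) id"
    proof -
      let ?h = "\<lambda>(t::real, x::nat \<Rightarrow> real). (\<lambda>i. if i \<le> m then x i else t * x i)"
      have "continuous_map (prod_topology unit_top ?Z) (powertop_real UNIV) ?h"
        unfolding continuous_map_componentwise_UNIV
      proof
        fix i
        have "continuous_map (prod_topology unit_top ?Z) euclideanreal (\<lambda>z. fst z)"
          using continuous_map_fst continuous_map_into_fulltopology by blast
        moreover have "continuous_map ?Z euclideanreal (\<lambda>x. x i)"
          by (intro continuous_map_from_subtopology continuous_map_product_projection) auto
        then have "continuous_map (prod_topology unit_top ?Z) euclideanreal ((\<lambda>x. x i) \<circ> snd)"
          using continuous_map_compose continuous_map_snd by blast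
        ultimately show "continuous_map (prod_topology unit_top ?Z) euclideanreal (\<lambda>z. ?h z i)"
          by (cases "i \<le> m") (auto simp: case_prod_unfold o_def intro!: continuous_intros)
      qed
      moreover have "?h \<in> topspace (prod_topology unit_top ?Z) \<rightarrow> ?W"
        by (auto simp: punctured_set_def)
      ultimately have "continuous_map (prod_topology unit_top ?Z) ?Z ?h"
        by (simp add: continuous_map_in_subtopology)
      then show ?thesis
        unfolding homotopic_with_def by (intro exI[of _ ?h]) (auto simp: fun_eq_iff)
    qed
    have "homotopic_with (\<lambda>h. True) ?Y ?Y (?f \<circ> id) id"
    proof (rule homotopic_with_equal)
      show "continuous_map ?Y ?Y (?f \<circ> id)" using continuous_map_compose[OF idc fc] .
      show "(?f \<circ> id) x = id x" if "x \<in> topspace ?Y" for x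
        using that by (auto simp: punctured_set_def fun_eq_iff not_less_eq_eq)
    qed simp_all
    from sphere_like_homotopy_equivalent[OF Suc.IH idc fc this fid]
    show "sphere_like TYPE('k) m (subtopology ?X (?U \<inter> ?V))" unfolding sub .
  qed
qed

section \<open>Reading off bars\<close>

definition fcoset :: "nat \<Rightarrow> 'a topology \<Rightarrow> ('a, 'k::field) fchain \<Rightarrow> ('a, 'k) fchain set" where
  "fcoset p X z = {z + b | b. b \<in> fboundaries p X}"

lemma mem_fcoset: "x \<in> fcoset p X z \<longleftrightarrow> x - z \<in> fboundaries p X"
  unfolding fcoset_def by (auto intro!: exI[of _ "x - z"])

lemma fcoset_eq_iff: "fcoset p X y = fcoset p X z \<longleftrightarrow> y - z \<in> fboundaries p X"
proof
  assume "fcoset p X y = fcoset p X z"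
  then have "y \<in> fcoset p X z" using mem_fcoset[of y p X y] fboundaries_closed(1)[of p X] by simp
  then show "y - z \<in> fboundaries p X" by (simp add: mem_fcoset)
next
  assume yz: "y - z \<in> fboundaries p X"
  show "fcoset p X y = fcoset p X z"
  proof (rule Set.set_eqI)
    fix x
    have "x - z = (x - y) + (y - z)" "x - y = (x - z) - (y - z)" by simp_all
    then show "x \<in> fcoset p X y \<longleftrightarrow> x \<in> fcoset p X z"
      unfolding mem_fcoset using fboundaries_closed(2)[OF _ yz] fboundaries_closed(3)[OF _ yz] by metis
  qed
qed

lemma fcoset_add: "{s + t | s t. s \<in> fcoset p X y \<and> t \<in> fcoset p X z} = fcoset p X (y + z)"
proof (rule Set.set_eqI)
  fix x
  show "x \<in> {s + t | s t. s \<in> fcoset p X y \<and> t \<in> fcoset p X z} \<longleftrightarrow> x \<in> fcoset p X (y + z)"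
  proof
    assume "x \<in> {s + t | s t. s \<in> fcoset p X y \<and> t \<in> fcoset p X z}"
    then obtain s t where "x = s + t" "s - y \<in> fboundaries p X" "t - z \<in> fboundaries p X"
      by (auto simp: mem_fcoset)
    then show "x \<in> fcoset p X (y + z)"
      using fboundaries_closed(2)[of "s - y" p X "t - z"] by (simp add: mem_fcoset algebra_simps)
  next
    assume "x \<in> fcoset p X (y + z)"
    then have "x - z \<in> fcoset p X y" "z \<in> fcoset p X z" "x = (x - z) + z"
      using fboundaries_closed(1) by (auto simp: mem_fcoset algebra_simps)
    then show "x \<in> {s + t | s t. s \<in> fcoset p X y \<and> t \<in> fcoset p X z}" by blast
  qed
qed

lemma fcoset_smult:
  "{fchain_smult a s + b | s b. s \<in> fcoset p X z \<and> b \<in> fboundaries p X} = fcoset p X (fchain_smult a z)"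
proof (rule Set.set_eqI)
  fix x
  show "x \<in> {fchain_smult a s + b | s b. s \<in> fcoset p X z \<and> b \<in> fboundaries p X} \<longleftrightarrow> x \<in> fcoset p X (fchain_smult a z)"
  proof
    assume "x \<in> {fchain_smult a s + b | s b. s \<in> fcoset p X z \<and> b \<in> fboundaries p X}"
    then obtain s b where x: "x = fchain_smult a s + b" "s - z \<in> fboundaries p X" "b \<in> fboundaries p X"
      by (auto simp: mem_fcoset)
    have "fchain_smult a (s - z) + b \<in> fboundaries p X"
      by (intro fboundaries_closed(2) fboundaries_closed(5) x)
    then show "x \<in> fcoset p X (fchain_smult a z)"
      using x by (simp add: mem_fcoset fchain_smult_diff algebra_simps)
  next
    assume "x \<in> fcoset p X (fchain_smult a z)"
    then have "x = fchain_smult a z + (x - fchain_smult a z)" "z \<in> fcoset p X z" "x - fchain_smult a z \<in> fboundaries p X"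
      using fboundaries_closed(1) by (auto simp: mem_fcoset)
    then show "x \<in> {fchain_smult a s + b | s b. s \<in> fcoset p X z \<and> b \<in> fboundaries p X}" by blast
  qed
qed

lemma fhomology_simps:
  "carrier (fhomology p X) = fcoset p X ` fcycles p X"
  "zero (fhomology p X) = fboundaries p X"
  "add (fhomology p X) (fcoset p X y) (fcoset p X z) = fcoset p X (y + z)"
  "smult (fhomology p X) a (fcoset p X z) = fcoset p X (fchain_smult a z)"
  by (auto simp: fhomology_def fcoset_add fcoset_smult) (auto simp: fcoset_def)

lemma fhom_induced_id:
  assumes z: "z \<in> fcycles p X" and c: "continuous_map X Y id"
  shows "fhom_induced p Y id (fcoset p X z) = fcoset p Y z"
proof (rule Set.set_eqI)
  have id: "fchain_map p id x = x" if "x \<in> fcoset p X z" for x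
  proof -
    have "x - z \<in> fcycles p X" using that fboundaries_subset_fcycles by (auto simp: mem_fcoset)
    then have "(x - z) + z \<in> fcycles p X" using z by (rule fcycles_closed)
    then show ?thesis using fchain_map_id[of x p X] by (simp add: fcycles_def)
  qed
  have BXY: "b \<in> fboundaries p Y" if "b \<in> fboundaries p X" for b :: "('a, 'b) fchain"
  proof -
    have "b \<in> fchain_set p X" using that fboundaries_subset_fcycles by (auto simp: fcycles_def)
    then show ?thesis using fboundaries_map[OF that c] fchain_map_id[of b p X] by simp
  qed
  fix x
  show "x \<in> fhom_induced p Y id (fcoset p X z) \<longleftrightarrow> x \<in> fcoset p Y z"
  proof
    assume "x \<in> fhom_induced p Y id (fcoset p X z)"
    then obtain s b where s: "x = s + b" "s - z \<in> fboundaries p X" "b \<in> fboundaries p Y"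
      using id by (auto simp: fhom_induced_def mem_fcoset)
    then have "(s - z) + b \<in> fboundaries p Y" using BXY fboundaries_closed(2) by blast
    then show "x \<in> fcoset p Y z" using s by (simp add: mem_fcoset algebra_simps)
  next
    assume "x \<in> fcoset p Y z"
    then have "x = fchain_map p id z + (x - z)" "z \<in> fcoset p X z" "x - z \<in> fboundaries p Y"
      using fboundaries_closed(1) id[of z] by (auto simp: mem_fcoset)
    then show "x \<in> fhom_induced p Y id (fcoset p X z)" unfolding fhom_induced_def by blast
  qed
qed

text \<open>\<open>L r\<close> is a coordinate on one-dimensional homology. Inclusions act as the
  identity on chains, so when \<open>L\<close> does not change with \<open>r\<close> the structure
  maps become identities.\<close>

theorem has_bars_single:
  fixes F :: "real \<Rightarrow> 'a topology" and L :: "real \<Rightarrow> ('a, 'k::field) fchain \<Rightarrow> 'k"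
  assumes F: "\<And>r s. r \<le> s \<Longrightarrow> continuous_map (F r) (F s) id"
    and J: "is_interval J" "J \<noteq> {}"
    and out: "\<And>r. r \<notin> J \<Longrightarrow> fcycles p (F r) \<subseteq> (fboundaries p (F r) :: ('a, 'k) fchain set)"
    and add: "\<And>r x y. r \<in> J \<Longrightarrow> x \<in> fcycles p (F r) \<Longrightarrow> y \<in> fcycles p (F r) \<Longrightarrow> L r (x + y) = L r x + L r y"
    and smult: "\<And>r x a. r \<in> J \<Longrightarrow> x \<in> fcycles p (F r) \<Longrightarrow> L r (fchain_smult a x) = a * L r x"
    and ker: "\<And>r x. r \<in> J \<Longrightarrow> x \<in> fcycles p (F r) \<Longrightarrow> L r x = 0 \<longleftrightarrow> x \<in> fboundaries p (F r)"
    and one: "\<And>r. r \<in> J \<Longrightarrow> \<exists>x\<in>fcycles p (F r). L r x = 1"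
    and compat: "\<And>r s x. r \<in> J \<Longrightarrow> s \<in> J \<Longrightarrow> r \<le> s \<Longrightarrow> x \<in> fcycles p (F r) \<Longrightarrow> L s x = L r x"
  shows "has_bars (persistent_homology TYPE('k) p F) {()} (\<lambda>_. J)"
proof -
  \<comment> \<open>The functional is evaluated on an arbitrary representative of the coset;
    \<open>Lco\<close> shows that the choice does not matter. The type \<open>unit\<close> indexes
    the single summand.\<close>
  define \<eta> where "\<eta> r S = (\<lambda>_::unit. if r \<in> J then L r (SOME s. s \<in> S) else 0)" for r S
  have Lco: "L r x = L r z" if "r \<in> J" "z \<in> fcycles p (F r)" "x - z \<in> fboundaries p (F r)" for r x z
  proof -
    have xz: "x - z \<in> fcycles p (F r)" using that(3) fboundaries_subset_fcycles by blast
    then have "L r ((x - z) + z) = L r (x - z) + L r z" using that by (intro add)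
    then show ?thesis using ker[OF that(1) xz] that(3) by simp
  qed
  have \<eta>: "\<eta> r (fcoset p (F r) z) = (\<lambda>_. if r \<in> J then L r z else 0)" if "z \<in> fcycles p (F r)" for r z
  proof -
    have "z \<in> fcoset p (F r) z" using fboundaries_closed(1) by (simp add: mem_fcoset)
    then have "(SOME s. s \<in> fcoset p (F r) z) \<in> fcoset p (F r) z" by (rule someI)
    then show ?thesis using Lco that unfolding \<eta>_def mem_fcoset by auto
  qed
  have cyc_mono: "z \<in> fcycles p (F s)" if "r \<le> s" "z \<in> fcycles p (F r)" for r s and z :: "('a, 'k) fchain"
    using fcycles_map[OF that(2) F[OF that(1)]] fchain_map_id[of z p "F r"] that(2) by (simp add: fcycles_def)
  have bnd_mono: "z \<in> fboundaries p (F s)" if "r \<le> s" "z \<in> fboundaries p (F r)" for r s and z :: "('a, 'k) fchain"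
  proof -
    have "z \<in> fchain_set p (F r)" using that(2) fboundaries_subset_fcycles by (auto simp: fcycles_def)
    then show ?thesis using fboundaries_map[OF that(2) F[OF that(1)]] fchain_map_id[of z p "F r"] by simp
  qed
  let ?N = "pers_direct_sum {()} (\<lambda>_. interval_module J) :: ('k, unit \<Rightarrow> 'k) pers_module"
  let ?M = "persistent_homology TYPE('k) p F"
  have carN: "carrier (pspace ?N r) = {f. r \<notin> J \<longrightarrow> f = (\<lambda>_. 0)}" for r
    by (auto simp: pers_direct_sum_def interval_module_def fun_eq_iff PiE_def extensional_def)
  have addN: "add (pspace ?N r) f g = (\<lambda>_. f () + g ())" for r f g
    by (auto simp: pers_direct_sum_def interval_module_def fun_eq_iff)
  have smultN: "smult (pspace ?N r) a f = (\<lambda>_. a * f ())" for r f a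
    by (auto simp: pers_direct_sum_def interval_module_def fun_eq_iff)
  have mapN: "pmap ?N r s f = (\<lambda>_. if r \<in> J \<and> s \<in> J then f () else 0)" for r s f
    by (auto simp: pers_direct_sum_def interval_module_def fun_eq_iff)
  have spM: "pspace ?M r = fhomology p (F r)" "pmap ?M r s = fhom_induced p (F s) id" for r s
    by (simp_all add: persistent_homology_def)
  have lin: "linear_iso (pspace ?M r) (pspace ?N r) (\<eta> r)" for r
    unfolding linear_iso_def iso_def hom_def
  proof (intro conjI CollectI ballI allI)
    show "\<eta> r \<in> carrier (add_monoid (pspace ?M r)) \<rightarrow> carrier (add_monoid (pspace ?N r))"
      unfolding spM by (auto simp: carN \<eta>_def)
    show "\<eta> r (x \<otimes>\<^bsub>add_monoid (pspace ?M r)\<^esub> y) = \<eta> r x \<otimes>\<^bsub>add_monoid (pspace ?N r)\<^esub> \<eta> r y"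
      if "x \<in> carrier (add_monoid (pspace ?M r))" "y \<in> carrier (add_monoid (pspace ?M r))" for x y
      using that unfolding spM by (auto simp: fhomology_simps \<eta> addN fcycles_closed add)
    show "\<eta> r (a \<odot>\<^bsub>pspace ?M r\<^esub> x) = a \<odot>\<^bsub>pspace ?N r\<^esub> \<eta> r x" if "x \<in> carrier (pspace ?M r)" for a x
      using that unfolding spM by (auto simp: fhomology_simps \<eta> smultN fcycles_closed smult)
    have "inj_on (\<eta> r) (fcoset p (F r) ` fcycles p (F r))"
    proof (rule inj_onI, clarsimp)
      fix y z :: "('a, 'k) fchain"
      assume yz: "y \<in> fcycles p (F r)" "z \<in> fcycles p (F r)" and eq: "\<eta> r (fcoset p (F r) y) = \<eta> r (fcoset p (F r) z)"
      have d: "y - z \<in> fcycles p (F r)" using yz by (rule fcycles_closed)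
      have "y - z \<in> fboundaries p (F r)"
      proof (cases "r \<in> J")
        case True
        have "L r ((y - z) + z) = L r (y - z) + L r z" using add[OF True d yz(2)] .
        then have "L r (y - z) = 0" using eq True yz by (simp add: \<eta> fun_eq_iff)
        then show ?thesis using ker[OF True d] by simp
      qed (use out d in blast)
      then show "fcoset p (F r) y = fcoset p (F r) z" by (simp add: fcoset_eq_iff)
    qed
    moreover have "\<eta> r ` (fcoset p (F r) ` fcycles p (F r)) = {f. r \<notin> J \<longrightarrow> f = (\<lambda>_. 0)}"
    proof (intro subset_antisym subsetI)
      fix f :: "unit \<Rightarrow> 'k" assume f: "f \<in> {f. r \<notin> J \<longrightarrow> f = (\<lambda>_. 0)}"
      show "f \<in> \<eta> r ` (fcoset p (F r) ` fcycles p (F r))"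
      proof (cases "r \<in> J")
        case True
        then obtain x where x: "x \<in> fcycles p (F r)" "L r x = 1" using one by blast
        have "\<eta> r (fcoset p (F r) (fchain_smult (f ()) x)) = f"
          using x True smult[OF True x(1)] by (subst \<eta>) (auto simp: fcycles_closed)
        then show ?thesis using x(1) fcycles_closed(5) by (metis image_eqI)
      next
        case False
        then have "\<eta> r (fcoset p (F r) 0) = f" using f by (simp add: \<eta>_def)
        then show ?thesis using fcycles_closed(1) by (metis image_eqI)
      qed
    qed (auto simp: \<eta>_def)
    ultimately show "bij_betw (\<eta> r) (carrier (add_monoid (pspace ?M r))) (carrier (add_monoid (pspace ?N r)))"
      unfolding bij_betw_def spM by (simp add: fhomology_simps carN)
  qed
  have nat: "\<eta> s (pmap ?M r s v) = pmap ?N r s (\<eta> r v)" if rs: "r \<le> s" and v: "v \<in> carrier (pspace ?M r)" for r s v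
  proof -
    obtain z where z: "z \<in> fcycles p (F r)" "v = fcoset p (F r) z" using v unfolding spM by (auto simp: fhomology_simps)
    have zs: "z \<in> fcycles p (F s)" using cyc_mono rs z(1) by blast
    \<comment> \<open>Entering \<open>J\<close> from the left: every cycle already bounds at
      \<open>r\<close>, hence at \<open>s\<close>, in accordance with the zero map of the interval
      module.\<close>
    have "L s z = 0" if "r \<notin> J" "s \<in> J"
      using out[OF that(1)] z(1) bnd_mono[OF rs] ker[OF that(2) zs] by blast
    then show ?thesis
      unfolding spM z(2) fhom_induced_id[OF z(1) F[OF rs]] using \<eta>[OF zs] \<eta>[OF z(1)] compat[of r s z] rs z(1)
      by (auto simp: mapN fun_eq_iff)
  qed
  show ?thesis
    unfolding has_bars_def pers_isomorphic_def using J lin nat by (intro conjI ballI exI[of _ \<eta>]) auto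
qed

theorem has_bars_none:
  fixes F :: "real \<Rightarrow> 'a topology" and J :: "'i \<Rightarrow> real set"
  assumes out: "\<And>r. fcycles p (F r) \<subseteq> (fboundaries p (F r) :: ('a, 'k::field) fchain set)"
  shows "has_bars (persistent_homology TYPE('k) p F) ({} :: 'i set) J"
proof -
  let ?N = "pers_direct_sum ({} :: 'i set) (\<lambda>i. interval_module (J i)) :: ('k, 'i \<Rightarrow> 'k) pers_module"
  let ?M = "persistent_homology TYPE('k) p F"
  \<comment> \<open>An empty direct sum consists of the extensional functions on the empty set,
    hence of one element.\<close>
  have carN: "carrier (pspace ?N r) = {\<lambda>_. undefined}" for r
    by (auto simp: pers_direct_sum_def)
  have spM: "pspace ?M r = fhomology p (F r)" for r by (simp add: persistent_homology_def)
  have opN: "add (pspace ?N r) f g = (\<lambda>_. undefined)" "smult (pspace ?N r) a f = (\<lambda>_. undefined)"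
    "pmap ?N r s f = (\<lambda>_. undefined)" for r s f g a
    by (auto simp: pers_direct_sum_def)
  have carM: "carrier (pspace ?M r) = {fcoset p (F r) 0}" for r
  proof -
    have "fcoset p (F r) z = fcoset p (F r) 0" if "z \<in> fcycles p (F r)" for z :: "('a, 'k) fchain"
      using out that by (auto simp: fcoset_eq_iff)
    moreover have "0 \<in> fcycles p (F r)" by (rule fcycles_closed)
    ultimately show ?thesis unfolding spM fhomology_simps by blast
  qed
  have "linear_iso (pspace ?M r) (pspace ?N r) (\<lambda>_ _. undefined)" for r
    unfolding linear_iso_def iso_def hom_def by (simp add: carN carM opN bij_betw_def)
  then show ?thesis
    unfolding has_bars_def pers_isomorphic_def
    by (intro conjI exI[of _ "\<lambda>r _ _. undefined"]) (auto simp: opN)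
qed

section \<open>The Wasserstein metric induces weak convergence\<close>

definition fexp :: "'a pmf \<Rightarrow> ('a \<Rightarrow> real) \<Rightarrow> real" where
  "fexp \<mu> g = (\<Sum>x\<in>set_pmf \<mu>. pmf \<mu> x * g x)"

lemma fexp_superset:
  assumes "finite A" "set_pmf \<mu> \<subseteq> A"
  shows "fexp \<mu> g = (\<Sum>x\<in>A. pmf \<mu> x * g x)"
  unfolding fexp_def using assms by (intro sum.mono_neutral_left) (auto simp: set_pmf_iff)

lemma fexp_mono: "(\<And>x. x \<in> set_pmf \<mu> \<Longrightarrow> f x \<le> g x) \<Longrightarrow> fexp \<mu> f \<le> fexp \<mu> g"
  unfolding fexp_def by (intro sum_mono mult_left_mono) auto

lemma fexp_nonneg: "(\<And>x. x \<in> set_pmf \<mu> \<Longrightarrow> 0 \<le> g x) \<Longrightarrow> 0 \<le> fexp \<mu> g"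
  unfolding fexp_def by (intro sum_nonneg) auto

lemma fexp_const: "finite (set_pmf \<mu>) \<Longrightarrow> fexp \<mu> (\<lambda>_. c) = c"
  by (simp add: fexp_def sum_pmf_eq_1 flip: sum_distrib_right)

lemma fexp_diff: "fexp \<mu> (\<lambda>x. f x - g x) = fexp \<mu> f - fexp \<mu> g"
  by (simp add: fexp_def right_diff_distrib sum_subtractf)

lemma fexp_cmult: "fexp \<mu> (\<lambda>x. c * f x) = c * fexp \<mu> f"
  by (simp add: fexp_def sum_distrib_left mult.left_commute)

lemma fexp_sum: "fexp \<mu> (\<lambda>x. \<Sum>i\<in>I. f i x) = (\<Sum>i\<in>I. fexp \<mu> (f i))"
  unfolding fexp_def sum_distrib_left by (rule sum.swap)

lemma fexp_pos:
  assumes "finite (set_pmf \<mu>)" "\<And>x. x \<in> set_pmf \<mu> \<Longrightarrow> 0 \<le> g x" "x \<in> set_pmf \<mu>" "0 < g x"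
  shows "0 < fexp \<mu> g"
proof -
  have "0 < pmf \<mu> x * g x" using assms by (simp add: pmf_positive)
  also have "\<dots> \<le> fexp \<mu> g" unfolding fexp_def using assms by (intro member_le_sum) auto
  finally show ?thesis .
qed

lemma fexp_abs_le: "finite (set_pmf \<mu>) \<Longrightarrow> (\<And>x. x \<in> set_pmf \<mu> \<Longrightarrow> \<bar>g x\<bar> \<le> c) \<Longrightarrow> \<bar>fexp \<mu> g\<bar> \<le> c"
  using fexp_mono[of \<mu> g "\<lambda>_. c"] fexp_mono[of \<mu> "\<lambda>_. - c" g] fexp_const[of \<mu> c] fexp_const[of \<mu> "- c"]
  by (fastforce simp: abs_le_iff)

lemma fin_probsD: "\<mu> \<in> fin_probs X \<Longrightarrow> finite (set_pmf \<mu>)" "\<mu> \<in> fin_probs X \<Longrightarrow> x \<in> set_pmf \<mu> \<Longrightarrow> x \<in> X"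
  by (auto simp: fin_probs_def)

section \<open>Bounds for the Wasserstein distance\<close>

lemma transport_plan_product:
  assumes "finite (set_pmf \<mu>)" "finite (set_pmf \<nu>)"
  shows "transport_plan \<mu> \<nu> (\<lambda>x y. pmf \<mu> x * pmf \<nu> y)"
  using assms by (simp add: transport_plan_def sum_pmf_eq_1 flip: sum_distrib_left sum_distrib_right)

lemma wasserstein_greatest:
  assumes "finite (set_pmf \<mu>)" "finite (set_pmf \<nu>)"
    and "\<And>\<kappa>. transport_plan \<mu> \<nu> \<kappa> \<Longrightarrow> c \<le> (\<Sum>x\<in>set_pmf \<mu>. \<Sum>y\<in>set_pmf \<nu>. \<kappa> x y * d x y)"
  shows "c \<le> wasserstein d \<mu> \<nu>"
  unfolding wasserstein_def using assms transport_plan_product[OF assms(1,2)]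
  by (auto intro!: cInf_greatest)

lemma wasserstein_lower:
  assumes "finite (set_pmf \<mu>)" "finite (set_pmf \<nu>)" "transport_plan \<mu> \<nu> \<kappa>" "\<And>x y. 0 \<le> d x y"
  shows "wasserstein d \<mu> \<nu> \<le> (\<Sum>x\<in>set_pmf \<mu>. \<Sum>y\<in>set_pmf \<nu>. \<kappa> x y * d x y)"
proof -
  have "bdd_below {(\<Sum>x\<in>set_pmf \<mu>. \<Sum>y\<in>set_pmf \<nu>. \<kappa> x y * d x y) | \<kappa>. transport_plan \<mu> \<nu> \<kappa>}"
    by (rule bdd_belowI[of _ 0]) (use assms(4) in \<open>auto simp: transport_plan_def intro!: sum_nonneg\<close>)
  then show ?thesis
    unfolding wasserstein_def using assms by (auto intro!: cInf_lower)
qed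

text \<open>The easy half of Kantorovich duality. The additive \<open>e\<close> admits functions
  that are merely continuous: on a compact space they are Lipschitz up to an arbitrarily small
  error.\<close>

lemma fexp_diff_le_wasserstein:
  assumes \<mu>: "\<mu> \<in> fin_probs X" and \<nu>: "\<nu> \<in> fin_probs X" and C: "0 < C"
    and g: "\<And>x y. x \<in> X \<Longrightarrow> y \<in> X \<Longrightarrow> \<bar>g x - g y\<bar> \<le> e + C * d x y"
  shows "\<bar>fexp \<mu> g - fexp \<nu> g\<bar> \<le> e + C * wasserstein d \<mu> \<nu>"
proof -
  note fin = fin_probsD(1)[OF \<mu>] fin_probsD(1)[OF \<nu>]
  have "(\<bar>fexp \<mu> g - fexp \<nu> g\<bar> - e) / C \<le> wasserstein d \<mu> \<nu>"
  proof (rule wasserstein_greatest[OF fin])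
    fix \<kappa> assume k: "transport_plan \<mu> \<nu> \<kappa>"
    let ?S = "\<lambda>f. \<Sum>x\<in>set_pmf \<mu>. \<Sum>y\<in>set_pmf \<nu>. \<kappa> x y * f x y"
    have 1: "fexp \<mu> g = ?S (\<lambda>x y. g x)"
      using k by (simp add: fexp_def transport_plan_def flip: sum_distrib_right)
    have 2: "fexp \<nu> g = ?S (\<lambda>x y. g y)"
      by (subst sum.swap) (use k in \<open>simp add: fexp_def transport_plan_def flip: sum_distrib_right\<close>)
    have 3: "?S (\<lambda>x y. e) = e"
      using k fin by (simp add: transport_plan_def sum_pmf_eq_1 flip: sum_distrib_right)
    have "\<bar>fexp \<mu> g - fexp \<nu> g\<bar> = \<bar>?S (\<lambda>x y. g x - g y)\<bar>"
      unfolding 1 2 by (simp add: right_diff_distrib sum_subtractf)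
    also have "\<dots> \<le> ?S (\<lambda>x y. \<bar>g x - g y\<bar>)"
      using k by (intro order_trans[OF sum_abs] sum_mono order_trans[OF sum_abs])
        (auto simp: abs_mult transport_plan_def)
    also have "\<dots> \<le> ?S (\<lambda>x y. e + C * d x y)"
      using k g fin_probsD(2)[OF \<mu>] fin_probsD(2)[OF \<nu>]
      by (intro sum_mono mult_left_mono) (auto simp: transport_plan_def)
    also have "\<dots> = e + C * ?S d"
      using 3 by (simp add: distrib_left sum.distrib sum_distrib_left mult.left_commute)
    finally show "(\<bar>fexp \<mu> g - fexp \<nu> g\<bar> - e) / C \<le> ?S d"
      using C by (simp add: field_simps)
  qed
  then show ?thesis using C by (simp add: field_simps)
qed

text \<open>A partial transport plan is completed by transporting the remaining mass arbitrarily.\<close>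

lemma wasserstein_le_partial_plan:
  assumes fin: "finite (set_pmf \<mu>)" "finite (set_pmf \<nu>)" and d: "\<And>x y. 0 \<le> d x y" "\<And>x y. d x y \<le> D"
    and p: "\<And>x y. 0 \<le> p x y"
    and row: "\<And>x. x \<in> set_pmf \<mu> \<Longrightarrow> (\<Sum>y\<in>set_pmf \<nu>. p x y) \<le> pmf \<mu> x"
    and col: "\<And>y. y \<in> set_pmf \<nu> \<Longrightarrow> (\<Sum>x\<in>set_pmf \<mu>. p x y) \<le> pmf \<nu> y"
  shows "wasserstein d \<mu> \<nu> \<le> (\<Sum>x\<in>set_pmf \<mu>. \<Sum>y\<in>set_pmf \<nu>. p x y * d x y)
           + D * (1 - (\<Sum>x\<in>set_pmf \<mu>. \<Sum>y\<in>set_pmf \<nu>. p x y))"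
proof -
  define r where "r x = pmf \<mu> x - (\<Sum>y\<in>set_pmf \<nu>. p x y)" for x
  define s where "s y = pmf \<nu> y - (\<Sum>x\<in>set_pmf \<mu>. p x y)" for y
  define R where "R = 1 - (\<Sum>x\<in>set_pmf \<mu>. \<Sum>y\<in>set_pmf \<nu>. p x y)"
  have Rr: "(\<Sum>x\<in>set_pmf \<mu>. r x) = R"
    using fin by (simp add: r_def R_def sum_subtractf sum_pmf_eq_1)
  have Rs: "(\<Sum>y\<in>set_pmf \<nu>. s y) = R"
    using fin unfolding s_def R_def by (subst sum.swap) (simp add: sum_subtractf sum_pmf_eq_1)
  have r0: "0 \<le> r x" if "x \<in> set_pmf \<mu>" for x using row[OF that] by (simp add: r_def)
  have s0: "0 \<le> s y" if "y \<in> set_pmf \<nu>" for y using col[OF that] by (simp add: s_def)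
  have R0: "0 \<le> R" unfolding Rr[symmetric] using r0 by (rule sum_nonneg)
  have rz: "r x = 0" if "x \<in> set_pmf \<mu>" "R = 0" for x
    using Rr that sum_nonneg_eq_0_iff[of "set_pmf \<mu>" r] fin r0 by auto
  have sz: "s y = 0" if "y \<in> set_pmf \<nu>" "R = 0" for y
    using Rs that sum_nonneg_eq_0_iff[of "set_pmf \<nu>" s] fin s0 by auto
  \<comment> \<open>The leftover masses \<open>r\<close> and \<open>s\<close>, both of total
    \<open>R\<close>, are coupled as a product. For \<open>R = 0\<close> both vanish and division by
    zero gives 0, so the formula also covers a plan that is already complete.\<close>
  define k where "k x y = p x y + r x * s y / R" for x y
  have "transport_plan \<mu> \<nu> k"
    unfolding transport_plan_def
  proof (intro conjI ballI)
    show "0 \<le> k x y" if "x \<in> set_pmf \<mu>" "y \<in> set_pmf \<nu>" for x y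
      using that r0 s0 R0 p by (simp add: k_def)
    show "(\<Sum>y\<in>set_pmf \<nu>. k x y) = pmf \<mu> x" if "x \<in> set_pmf \<mu>" for x
    proof -
      have "(\<Sum>y\<in>set_pmf \<nu>. k x y) = (\<Sum>y\<in>set_pmf \<nu>. p x y) + r x * R / R"
        by (simp add: k_def sum.distrib Rs flip: sum_divide_distrib sum_distrib_left)
      also have "r x * R / R = r x" using rz[OF that] by (cases "R = 0") auto
      finally show ?thesis by (simp add: r_def)
    qed
    show "(\<Sum>x\<in>set_pmf \<mu>. k x y) = pmf \<nu> y" if "y \<in> set_pmf \<nu>" for y
    proof -
      have "(\<Sum>x\<in>set_pmf \<mu>. k x y) = (\<Sum>x\<in>set_pmf \<mu>. p x y) + R * s y / R"
        by (simp add: k_def sum.distrib Rr flip: sum_divide_distrib sum_distrib_right)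
      also have "R * s y / R = s y" using sz[OF that] by (cases "R = 0") auto
      finally show ?thesis by (simp add: s_def)
    qed
  qed
  from wasserstein_lower[OF fin this d(1)]
  have "wasserstein d \<mu> \<nu> \<le> (\<Sum>x\<in>set_pmf \<mu>. \<Sum>y\<in>set_pmf \<nu>. k x y * d x y)" .
  also have "\<dots> = (\<Sum>x\<in>set_pmf \<mu>. \<Sum>y\<in>set_pmf \<nu>. p x y * d x y) + (\<Sum>x\<in>set_pmf \<mu>. \<Sum>y\<in>set_pmf \<nu>. r x * s y / R * d x y)"
    by (simp add: k_def distrib_right sum.distrib)
  also have "(\<Sum>x\<in>set_pmf \<mu>. \<Sum>y\<in>set_pmf \<nu>. r x * s y / R * d x y) \<le> (\<Sum>x\<in>set_pmf \<mu>. \<Sum>y\<in>set_pmf \<nu>. r x * s y / R * D)"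
    using d(2) r0 s0 R0 by (intro sum_mono mult_left_mono) auto
  also have "(\<Sum>x\<in>set_pmf \<mu>. \<Sum>y\<in>set_pmf \<nu>. r x * s y / R * D) = R * R / R * D"
    unfolding sum_distrib_right[symmetric] sum_divide_distrib[symmetric] sum_distrib_left[symmetric] Rs
    unfolding sum_distrib_right[symmetric] sum_divide_distrib[symmetric] Rr ..
  also have "\<dots> = D * R" by simp
  finally show ?thesis by (simp add: R_def)
qed

lemma circle_dist_le_pi: "circle_dist x y \<le> pi"
  using Arg_bounded[of "x / y"] by (auto simp: circle_dist_def)

lemma circle_dist_nonneg: "0 \<le> circle_dist x y"
  by (simp add: circle_dist_def)

lemma cis_Arg_circle: "z \<in> circle \<Longrightarrow> cis (Arg z) = z"
  by (metis cis_Arg div_by_1 dist_0_norm mem_sphere norm_eq_zero of_real_1 scaleR_one sgn_eq zero_neq_one)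

lemma norm_cis_minus_1_le: "norm (cis t - 1) \<le> \<bar>t\<bar>"
proof (rule power2_le_imp_le)
  have "(norm (cis t - 1))\<^sup>2 = (cos t - 1)\<^sup>2 + (sin t)\<^sup>2" by (simp add: cmod_power2)
  also have "\<dots> = 2 - 2 * cos (2 * (t / 2))"
    using sin_cos_squared_add[of t] by (simp add: power2_eq_square algebra_simps)
  also have "\<dots> = (2 * \<bar>sin (t / 2)\<bar>)\<^sup>2" unfolding cos_double_sin by (simp add: power_mult_distrib)
  also have "\<dots> \<le> \<bar>t\<bar>\<^sup>2" using abs_sin_x_le_abs_x[of "t / 2"] by (intro power_mono) auto
  finally show "(norm (cis t - 1))\<^sup>2 \<le> \<bar>t\<bar>\<^sup>2" .
qed simp

lemma dist_le_circle_dist: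
  assumes "x \<in> circle" "y \<in> circle"
  shows "dist x y \<le> circle_dist x y"
proof -
  have y: "norm y = 1" "y \<noteq> 0" using assms by auto
  let ?t = "Arg (x / y)"
  have "x / y \<in> circle" using assms by (simp add: norm_divide)
  then have c: "cis ?t = x / y" by (rule cis_Arg_circle)
  have "dist x y = norm (y * (x / y - 1))" using y by (simp add: dist_norm right_diff_distrib)
  also have "\<dots> = norm (cis ?t - 1)" using y by (simp add: norm_mult c)
  also have "\<dots> \<le> \<bar>?t\<bar>"
    by (rule norm_cis_minus_1_le)
  finally show ?thesis by (simp add: circle_dist_def)
qed

abbreviation wass_top :: "complex pmf topology" where
  "wass_top \<equiv> Metric_space.mtopology (fin_probs circle) (wasserstein circle_dist)"

lemma topspace_wass_top: "topspace wass_top = fin_probs circle"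
  by (rule Metric_space.topspace_mtopology[OF Metric_space_wasserstein[OF Metric_space_circle]])

lemma compact_circle: "compact circle"
  by (rule compact_sphere)

text \<open>Uniform continuity of \<open>g\<close> handles near points and boundedness handles far
  ones; together they give a Lipschitz bound up to \<open>e / 2\<close>, to which
  \<open>fexp_diff_le_wasserstein\<close> applies.\<close>

lemma continuous_map_fexp:
  assumes g: "continuous_on circle g"
  shows "continuous_map wass_top euclideanreal (\<lambda>\<mu>. fexp \<mu> g)"
proof -
  interpret W: Metric_space "fin_probs circle" "wasserstein circle_dist"
    by (rule Metric_space_wasserstein[OF Metric_space_circle])
  have "continuous_map wass_top (Metric_space.mtopology UNIV dist) (\<lambda>\<mu>. fexp \<mu> g)"
    unfolding W.metric_continuous_map[OF Met_TC.Metric_space_axioms]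
  proof (intro conjI ballI allI impI)
    fix \<mu> and e :: real assume \<mu>: "\<mu> \<in> fin_probs circle" and e: "0 < e"
    have "bounded (g ` circle)" using compact_continuous_image[OF g compact_circle] by (rule compact_imp_bounded)
    then obtain M where M: "0 < M" "\<And>x. x \<in> circle \<Longrightarrow> \<bar>g x\<bar> \<le> M" by (auto simp: bounded_pos)
    have "uniformly_continuous_on circle g" using g compact_circle by (rule compact_uniformly_continuous)
    then obtain d where d: "0 < d" "\<And>x y. x \<in> circle \<Longrightarrow> y \<in> circle \<Longrightarrow> dist y x < d \<Longrightarrow> dist (g y) (g x) < e / 2"
      using e unfolding uniformly_continuous_on_def by (metis half_gt_zero)
    \<comment> \<open>With this slope the Lipschitz term alone reaches the maximal oscillation
      \<open>2 * M\<close> at distance \<open>d\<close>.\<close>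
    define C where "C = 2 * M / d"
    have C: "0 < C" using M d by (simp add: C_def)
    have bd: "\<bar>g x - g y\<bar> \<le> e / 2 + C * circle_dist x y" if xy: "x \<in> circle" "y \<in> circle" for x y
    proof (cases "dist x y < d")
      case True
      then show ?thesis using d(2)[OF xy(2,1)] C circle_dist_nonneg[of x y] e
        by (smt (verit) dist_real_def mult_nonneg_nonneg)
    next
      case False
      then have "d \<le> circle_dist x y" using dist_le_circle_dist[OF xy] by simp
      then have "2 * M \<le> C * circle_dist x y" using M d by (simp add: C_def field_simps)
      then show ?thesis using M(2)[OF xy(1)] M(2)[OF xy(2)] e by linarith
    qed
    have "dist (fexp \<mu> g) (fexp \<nu> g) < e"
      if "\<nu> \<in> fin_probs circle" "wasserstein circle_dist \<mu> \<nu> < e / (2 * C)" for \<nu>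
    proof -
      have "C * wasserstein circle_dist \<mu> \<nu> < e / 2" using that(2) C by (simp add: field_simps)
      moreover have "\<bar>fexp \<mu> g - fexp \<nu> g\<bar> \<le> e / 2 + C * wasserstein circle_dist \<mu> \<nu>"
        by (rule fexp_diff_le_wasserstein[OF \<mu> that(1) C]) (rule bd)
      ultimately show ?thesis by (simp add: dist_real_def)
    qed
    then show "\<exists>\<delta>>0. \<forall>\<nu>. \<nu> \<in> fin_probs circle \<and> wasserstein circle_dist \<mu> \<nu> < \<delta> \<longrightarrow> dist (fexp \<mu> g) (fexp \<nu> g) < e"
      using C e by (intro exI[of _ "e / (2 * C)"]) auto
  qed auto
  then show ?thesis by simp
qed

lemma circle_dist_continuous_at:
  assumes "x \<in> circle" "0 < e"
  obtains d where "0 < d" "\<And>y. y \<in> circle \<Longrightarrow> dist y x < d \<Longrightarrow> circle_dist y x < e"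
proof -
  have x: "x \<noteq> 0" using assms by auto
  have "isCont (\<lambda>y. Arg (y / x)) x"
  proof (rule isCont_o2[where g = Arg])
    show "isCont (\<lambda>y. y / x) x" using x by (intro continuous_intros) auto
    show "isCont Arg (x / x)" using x by (intro continuous_at_Arg) simp
  qed
  then have "\<exists>d>0. \<forall>y. dist y x < d \<longrightarrow> dist (Arg (y / x)) (Arg (x / x)) < e"
    using assms(2) unfolding continuous_at_eps_delta by blast
  then show thesis using that x by (auto simp: circle_dist_def Arg_eq_0)
qed

text \<open>Near a finitely supported measure, most of the mass is seen by bump functions around the atoms
  and can be moved there at small cost.\<close>

lemma continuous_map_into_wass_top:
  assumes F: "\<And>t. t \<in> topspace T \<Longrightarrow> F t \<in> fin_probs circle"
    and cont: "\<And>g. continuous_on circle g \<Longrightarrow> continuous_map T euclideanreal (\<lambda>t. fexp (F t) g)"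
  shows "continuous_map T wass_top F"
proof -
  interpret W: Metric_space "fin_probs circle" "wasserstein circle_dist"
    by (rule Metric_space_wasserstein[OF Metric_space_circle])
  show ?thesis
    unfolding W.continuous_map_to_metric
  proof (intro ballI allI impI)
    fix t0 and e :: real assume t0: "t0 \<in> topspace T" and e: "0 < e"
    let ?\<mu> = "F t0" and ?A = "set_pmf (F t0)"
    have \<mu>: "finite ?A" "?A \<subseteq> circle" using F[OF t0] by (auto simp: fin_probs_def)
    have "\<forall>x\<in>?A. \<exists>d>0. \<forall>y\<in>circle. dist y x < d \<longrightarrow> circle_dist y x < e / 2"
      using circle_dist_continuous_at[of _ "e / 2"] e \<mu>(2) by (metis half_gt_zero subsetD)
    then obtain dd where dd: "\<And>x. x \<in> ?A \<Longrightarrow> dd x > 0"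
        "\<And>x y. x \<in> ?A \<Longrightarrow> y \<in> circle \<Longrightarrow> dist y x < dd x \<Longrightarrow> circle_dist y x < e / 2"
      by metis
    \<comment> \<open>Bumps of this radius around the atoms have disjoint supports, vanish at the
      other atoms and stay within arc length \<open>e / 2\<close> of their centres. The 1 keeps the
      set nonempty.\<close>
    define \<eta> where "\<eta> = Min (insert 1 (dd ` ?A \<union> (\<lambda>(x, y). dist x y / 2) ` {(x, y) \<in> ?A \<times> ?A. x \<noteq> y}))"
    have fin: "finite (insert 1 (dd ` ?A \<union> (\<lambda>(x, y). dist x y / 2) ` {(x, y) \<in> ?A \<times> ?A. x \<noteq> y}))"
      using \<mu>(1) by (auto intro: finite_subset[of _ "?A \<times> ?A"])
    have \<eta>0: "0 < \<eta>" unfolding \<eta>_def using fin dd(1) by (subst Min_gr_iff) auto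
    have \<eta>1: "\<eta> \<le> dd x" if "x \<in> ?A" for x unfolding \<eta>_def using fin that by (intro Min_le) auto
    have \<eta>2: "2 * \<eta> \<le> dist x y" if "x \<in> ?A" "y \<in> ?A" "x \<noteq> y" for x y
    proof -
      have "\<eta> \<le> dist x y / 2" unfolding \<eta>_def using fin that by (intro Min_le) force+
      then show ?thesis by simp
    qed
    define b where "b x y = max 0 (1 - dist y x / \<eta>)" for x y :: complex
    have b0: "0 \<le> b x y" for x y by (simp add: b_def)
    have b1: "b x y \<le> 1" for x y using \<eta>0 by (simp add: b_def)
    have bpos: "dist y x < \<eta>" if "b x y \<noteq> 0" for x y using that \<eta>0 by (auto simp: b_def max_def field_simps split: if_splits)
    have bsum: "(\<Sum>x\<in>?A. b x y) \<le> 1" for y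
    proof (cases "\<exists>x\<in>?A. b x y \<noteq> 0")
      case True
      then obtain x where x: "x \<in> ?A" "b x y \<noteq> 0" by blast
      have "b x' y = 0" if "x' \<in> ?A" "x' \<noteq> x" for x'
      proof (rule ccontr)
        assume "b x' y \<noteq> 0"
        then have "dist y x' < \<eta>" "dist y x < \<eta>" using bpos x by auto
        then have "dist x' x < 2 * \<eta>" by (smt (verit) dist_commute dist_triangle)
        then show False using \<eta>2[OF that(1) x(1) that(2)] by simp
      qed
      then have "(\<Sum>x\<in>?A. b x y) = b x y" using \<mu>(1) x(1) by (subst sum.remove[of _ x]) auto
      then show ?thesis using b1 by simp
    qed simp
    have bdelta: "b x x' = (if x' = x then 1 else 0)" if "x \<in> ?A" "x' \<in> ?A" for x x'
      using bpos[of x x'] \<eta>2[of x' x] that \<eta>0 by (cases "x' = x") (auto simp: b_def)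
    have fexp0: "fexp ?\<mu> (b x) = pmf ?\<mu> x" if "x \<in> ?A" for x
    proof -
      have "fexp ?\<mu> (b x) = (\<Sum>x'\<in>?A. if x' = x then pmf ?\<mu> x' else 0)"
        unfolding fexp_def by (intro sum.cong) (auto simp: bdelta that)
      then show ?thesis using \<mu>(1) that by simp
    qed
    \<comment> \<open>\<open>\<Delta> t\<close> bounds the mass that the bumps fail to match. Moving
      it costs at most \<open>pi\<close> per unit, whence the threshold
      \<open>e / (2 * pi)\<close>.\<close>
    define \<Delta> where "\<Delta> t = (\<Sum>x\<in>?A. \<bar>fexp (F t) (b x) - pmf ?\<mu> x\<bar>)" for t
    have "continuous_on circle (b x)" for x unfolding b_def using \<eta>0 by (intro continuous_intros) auto
    then have "continuous_map T euclideanreal (\<lambda>t. fexp (F t) (b x))" for x by (rule cont)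
    then have "continuous_map T euclideanreal \<Delta>"
      unfolding \<Delta>_def using \<mu>(1) by (intro continuous_intros) auto
    then have op: "openin T {t \<in> topspace T. \<Delta> t \<in> {..< e / (2 * pi)}}"
      by (rule openin_continuous_map_preimage) auto
    have "wasserstein circle_dist (F t0) (F t) < e" if t: "t \<in> topspace T" "\<Delta> t < e / (2 * pi)" for t
    proof -
      let ?\<nu> = "F t" and ?B = "set_pmf (F t)"
      have \<nu>: "finite ?B" "?B \<subseteq> circle" using F[OF t(1)] by (auto simp: fin_probs_def)
      define a where "a x = pmf ?\<mu> x" for x
      define \<beta> where "\<beta> x = fexp ?\<nu> (b x)" for x
      \<comment> \<open>Scales the mass seen by the bump at \<open>x\<close> so that
        \<open>\<beta> x * w x\<close> is the minimum of \<open>a x\<close> and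
        \<open>\<beta> x\<close>: the atom never receives more than its weight.\<close>
      define w where "w x = a x / max (a x) (\<beta> x)" for x
      define p where "p y x = (if x \<in> ?A then pmf ?\<nu> y * b x y * w x else 0)" for y x
      have a0: "0 < a x" if "x \<in> ?A" for x using that by (simp add: a_def pmf_positive)
      have \<beta>0: "0 \<le> \<beta> x" for x unfolding \<beta>_def using b0 by (intro fexp_nonneg) auto
      have q: "0 \<le> w x" "w x \<le> 1" if "x \<in> ?A" for x
        using a0[OF that] by (auto simp: max_def w_def)
      have p0: "0 \<le> p y x" for y x
        unfolding p_def using b0 q by auto
      have colsum: "(\<Sum>y\<in>?B. p y x) = \<beta> x * w x" if "x \<in> ?A" for x
        using that by (simp add: p_def \<beta>_def fexp_def sum_distrib_right)
      have tot: "1 - (\<Sum>y\<in>?B. \<Sum>x\<in>?A. p y x) \<le> \<Delta> t"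
      proof -
        have "a x - \<bar>\<beta> x - a x\<bar> \<le> \<beta> x * w x" if "x \<in> ?A" for x
          using a0[OF that] \<beta>0[of x] by (auto simp: max_def w_def)
        then have "(\<Sum>x\<in>?A. a x - \<bar>\<beta> x - a x\<bar>) \<le> (\<Sum>x\<in>?A. \<Sum>y\<in>?B. p y x)"
          by (intro sum_mono) (simp add: colsum)
        moreover have "(\<Sum>x\<in>?A. a x - \<bar>\<beta> x - a x\<bar>) = 1 - \<Delta> t"
          using \<mu>(1) by (simp add: sum_subtractf \<Delta>_def a_def \<beta>_def sum_pmf_eq_1)
        ultimately show ?thesis by (subst sum.swap) simp
      qed
      have cost: "(\<Sum>y\<in>?B. \<Sum>x\<in>?A. p y x * circle_dist y x) \<le> e / 2"
      proof -
        have "(\<Sum>y\<in>?B. \<Sum>x\<in>?A. p y x * circle_dist y x) \<le> (\<Sum>y\<in>?B. \<Sum>x\<in>?A. pmf ?\<nu> y * b x y * (e / 2))"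
        proof (intro sum_mono)
          fix y x assume yx: "y \<in> ?B" "x \<in> ?A"
          show "p y x * circle_dist y x \<le> pmf ?\<nu> y * b x y * (e / 2)"
          proof (cases "b x y = 0")
            case False
            then have "dist y x < dd x" using bpos[of x y] \<eta>1[OF yx(2)] by simp
            then have "circle_dist y x \<le> e / 2" using dd(2)[OF yx(2)] yx(1) \<nu>(2) by force
            moreover have "p y x \<le> pmf ?\<nu> y * b x y"
              using q[OF yx(2)] b0[of x y] yx(2) unfolding p_def by (simp add: mult_left_le)
            ultimately show ?thesis using p0[of y x] b0[of x y] circle_dist_nonneg[of y x]
              by (intro mult_mono) auto
          qed (simp add: p_def)
        qed
        also have "\<dots> = (\<Sum>y\<in>?B. pmf ?\<nu> y * (e / 2) * (\<Sum>x\<in>?A. b x y))"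
          unfolding sum_distrib_left by (intro sum.cong refl) (simp add: mult_ac)
        also have "\<dots> \<le> (\<Sum>y\<in>?B. pmf ?\<nu> y * (e / 2))"
          using e bsum by (intro sum_mono mult_left_le) (auto intro: sum_nonneg b0)
        also have "\<dots> = e / 2" using \<nu>(1) by (simp add: sum_pmf_eq_1 flip: sum_distrib_right sum_divide_distrib)
        finally show ?thesis .
      qed
      have "wasserstein circle_dist ?\<nu> ?\<mu> \<le> (\<Sum>y\<in>?B. \<Sum>x\<in>?A. p y x * circle_dist y x) + pi * (1 - (\<Sum>y\<in>?B. \<Sum>x\<in>?A. p y x))"
      proof (rule wasserstein_le_partial_plan[OF \<nu>(1) \<mu>(1) circle_dist_nonneg circle_dist_le_pi p0])
        fix y assume "y \<in> ?B"
        have "(\<Sum>x\<in>?A. p y x) \<le> (\<Sum>x\<in>?A. pmf ?\<nu> y * b x y)"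
          using q b0 by (intro sum_mono) (simp add: p_def mult_left_le)
        also have "\<dots> \<le> pmf ?\<nu> y" using bsum[of y] by (simp add: mult_left_le b0 sum_nonneg flip: sum_distrib_left)
        finally show "(\<Sum>x\<in>?A. p y x) \<le> pmf ?\<nu> y" .
      next
        fix x assume x: "x \<in> ?A"
        show "(\<Sum>y\<in>?B. p y x) \<le> pmf ?\<mu> x"
          unfolding colsum[OF x] using a0[OF x] \<beta>0[of x] by (auto simp: max_def a_def w_def field_simps)
      qed
      also have "\<dots> \<le> e / 2 + pi * \<Delta> t" using cost tot by (intro add_mono mult_left_mono) auto
      also have "\<dots> < e" using t(2) by (simp add: field_simps)
      finally show ?thesis by (simp add: W.commute)
    qed
    moreover have "\<Delta> t0 = 0" by (simp add: \<Delta>_def fexp0)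
    ultimately show "\<exists>U. openin T U \<and> t0 \<in> U \<and> (\<forall>t\<in>U. F t \<in> W.mball (F t0) e)"
      using op t0 F e by (intro exI[of _ "{t \<in> topspace T. \<Delta> t \<in> {..< e / (2 * pi)}}"]) auto
  qed
qed

text \<open>The circle is compact, so \<open>G q\<close> varies uniformly with \<open>q\<close>; the
  change of the integral splits into a change of the integrand and a change of the measure.\<close>

lemma continuous_map_fexp_param:
  fixes q :: "'t \<Rightarrow> 'q::topological_space" and G :: "'q \<Rightarrow> complex \<Rightarrow> real"
  assumes m: "continuous_map T wass_top m" and q: "continuous_map T euclidean q"
    and Q: "\<And>t. t \<in> topspace T \<Longrightarrow> q t \<in> Q"
    and G: "continuous_on (Q \<times> circle) (\<lambda>(q, x). G q x)"
  shows "continuous_map T euclideanreal (\<lambda>t. fexp (m t) (G (q t)))"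
proof -
  have "continuous_map T Met_TC.mtopology (\<lambda>t. fexp (m t) (G (q t)))"
    unfolding Met_TC.continuous_map_to_metric
  proof (intro ballI allI impI)
    fix t0 and e :: real assume t0: "t0 \<in> topspace T" and e: "0 < e"
    obtain X0 where X0: "q t0 \<in> X0" "open X0"
        "\<forall>p\<in>X0 \<inter> Q. \<forall>x\<in>circle. dist ((\<lambda>(q, x). G q x) (p, x)) ((\<lambda>(q, x). G q x) (q t0, x)) \<le> e / 3"
      using continuous_on_prod_compactE[OF G compact_circle Q[OF t0], of "e / 3"] e by auto
    have "continuous_on circle (\<lambda>x. (\<lambda>(q, x). G q x) (q t0, x))"
      by (rule continuous_on_compose2[OF G]) (use Q[OF t0] in \<open>auto intro!: continuous_intros\<close>)
    then have c0: "continuous_on circle (G (q t0))" by simp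
    have c: "continuous_map T euclideanreal (\<lambda>t. fexp (m t) (G (q t0)))"
      using continuous_map_compose[OF m continuous_map_fexp[OF c0]] by (simp add: o_def)
    define U where "U = {t \<in> topspace T. q t \<in> X0} \<inter> {t \<in> topspace T. fexp (m t) (G (q t0)) \<in> ball (fexp (m t0) (G (q t0))) (e / 3)}"
    have "openin T U"
      unfolding U_def using X0(2) q c by (intro openin_Int openin_continuous_map_preimage) auto
    moreover have "t0 \<in> U" using X0 t0 e by (simp add: U_def)
    moreover have "fexp (m t) (G (q t)) \<in> Met_TC.mball (fexp (m t0) (G (q t0))) e" if t: "t \<in> U" for t
    proof -
      have tt: "t \<in> topspace T" "q t \<in> X0 \<inter> Q" using t Q by (auto simp: U_def)
      have mt: "m t \<in> fin_probs circle" using continuous_map_image_subset_topspace[OF m] tt(1) topspace_wass_top by auto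
      have "\<bar>fexp (m t) (\<lambda>x. G (q t) x - G (q t0) x)\<bar> \<le> e / 3"
        using X0(3) tt(2) fin_probsD[OF mt] by (intro fexp_abs_le) (auto simp: dist_real_def)
      moreover have "\<bar>fexp (m t) (G (q t0)) - fexp (m t0) (G (q t0))\<bar> < e / 3"
        using t by (simp add: U_def dist_real_def abs_minus_commute)
      ultimately show ?thesis using e by (simp add: fexp_diff dist_real_def abs_if split: if_splits)
    qed
    ultimately show "\<exists>U. openin T U \<and> t0 \<in> U \<and> (\<forall>t\<in>U. fexp (m t) (G (q t)) \<in> Met_TC.mball (fexp (m t0) (G (q t0))) e)"
      by blast
  qed
  then show ?thesis by simp
qed

section \<open>Operations on finitely supported measures\<close>

definition reweight :: "'a pmf \<Rightarrow> ('a \<Rightarrow> real) \<Rightarrow> 'a pmf" where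
  "reweight \<mu> h = embed_pmf (\<lambda>x. pmf \<mu> x * h x / fexp \<mu> h)"

definition mix :: "real \<Rightarrow> 'a pmf \<Rightarrow> 'a pmf \<Rightarrow> 'a pmf" where
  "mix t \<mu> \<nu> = bind_pmf (bernoulli_pmf t) (\<lambda>b. if b then \<nu> else \<mu>)"

lemma pmf_reweight:
  assumes "finite (set_pmf \<mu>)" "\<And>x. 0 \<le> h x" "0 < fexp \<mu> h"
  shows "pmf (reweight \<mu> h) x = pmf \<mu> x * h x / fexp \<mu> h"
  unfolding reweight_def
proof (rule pmf_embed_pmf)
  show "0 \<le> pmf \<mu> x * h x / fexp \<mu> h" for x using assms by simp
  have "(\<integral>\<^sup>+x. ennreal (pmf \<mu> x * h x / fexp \<mu> h) \<partial>count_space UNIV) =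
        (\<Sum>x\<in>set_pmf \<mu>. ennreal (pmf \<mu> x * h x / fexp \<mu> h))"
    using assms(1) by (intro nn_integral_count_space') (auto simp: set_pmf_iff)
  also have "\<dots> = ennreal (\<Sum>x\<in>set_pmf \<mu>. pmf \<mu> x * h x / fexp \<mu> h)"
    using assms by (intro sum_ennreal) simp
  also have "(\<Sum>x\<in>set_pmf \<mu>. pmf \<mu> x * h x / fexp \<mu> h) = 1"
    using assms(3) by (simp add: fexp_def flip: sum_divide_distrib)
  finally show "(\<integral>\<^sup>+x. ennreal (pmf \<mu> x * h x / fexp \<mu> h) \<partial>count_space UNIV) = 1" by simp
qed

lemma set_pmf_reweight:
  assumes "finite (set_pmf \<mu>)" "\<And>x. 0 \<le> h x" "0 < fexp \<mu> h"
  shows "set_pmf (reweight \<mu> h) = {x \<in> set_pmf \<mu>. h x \<noteq> 0}"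
  using assms(3) by (auto simp: set_pmf_iff pmf_reweight[OF assms])

lemma fexp_reweight:
  assumes "finite (set_pmf \<mu>)" "\<And>x. 0 \<le> h x" "0 < fexp \<mu> h"
  shows "fexp (reweight \<mu> h) g = fexp \<mu> (\<lambda>x. h x * g x) / fexp \<mu> h"
proof -
  have "fexp (reweight \<mu> h) g = (\<Sum>x\<in>set_pmf \<mu>. pmf (reweight \<mu> h) x * g x)"
    using assms by (intro fexp_superset) (auto simp: set_pmf_reweight)
  then show ?thesis
    by (simp add: pmf_reweight[OF assms] fexp_def sum_divide_distrib mult.assoc)
qed

lemma pmf_mix: "0 \<le> t \<Longrightarrow> t \<le> 1 \<Longrightarrow> pmf (mix t \<mu> \<nu>) x = (1 - t) * pmf \<mu> x + t * pmf \<nu> x"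
  by (simp add: mix_def pmf_bind)

lemma set_pmf_mix: "0 \<le> t \<Longrightarrow> t \<le> 1 \<Longrightarrow> set_pmf (mix t \<mu> \<nu>) \<subseteq> set_pmf \<mu> \<union> set_pmf \<nu>"
  by (auto simp: set_pmf_iff pmf_mix)

lemma mix_0: "mix 0 \<mu> \<nu> = \<mu>" and mix_1: "mix 1 \<mu> \<nu> = \<nu>"
  by (auto intro: pmf_eqI simp: pmf_mix)

lemma fexp_mix:
  assumes "0 \<le> t" "t \<le> 1" "finite (set_pmf \<mu>)" "finite (set_pmf \<nu>)"
  shows "fexp (mix t \<mu> \<nu>) g = (1 - t) * fexp \<mu> g + t * fexp \<nu> g"
proof -
  let ?A = "set_pmf \<mu> \<union> set_pmf \<nu>"
  have "fexp (mix t \<mu> \<nu>) g = (\<Sum>x\<in>?A. pmf (mix t \<mu> \<nu>) x * g x)"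
    using assms set_pmf_mix[OF assms(1,2), of \<mu> \<nu>] by (intro fexp_superset) auto
  also have "\<dots> = (1 - t) * (\<Sum>x\<in>?A. pmf \<mu> x * g x) + t * (\<Sum>x\<in>?A. pmf \<nu> x * g x)"
    using assms by (simp add: pmf_mix distrib_right sum.distrib sum_distrib_left mult.assoc)
  also have "\<dots> = (1 - t) * fexp \<mu> g + t * fexp \<nu> g"
    using assms by (subst (1 2) fexp_superset[of ?A, symmetric]) auto
  finally show ?thesis .
qed

lemma fexp_map:
  assumes "finite (set_pmf \<mu>)"
  shows "fexp (map_pmf f \<mu>) g = fexp \<mu> (\<lambda>x. g (f x))"
proof -
  have f: "finite (set_pmf (map_pmf f \<mu>))" using assms by simp
  have "fexp (map_pmf f \<mu>) g = measure_pmf.expectation (map_pmf f \<mu>) g"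
    using f by (subst integral_measure_pmf_real[OF f]) (auto simp: fexp_def mult.commute)
  also have "\<dots> = measure_pmf.expectation \<mu> (\<lambda>x. g (f x))" by simp
  also have "\<dots> = fexp \<mu> (\<lambda>x. g (f x))"
    by (subst integral_measure_pmf_real[OF assms]) (auto simp: fexp_def mult.commute)
  finally show ?thesis .
qed

section \<open>The thickenings of the circle\<close>

abbreviation VRC :: "real \<Rightarrow> complex pmf topology" where
  "VRC \<equiv> VR_thickening circle circle_dist"

lemma topspace_VRC: "topspace (VRC r) = {\<mu> \<in> fin_probs circle. \<forall>x\<in>set_pmf \<mu>. \<forall>y\<in>set_pmf \<mu>. circle_dist x y \<le> r}"
proof -
  have "diam circle_dist (set_pmf \<mu>) \<le> r \<longleftrightarrow> (\<forall>x\<in>set_pmf \<mu>. \<forall>y\<in>set_pmf \<mu>. circle_dist x y \<le> r)"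
    if "\<mu> \<in> fin_probs circle" for \<mu>
  proof -
    let ?D = "{circle_dist x y | x y. x \<in> set_pmf \<mu> \<and> y \<in> set_pmf \<mu>}"
    have "?D = (\<lambda>(x, y). circle_dist x y) ` (set_pmf \<mu> \<times> set_pmf \<mu>)" by auto
    then have "finite ?D" using fin_probsD(1)[OF that] by simp
    moreover have "?D \<noteq> {}" using set_pmf_not_empty[of \<mu>] by blast
    ultimately show ?thesis unfolding diam_def by (subst cSup_eq_Max) (auto simp: Max_le_iff)
  qed
  then show ?thesis by (auto simp: VR_thickening_def topspace_wass_top)
qed

lemma continuous_map_VRC_wass: "continuous_map T (VRC r) F \<Longrightarrow> continuous_map T wass_top F"
  by (simp add: VR_thickening_def continuous_map_in_subtopology)

lemma continuous_map_into_VRC: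
  assumes "continuous_map T wass_top F" "\<And>t. t \<in> topspace T \<Longrightarrow> F t \<in> topspace (VRC r)"
  shows "continuous_map T (VRC r) F"
  using assms by (auto simp: VR_thickening_def continuous_map_in_subtopology)

lemma continuous_map_VRC_mono:
  assumes "r \<le> s" shows "continuous_map (VRC r) (VRC s) id"
proof (rule continuous_map_into_VRC)
  show "continuous_map (VRC r) wass_top id"
    unfolding VR_thickening_def by (intro continuous_map_from_subtopology) simp
  show "id t \<in> topspace (VRC s)" if "t \<in> topspace (VRC r)" for t
    using that assms by (force simp: topspace_VRC)
qed

lemma VRC_empty: "r < 0 \<Longrightarrow> topspace (VRC r) = {}"
proof -
  assume r: "r < 0"
  have False if "\<mu> \<in> topspace (VRC r)" for \<mu>
  proof -
    obtain x where "x \<in> set_pmf \<mu>" using set_pmf_not_empty[of \<mu>] by blast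
    then have "circle_dist x x \<le> r" using that by (auto simp: topspace_VRC)
    then show False using circle_dist_nonneg[of x x] r by simp
  qed
  then show ?thesis by blast
qed

lemma VRC_nonempty: "0 \<le> r \<Longrightarrow> return_pmf 1 \<in> topspace (VRC r)"
  by (auto simp: topspace_VRC fin_probs_def circle_dist_def)

lemma contractible_VRC:
  assumes "pi \<le> r" shows "contractible_space (VRC r)"
proof -
  let ?T = "prod_topology unit_top (VRC r)" and ?h = "\<lambda>(t, \<mu>). mix t \<mu> (return_pmf (1::complex))"
  have V: "topspace (VRC r) = fin_probs circle"
    using order_trans[OF circle_dist_le_pi assms] by (auto simp: topspace_VRC)
  have fin: "?h z \<in> fin_probs circle" if z: "z \<in> topspace ?T" for z
  proof -
    obtain t \<mu> where "z = (t, \<mu>)" "0 \<le> t" "t \<le> 1" "\<mu> \<in> fin_probs circle" using z V by (cases z) auto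
    then show ?thesis using set_pmf_mix[of t \<mu> "return_pmf 1"] by (auto simp: fin_probs_def intro: finite_subset)
  qed
  have "continuous_map ?T wass_top ?h"
  proof (rule continuous_map_into_wass_top)
    fix g :: "complex \<Rightarrow> real" assume g: "continuous_on circle g"
    have 1: "continuous_map ?T euclideanreal (\<lambda>z. fst z)"
      using continuous_map_fst continuous_map_into_fulltopology by blast
    have "continuous_map ?T wass_top snd"
      using continuous_map_snd continuous_map_VRC_wass by blast
    from continuous_map_compose[OF this continuous_map_fexp[OF g]]
    have 2: "continuous_map ?T euclideanreal (\<lambda>z. fexp (snd z) g)" by (simp add: o_def)
    show "continuous_map ?T euclideanreal (\<lambda>z. fexp (?h z) g)"
    proof (rule continuous_map_eq)
      show "continuous_map ?T euclideanreal (\<lambda>z. (1 - fst z) * fexp (snd z) g + fst z * g 1)"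
        using 1 2 by (intro continuous_intros)
      show "(1 - fst z) * fexp (snd z) g + fst z * g 1 = fexp (?h z) g" if "z \<in> topspace ?T" for z
        using that V by (auto simp: fexp_mix fin_probs_def) (simp add: fexp_def)
    qed
  qed (rule fin)
  then have "continuous_map ?T (VRC r) ?h"
    using fin V by (intro continuous_map_into_VRC) auto
  then show ?thesis
    unfolding contractible_space_def homotopic_with_def
    by (intro exI[of _ "return_pmf 1"] exI[of _ ?h]) (auto simp: mix_0 mix_1)
qed

section \<open>Odd trigonometric polynomials\<close>

text \<open>Indices \<open>2 * j\<close> and \<open>2 * j + 1\<close> carry cosine and sine of
  \<open>(2 * j + 1) * x\<close>, so \<open>2 * k + 2\<close> coefficients describe exactly the odd
  frequencies up to \<open>2 * k + 1\<close>.\<close>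

definition trig_basis :: "nat \<Rightarrow> complex \<Rightarrow> real" where
  "trig_basis i z = (if even i then Re (z ^ (i + 1)) else Im (z ^ i))"

definition trig_form :: "nat \<Rightarrow> (nat \<Rightarrow> real) \<Rightarrow> complex \<Rightarrow> real" where
  "trig_form k c z = (\<Sum>i<2 * k + 2. c i * trig_basis i z)"

lemma trig_basis_minus: "trig_basis i (- z) = - trig_basis i z"
  by (auto simp: trig_basis_def power_minus_odd)

lemma trig_form_minus: "trig_form k c (- z) = - trig_form k c z"
  by (simp add: trig_form_def trig_basis_minus sum_negf)

lemma continuous_on_trig_basis: "continuous_on S (trig_basis i)"
  unfolding trig_basis_def by (cases "even i") (auto intro!: continuous_intros)

lemma trig_basis_cis_even: "trig_basis (2 * i) (cis x) = cos (real (2 * i + 1) * x)"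
  by (simp add: trig_basis_def Complex.DeMoivre flip: power_Suc)

lemma trig_basis_cis_odd: "trig_basis (2 * i + 1) (cis x) = sin (real (2 * i + 1) * x)"
  by (simp add: trig_basis_def Complex.DeMoivre flip: power_Suc)

definition odd_trig :: "nat \<Rightarrow> (real \<Rightarrow> real) \<Rightarrow> bool" where
  "odd_trig k f \<longleftrightarrow> (\<exists>c. \<forall>x. f x = trig_form k c (cis x))"

lemma odd_trig_add: "odd_trig k f \<Longrightarrow> odd_trig k g \<Longrightarrow> odd_trig k (\<lambda>x. f x + g x)"
proof -
  assume "odd_trig k f" "odd_trig k g"
  then obtain c d where "\<forall>x. f x = trig_form k c (cis x)" "\<forall>x. g x = trig_form k d (cis x)"
    by (auto simp: odd_trig_def)
  then show ?thesis
    unfolding odd_trig_def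
    by (intro exI[of _ "\<lambda>i. c i + d i"]) (simp add: trig_form_def distrib_right sum.distrib)
qed

lemma odd_trig_cmult: "odd_trig k f \<Longrightarrow> odd_trig k (\<lambda>x. a * f x)"
proof -
  assume "odd_trig k f"
  then obtain c where "\<forall>x. f x = trig_form k c (cis x)" by (auto simp: odd_trig_def)
  then show ?thesis
    unfolding odd_trig_def
    by (intro exI[of _ "\<lambda>i. a * c i"]) (simp add: trig_form_def sum_distrib_left mult.assoc distrib_left)
qed

lemma odd_trig_sum:
  "finite I \<Longrightarrow> (\<And>i. i \<in> I \<Longrightarrow> odd_trig k (f i)) \<Longrightarrow> odd_trig k (\<lambda>x. \<Sum>i\<in>I. f i x)"
proof (induction I rule: finite_induct)
  case empty
  show ?case unfolding odd_trig_def by (intro exI[of _ "\<lambda>_. 0"]) (simp add: trig_form_def)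
qed (auto intro: odd_trig_add)

lemma odd_trig_mono:
  assumes "odd_trig j f" "j \<le> k" shows "odd_trig k f"
proof -
  obtain c where c: "\<forall>x. f x = trig_form j c (cis x)" using assms(1) by (auto simp: odd_trig_def)
  have "trig_form k (\<lambda>i. if i < 2 * j + 2 then c i else 0) z = trig_form j c z" for z
    unfolding trig_form_def using assms(2) by (intro sum.mono_neutral_cong_right) auto
  then show ?thesis using c unfolding odd_trig_def by metis
qed

lemma odd_trig_basis:
  assumes "i < 2 * k + 2" shows "odd_trig k (\<lambda>x. trig_basis i (cis x))"
proof -
  have "trig_form k (\<lambda>j. if j = i then 1 else 0) z = trig_basis i z" for z
    using assms by (simp add: trig_form_def if_distrib[of "\<lambda>u. u * _"] cong: if_cong)
  then show ?thesis unfolding odd_trig_def by metis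
qed

lemma odd_trig_cos:
  assumes "i \<le> k" shows "odd_trig k (\<lambda>x. cos (real (2 * i + 1) * x + \<psi>))"
proof -
  have "odd_trig k (\<lambda>x. cos \<psi> * trig_basis (2 * i) (cis x) + (- sin \<psi>) * trig_basis (2 * i + 1) (cis x))"
    using assms by (intro odd_trig_add odd_trig_cmult odd_trig_basis) auto
  then show ?thesis
    unfolding trig_basis_cis_even trig_basis_cis_odd by (simp add: cos_add mult.commute)
qed

text \<open>The product-to-sum formula shifts the frequency by 2 in both directions, which keeps it
  odd; for \<open>i = 0\<close> the frequency -1 is reflected to 1.\<close>

lemma odd_trig_cos_mult:
  assumes "i \<le> k"
  shows "odd_trig (Suc k) (\<lambda>x. cos (real (2 * i + 1) * x + \<psi>) * cos (2 * x + \<phi>))"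
proof -
  have eq: "cos (real (2 * i + 1) * x + \<psi>) * cos (2 * x + \<phi>) =
     (1 / 2) * cos (real (2 * (i + 1) + 1) * x + (\<psi> + \<phi>)) + (1 / 2) * cos ((2 * real i - 1) * x + (\<psi> - \<phi>))" for x
    unfolding cos_times_cos by (simp add: algebra_simps)
  have 1: "odd_trig (Suc k) (\<lambda>x. cos (real (2 * (i + 1) + 1) * x + (\<psi> + \<phi>)))"
    using assms by (intro odd_trig_cos) auto
  have 2: "odd_trig (Suc k) (\<lambda>x. cos ((2 * real i - 1) * x + (\<psi> - \<phi>)))"
  proof (cases i)
    case 0
    have "cos ((2 * real i - 1) * x + (\<psi> - \<phi>)) = cos (real (2 * 0 + 1) * x + (\<phi> - \<psi>))" for x
      using cos_minus[of "x + (\<phi> - \<psi>)"] 0 by (simp add: algebra_simps)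
    then show ?thesis using odd_trig_cos[of 0 "Suc k" "\<phi> - \<psi>"] by simp
  next
    case (Suc i')
    then have "(2 * real i - 1) = real (2 * i' + 1)" by simp
    then show ?thesis using odd_trig_cos[of i' "Suc k" "\<psi> - \<phi>"] Suc assms by simp
  qed
  show ?thesis unfolding eq using 1 2 by (intro odd_trig_add odd_trig_cmult)
qed

lemma odd_trig_mult:
  assumes "odd_trig k f"
  shows "odd_trig (Suc k) (\<lambda>x. f x * cos (2 * x + \<phi>))"
proof -
  obtain c where c: "\<forall>x. f x = trig_form k c (cis x)" using assms by (auto simp: odd_trig_def)
  have "odd_trig (Suc k) (\<lambda>x. trig_basis i (cis x) * cos (2 * x + \<phi>))" if i: "i < 2 * k + 2" for i
  proof (cases "even i")
    case True
    then obtain j where "i = 2 * j" by blast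
    then show ?thesis using odd_trig_cos_mult[of j k 0 \<phi>] i by (simp add: trig_basis_cis_even)
  next
    case False
    then obtain j where j: "i = 2 * j + 1" using oddE by blast
    have "cos (real (2 * j + 1) * x + (- pi / 2)) = sin (real (2 * j + 1) * x)" for x
      using cos_add[of "real (2 * j + 1) * x" "- pi / 2"] by simp
    then show ?thesis using odd_trig_cos_mult[of j k "- pi / 2" \<phi>] i unfolding j trig_basis_cis_odd by simp
  qed
  then have "odd_trig (Suc k) (\<lambda>x. \<Sum>i<2 * k + 2. c i * (trig_basis i (cis x) * cos (2 * x + \<phi>)))"
    by (intro odd_trig_sum odd_trig_cmult) auto
  then show ?thesis using c by (simp add: trig_form_def sum_distrib_right mult.assoc distrib_right)
qed

text \<open>Two sines multiply to half of a constant minus a cosine of frequency 2, so the factors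
  are added in pairs to a first single sine.\<close>

lemma odd_trig_prod_sin:
  "length ts = 2 * k + 1 \<Longrightarrow> odd_trig k (\<lambda>x. \<Prod>t\<leftarrow>ts. sin (x - t))"
proof (induction k arbitrary: ts)
  case 0
  then obtain t where t: "ts = [t]" by (auto simp: length_Suc_conv)
  have "cos (real (2 * 0 + 1) * x + (- t - pi / 2)) = sin (x - t)" for x
    using cos_add[of "x - t" "- pi / 2"] by (simp add: algebra_simps)
  then show ?case using odd_trig_cos[of 0 0 "- t - pi / 2"] t by simp
next
  case (Suc k)
  then obtain a b us where ts: "ts = a # b # us" "length us = 2 * k + 1"
    by (auto simp: length_Suc_conv)
  let ?f = "\<lambda>x. \<Prod>t\<leftarrow>us. sin (x - t)"
  have f: "odd_trig k ?f" using Suc.IH ts(2) by blast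
  have "(\<Prod>t\<leftarrow>ts. sin (x - t)) = cos (a - b) / 2 * ?f x + (- 1 / 2) * (?f x * cos (2 * x + (- a - b)))" for x
  proof -
    have "sin (x - a) * sin (x - b) = (cos (a - b) - cos (2 * x + (- a - b))) / 2"
      unfolding sin_times_sin using cos_minus[of "a - b"] by (simp add: algebra_simps)
    then have "(\<Prod>t\<leftarrow>ts. sin (x - t)) = (cos (a - b) - cos (2 * x + (- a - b))) / 2 * ?f x"
      by (simp add: ts flip: mult.assoc)
    then show ?thesis by (simp add: field_simps)
  qed
  then have eq: "(\<lambda>x. \<Prod>t\<leftarrow>ts. sin (x - t)) = (\<lambda>x. cos (a - b) / 2 * ?f x + (- 1 / 2) * (?f x * cos (2 * x + (- a - b))))"
    by blast
  show ?case
    unfolding eq by (intro odd_trig_add odd_trig_cmult odd_trig_mult f odd_trig_mono[OF f]) simp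
qed

section \<open>Sign changes\<close>

text \<open>Scanning upwards, a midpoint of two \<open>p\<close>-values is inserted at each change
  of the label \<open>l\<close>, and the product of differences changes sign there.
  \<open>\<phi>\<close> keeps the budget: every inserted point uses up \<open>\<epsilon>\<close> of
  its growth. \<open>p\<close> and \<open>\<phi>\<close> will differ when points are placed along a
  partly collapsed circle.\<close>

lemma separating_points:
  fixes p \<phi> :: "real \<Rightarrow> real" and l :: "real \<Rightarrow> bool"
  assumes "finite B" "B \<noteq> {}"
    and "\<And>x y. x \<in> B \<Longrightarrow> y \<in> B \<Longrightarrow> x < y \<Longrightarrow> p x \<le> p y \<and> \<phi> x \<le> \<phi> y"
    and "\<And>x y. x \<in> B \<Longrightarrow> y \<in> B \<Longrightarrow> x < y \<Longrightarrow> l x \<noteq> l y \<Longrightarrow> p x < p y \<and> \<epsilon> \<le> \<phi> y - \<phi> x"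
  shows "\<exists>ts. real (length ts) * \<epsilon> \<le> \<phi> (Max B) - \<phi> (Min B) \<and>
     (\<forall>t\<in>set ts. p (Min B) < t \<and> t < p (Max B)) \<and>
     (\<forall>x\<in>B. if l x = l (Max B) then 0 < (\<Prod>t\<leftarrow>ts. p x - t) else (\<Prod>t\<leftarrow>ts. p x - t) < 0)"
  using assms
proof (induction B rule: finite_linorder_max_induct)
  case (insert b A)
  show ?case
  proof (cases "A = {}")
    case True
    then show ?thesis by (intro exI[of _ "[]"]) simp
  next
    case ne: False
    have "\<exists>ts. real (length ts) * \<epsilon> \<le> \<phi> (Max A) - \<phi> (Min A) \<and>
     (\<forall>t\<in>set ts. p (Min A) < t \<and> t < p (Max A)) \<and>
     (\<forall>x\<in>A. if l x = l (Max A) then 0 < (\<Prod>t\<leftarrow>ts. p x - t) else (\<Prod>t\<leftarrow>ts. p x - t) < 0)"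
      by (rule insert.IH[OF ne insert.prems(2) insert.prems(3)]) auto
    then obtain ts where ts: "real (length ts) * \<epsilon> \<le> \<phi> (Max A) - \<phi> (Min A)"
     "\<And>t. t \<in> set ts \<Longrightarrow> p (Min A) < t \<and> t < p (Max A)"
     "\<And>x. x \<in> A \<Longrightarrow> if l x = l (Max A) then 0 < (\<Prod>t\<leftarrow>ts. p x - t) else (\<Prod>t\<leftarrow>ts. p x - t) < 0" by blast
    let ?m = "Max A"
    have m: "?m \<in> A" "?m < b" using insert.hyps ne by auto
    have M: "Max (insert b A) = b" using insert.hyps by (intro Max_eqI) (auto simp: less_imp_le)
    have "Min A < b" using insert.hyps ne Min_in by blast
    then have I: "Min (insert b A) = Min A" using insert.hyps ne by (simp add: min.absorb2 less_imp_le)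
    have pm: "p x \<le> p ?m" if "x \<in> A" for x
    proof (cases "x = ?m")
      case False
      then have "x < ?m" using insert.hyps that by (simp add: order_less_le)
      then show ?thesis using insert.prems(2) that m(1) by blast
    qed simp
    have mb: "p ?m \<le> p b" "\<phi> ?m \<le> \<phi> b" using insert.prems(2)[of ?m b] m by auto
    have pos: "0 < (\<Prod>t\<leftarrow>us. y - t)" if "\<And>t. t \<in> set us \<Longrightarrow> t < y" for us and y :: real
      using that by (induction us) auto
    show ?thesis
    proof (cases "l b = l ?m")
      case True
      have "if l x = l b then 0 < (\<Prod>t\<leftarrow>ts. p x - t) else (\<Prod>t\<leftarrow>ts. p x - t) < 0" if "x \<in> insert b A" for x
      proof (cases "x = b")
        case True
        have "0 < (\<Prod>t\<leftarrow>ts. p b - t)" using pos ts(2) mb(1) by (meson order_less_le_trans)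
        then show ?thesis using True by simp
      next
        case False
        then show ?thesis using ts(3) that \<open>l b = l ?m\<close> by simp
      qed
      then show ?thesis unfolding M I using ts mb by (intro exI[of _ ts]) force
    next
      case False
      then have lt: "p ?m < p b" "\<epsilon> \<le> \<phi> b - \<phi> ?m" using insert.prems(3)[of ?m b] m by auto
      let ?t = "(p ?m + p b) / 2"
      have "if l x = l b then 0 < (\<Prod>t\<leftarrow>?t # ts. p x - t) else (\<Prod>t\<leftarrow>?t # ts. p x - t) < 0" if "x \<in> insert b A" for x
      proof (cases "x = b")
        case True
        have "0 < (\<Prod>t\<leftarrow>?t # ts. p b - t)"
        proof (rule pos)
          show "t < p b" if "t \<in> set (?t # ts)" for t using that ts(2)[of t] lt(1) by auto
        qed
        then show ?thesis using True by simp
      next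
        case xb: False
        then have "x \<in> A" using that by simp
        then have "p x - ?t < 0" using pm[of x] lt(1) by (simp add: field_simps)
        moreover have "l x = l b \<longleftrightarrow> l x \<noteq> l ?m" using False by blast
        ultimately show ?thesis using ts(3)[OF \<open>x \<in> A\<close>]
          by (auto simp: mult_neg_neg mult_neg_pos split: if_splits)
      qed
      moreover have "p (Min A) \<le> p ?m" using pm ne insert.hyps by simp
      then have "p (Min A) < t \<and> t < p b" if "t \<in> set (?t # ts)" for t
        using that ts(2)[of t] lt(1) by auto
      moreover have "real (length (?t # ts)) * \<epsilon> \<le> \<phi> b - \<phi> (Min A)"
        using ts(1) lt(2) by (simp add: algebra_simps)
      ultimately show ?thesis unfolding M I by (intro exI[of _ "?t # ts"]) blast
    qed
  qed
qed simp

lemma prod_sin_sign: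
  assumes "\<And>t. t \<in> set ts \<Longrightarrow> \<bar>y - t\<bar> < pi"
  shows "sgn (\<Prod>t\<leftarrow>ts. sin (y - t)) = sgn (\<Prod>t\<leftarrow>ts. y - t)"
  using assms
proof (induction ts)
  case (Cons t ts)
  have "sgn (sin (y - t)) = sgn (y - t)"
  proof (cases "y - t" "0::real" rule: linorder_cases)
    case less
    then show ?thesis using Cons.prems[of t] sin_gt_zero[of "t - y"] sin_minus[of "t - y"] by (simp add: sgn_if)
  next
    case greater
    then show ?thesis using Cons.prems[of t] sin_gt_zero[of "y - t"] by (simp add: sgn_if)
  qed simp
  then show ?case using Cons by (simp add: sgn_mult)
qed simp

lemma cis_inj_half_turn:
  assumes "cis x = cis y" "\<bar>x - y\<bar> \<le> pi" shows "x = y"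
proof -
  have "cis (x - y) = 1" using assms(1) by (metis cis_divide cis_neq_zero divide_self)
  then have "cos (x - y) = 1" by (metis cis.simps(1) one_complex.simps(1))
  then obtain n :: int where n: "x - y = of_int n * (2 * pi)"
    using cos_one_2pi_int by (auto simp: mult.commute)
  have "\<bar>of_int n :: real\<bar> * (2 * pi) \<le> pi" using assms(2) unfolding n by (simp add: abs_mult)
  then have "(\<bar>of_int n :: real\<bar> * 2) * pi \<le> 1 * pi" by simp
  then have "\<bar>of_int n :: real\<bar> * 2 \<le> 1" using pi_gt_zero by (simp only: mult_le_cancel_right_pos)
  then have "n = 0" by linarith
  then show ?thesis using n by simp
qed

lemma half_turn_shift_int:
  fixes \<rho> :: "real \<Rightarrow> real"
  assumes "\<And>x. \<rho> (x + pi) = \<rho> x + pi"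
  shows "\<rho> (x + of_int n * pi) = \<rho> x + of_int n * pi"
proof (induction n rule: int_induct[where k = 0])
  case (step1 i)
  then show ?case using assms[of "x + of_int i * pi"] by (simp add: algebra_simps)
next
  case (step2 i)
  then show ?case using assms[of "x + of_int (i - 1) * pi"] by (simp add: algebra_simps)
qed simp

lemma cis_add_int_pi: "cis (x + of_int n * pi) = (if even n then cis x else - cis x)"
proof -
  have "cis (of_int n * pi) = (if even n then 1 else - 1)"
  proof (cases "even n")
    case True
    then obtain m where "n = 2 * m" by blast
    then show ?thesis using cis_multiple_2pi[of "of_int m"] by (simp add: mult_ac)
  next
    case False
    then obtain m where m: "n = 2 * m + 1" using oddE by blast
    have e: "of_int n * pi = 2 * pi * of_int m + pi" by (simp add: m algebra_simps)
    show ?thesis unfolding e cis_mult[symmetric] using False cis_multiple_2pi[of "of_int m"] by simp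
  qed
  then show ?thesis by (simp flip: cis_mult)
qed

text \<open>Sturm--Hurwitz: a set whose antipodal alternations are spread out is separated from its
  antipode by an odd trigonometric polynomial of low degree, even after a monotone
  deformation \<^term>\<open>\<rho>\<close> of the circle. The function \<^term>\<open>\<phi>\<close> measures the spread.\<close>

theorem positive_trig_form_exists:
  fixes \<rho> \<phi> :: "real \<Rightarrow> real"
  assumes A: "finite A" "A \<noteq> {}" "A \<subseteq> circle" "\<And>z. z \<in> A \<Longrightarrow> - z \<notin> A"
    and \<rho>: "mono \<rho>" "\<And>x. \<rho> (x + pi) = \<rho> x + pi" and \<phi>: "mono \<phi>" "\<And>x. \<phi> (x + pi) = \<phi> x + pi"
    and sep: "\<And>x y. x < y \<Longrightarrow> cis x \<in> A \<Longrightarrow> - cis y \<in> A \<Longrightarrow> \<rho> x < \<rho> y \<and> \<epsilon> \<le> \<phi> y - \<phi> x"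
    and \<epsilon>: "0 < \<epsilon>" "pi < (2 * real k + 3) * \<epsilon>"
  shows "\<exists>c. \<forall>x. cis x \<in> A \<longrightarrow> 0 < trig_form k c (cis (\<rho> x))"
proof -
  obtain a where a: "a \<in> A" using A(2) by blast
  define \<theta> where "\<theta> = Arg a"
  have ca: "cis \<theta> = a" unfolding \<theta>_def using a A(3) cis_Arg_circle by blast
  \<comment> \<open>A closed half turn from a point of \<open>A\<close> to its antipode: it
    represents every point of \<open>A\<close> up to sign, and its two ends have different
    labels.\<close>
  define B where "B = {x \<in> {\<theta>..\<theta> + pi}. cis x \<in> A \<or> - cis x \<in> A}"
  define l where "l x \<longleftrightarrow> cis x \<in> A" for x
  have "finite (cis ` B)"
    by (rule finite_subset[of _ "A \<union> uminus ` A"]) (use A(1) in \<open>force simp: B_def\<close>)+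
  moreover have "inj_on cis B"
    using cis_inj_half_turn by (force intro!: inj_onI simp: B_def abs_if)
  ultimately have finB: "finite B" by (rule finite_imageD)
  have ends: "\<theta> \<in> B" "\<theta> + pi \<in> B" "l \<theta>" "\<not> l (\<theta> + pi)"
    using a ca A(4) by (auto simp: B_def l_def cis_mult[symmetric])
  have Mx: "Max B = \<theta> + pi" and Mn: "Min B = \<theta>"
    using finB ends(1,2) by (auto intro!: Max_eqI Min_eqI simp: B_def)
  have lB: "- cis x \<in> A" if "x \<in> B" "\<not> l x" for x using that by (auto simp: B_def l_def)
  have sepB: "\<rho> x < \<rho> y \<and> \<epsilon> \<le> \<phi> y - \<phi> x" if "x \<in> B" "y \<in> B" "x < y" "l x \<noteq> l y" for x y
  proof (cases "l x")
    case True
    then show ?thesis using sep[of x y] that lB by (auto simp: l_def)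
  next
    case False
    then have "cis (x + pi) \<in> A" "- cis (y + pi) \<in> A" using that lB by (auto simp: l_def cis_mult[symmetric])
    then show ?thesis using sep[of "x + pi" "y + pi"] that(3) by (simp add: \<rho> \<phi>)
  qed
  have monoB: "\<rho> x \<le> \<rho> y \<and> \<phi> x \<le> \<phi> y" if "x \<in> B" "y \<in> B" "x < y" for x y
    using that \<rho>(1) \<phi>(1) by (simp add: monoD)
  have "B \<noteq> {}" using ends(1) by blast
  from separating_points[of B \<rho> \<phi> l \<epsilon>, OF finB this monoB sepB]
  have "\<exists>ts. real (length ts) * \<epsilon> \<le> \<phi> (\<theta> + pi) - \<phi> \<theta> \<and>
     (\<forall>t\<in>set ts. \<rho> \<theta> < t \<and> t < \<rho> (\<theta> + pi)) \<and>
     (\<forall>x\<in>B. if l x = l (\<theta> + pi) then 0 < (\<Prod>t\<leftarrow>ts. \<rho> x - t) else (\<Prod>t\<leftarrow>ts. \<rho> x - t) < 0)"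
    unfolding Mx Mn .
  then obtain ts where ts: "real (length ts) * \<epsilon> \<le> \<phi> (\<theta> + pi) - \<phi> \<theta>"
     "\<And>t. t \<in> set ts \<Longrightarrow> \<rho> \<theta> < t \<and> t < \<rho> (\<theta> + pi)"
     "\<And>x. x \<in> B \<Longrightarrow> if l x = l (\<theta> + pi) then 0 < (\<Prod>t\<leftarrow>ts. \<rho> x - t) else (\<Prod>t\<leftarrow>ts. \<rho> x - t) < 0"
    by blast
  have sign: "sgn (\<Prod>t\<leftarrow>us. y - t) = (- 1) ^ length us" if "\<And>t. t \<in> set us \<Longrightarrow> y < t" for us and y :: real
    using that by (induction us) (auto simp: sgn_mult)
  have "(\<Prod>t\<leftarrow>ts. \<rho> \<theta> - t) < 0" using ts(3)[OF ends(1)] ends by simp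
  then have "(- 1) ^ length ts = (- 1 :: real)" using sign[of ts "\<rho> \<theta>"] ts(2) by simp
  \<comment> \<open>The ends have opposite signs, so the number of sign changes is odd; being below
    \<open>2 * k + 3\<close> it is at most \<open>2 * k + 1\<close>, which gives
    \<open>j \<le> k\<close>.\<close>
  then have "odd (length ts)" by (cases "even (length ts)") auto
  then obtain j where j: "length ts = 2 * j + 1" using oddE by blast
  have "real (length ts) * \<epsilon> < (2 * real k + 3) * \<epsilon>" using ts(1) \<phi>(2)[of \<theta>] \<epsilon>(2) by simp
  then have "length ts < 2 * k + 3" using \<epsilon>(1) by simp
  then have jk: "j \<le> k" using j by simp
  \<comment> \<open>Replacing differences by sines will keep the signs, because on the window all of
    them lie strictly between \<open>- pi\<close> and \<open>pi\<close>.\<close>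
  obtain c0 where c0: "\<And>x. (\<Prod>t\<leftarrow>ts. sin (x - t)) = trig_form k c0 (cis x)"
    using odd_trig_mono[OF odd_trig_prod_sin[OF j] jk] by (auto simp: odd_trig_def)
  \<comment> \<open>Signs were normalised at the right end, which carries the label of the antipode;
    the product is thus negative on \<open>A\<close> and has to be reversed.\<close>
  have neg: "trig_form k (\<lambda>i. - c0 i) z = - trig_form k c0 z" for z
    by (simp add: trig_form_def sum_negf)
  have main: "if l x then 0 < trig_form k (\<lambda>i. - c0 i) (cis (\<rho> x)) else trig_form k (\<lambda>i. - c0 i) (cis (\<rho> x)) < 0"
    if x: "x \<in> B" for x
  proof -
    have "\<theta> \<le> x" "x \<le> \<theta> + pi" using x by (auto simp: B_def)
    then have "\<rho> \<theta> \<le> \<rho> x" "\<rho> x \<le> \<rho> \<theta> + pi" using \<rho> unfolding mono_def by metis+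
    then have "\<bar>\<rho> x - t\<bar> < pi" if "t \<in> set ts" for t using ts(2)[OF that] \<rho>(2)[of \<theta>] by auto
    from prod_sin_sign[of ts "\<rho> x", OF this]
    have "sgn (trig_form k c0 (cis (\<rho> x))) = sgn (\<Prod>t\<leftarrow>ts. \<rho> x - t)" by (simp add: c0)
    then show ?thesis using ts(3)[OF x] ends(4) unfolding neg by (auto simp: sgn_if split: if_splits)
  qed
  show ?thesis
  proof (intro exI[of _ "\<lambda>i. - c0 i"] allI impI)
    fix x assume xA: "cis x \<in> A"
    \<comment> \<open>Brings \<open>x\<close> into the window by half turns; an odd number of them
      changes the sign of \<open>cis x\<close> and of the form alike.\<close>
    define n where "n = \<lfloor>(x - \<theta>) / pi\<rfloor>"
    define x' where "x' = x - of_int n * pi"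
    have x: "x = x' + of_int n * pi" by (simp add: x'_def)
    have "of_int n \<le> (x - \<theta>) / pi" "(x - \<theta>) / pi < of_int n + 1" unfolding n_def by linarith+
    then have "\<theta> \<le> x'" "x' \<le> \<theta> + pi" using pi_gt_zero by (simp_all add: x'_def field_simps)
    then have x'B: "x' \<in> B" using xA cis_add_int_pi[of x' n] by (auto simp: B_def simp flip: x split: if_splits)
    have \<rho>x: "cis (\<rho> x) = (if even n then cis (\<rho> x') else - cis (\<rho> x'))"
      using half_turn_shift_int[of \<rho>, OF \<rho>(2), of x' n] cis_add_int_pi[of "\<rho> x'" n] by (simp flip: x)
    show "0 < trig_form k (\<lambda>i. - c0 i) (cis (\<rho> x))"
    proof (cases "even n")
      case True
      then have "l x'" using xA cis_add_int_pi[of x' n] by (simp add: l_def flip: x)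
      then show ?thesis using main[OF x'B] \<rho>x True by simp
    next
      case False
      then have "- cis x' \<in> A" using xA cis_add_int_pi[of x' n] by (simp flip: x)
      then have "\<not> l x'" using A(4) by (force simp: l_def)
      then show ?thesis using main[OF x'B] \<rho>x False by (simp add: trig_form_minus)
    qed
  qed
qed

section \<open>The moment map\<close>

definition moment :: "nat \<Rightarrow> complex pmf \<Rightarrow> nat \<Rightarrow> real" where
  "moment k \<mu> = (\<lambda>i. if i < 2 * k + 2 then fexp \<mu> (trig_basis i) else 0)"

lemma fexp_trig_form: "fexp \<mu> (trig_form k c) = (\<Sum>i<2 * k + 2. c i * moment k \<mu> i)"
proof -
  have "fexp \<mu> (trig_form k c) = (\<Sum>i<2 * k + 2. fexp \<mu> (\<lambda>x. c i * trig_basis i x))"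
    unfolding trig_form_def[abs_def] by (rule fexp_sum)
  then show ?thesis by (simp add: fexp_cmult moment_def)
qed

lemma moment_punctured:
  assumes "finite (set_pmf \<mu>)" "0 < fexp \<mu> (trig_form k c)"
  shows "moment k \<mu> \<in> punctured_set (Suc (2 * k + 1))"
proof -
  have "\<exists>i. moment k \<mu> i \<noteq> 0"
  proof (rule ccontr)
    assume "\<nexists>i. moment k \<mu> i \<noteq> 0"
    then have "fexp \<mu> (trig_form k c) = 0" unfolding fexp_trig_form by simp
    then show False using assms by simp
  qed
  then show ?thesis by (simp add: punctured_set_def moment_def)
qed

text \<open>With the moments themselves as coefficients, the integral of the form is the sum of
  their squares.\<close>

lemma fexp_trig_form_moment_pos:
  assumes "moment k \<mu> \<in> punctured_set (Suc (2 * k + 1))"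
  shows "0 < fexp \<mu> (trig_form k (moment k \<mu>))"
proof -
  obtain i where i: "moment k \<mu> i \<noteq> 0" using assms by (auto simp: punctured_set_def)
  then have "i < 2 * k + 2" unfolding moment_def by meson
  then have "0 < (\<Sum>i<2 * k + 2. moment k \<mu> i * moment k \<mu> i)"
    using i by (intro sum_pos2[of _ i]) (auto simp: zero_less_mult_iff linorder_neq_iff)
  then show ?thesis unfolding fexp_trig_form .
qed

section \<open>Arc length in angle coordinates and nonvanishing of the moments\<close>

lemma Arg_minus_1: "Arg (- 1) = pi"
  using cis_Arg_unique[of "- 1" pi] by (simp add: sgn_eq)

lemma circle_dist_cis:
  assumes "\<bar>x - y\<bar> \<le> pi" shows "circle_dist (cis x) (cis y) = \<bar>x - y\<bar>"
proof (cases "x - y = - pi")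
  case True
  then have "cis x / cis y = - 1" by (simp add: cis_divide complex_eq_iff)
  then show ?thesis using True Arg_minus_1 by (simp add: circle_dist_def)
next
  case False
  then have "Arg (cis (x - y)) = x - y" using assms by (intro cis_Arg_unique) auto
  then show ?thesis by (simp add: circle_dist_def cis_divide)
qed

text \<open>\<open>- cis y\<close> sits at the angle \<open>y - pi\<close>, so within a half turn
  its arc to \<open>cis x\<close> has length \<open>pi - (y - x)\<close>.\<close>

lemma antipodal_gap:
  assumes "circle_dist (cis x) (- cis y) \<le> r" "x < y"
  shows "pi - r \<le> y - x"
proof (cases "y - x \<le> pi")
  case True
  have "- cis y = cis (y - pi)" using cis_divide[of y pi] by simp
  moreover have "\<bar>x - (y - pi)\<bar> \<le> pi" using True assms(2) by simp
  ultimately have "circle_dist (cis x) (- cis y) = \<bar>x - (y - pi)\<bar>" using circle_dist_cis[of x "y - pi"] by simp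
  then show ?thesis using assms(1) by simp
next
  case False
  then show ?thesis using assms(1) circle_dist_nonneg[of "cis x" "- cis y"] by linarith
qed

text \<open>A form that is positive on the support excludes vanishing moments. The gap
  \<open>pi - r\<close> suffices in \<open>positive_trig_form_exists\<close> because the bound on
  \<open>r\<close> says \<open>pi < (2 * k + 3) * (pi - r)\<close>. Nothing is collapsed here, hence
  \<open>id\<close> for both maps.\<close>

theorem moment_VRC:
  assumes \<mu>: "\<mu> \<in> topspace (VRC r)" and r: "r < (2 * real k + 2) * pi / (2 * real k + 3)"
  shows "moment k \<mu> \<in> punctured_set (Suc (2 * k + 1))"
proof -
  let ?A = "set_pmf \<mu>"
  have A: "finite ?A" "?A \<noteq> {}" "?A \<subseteq> circle" using \<mu> set_pmf_not_empty[of \<mu>] by (auto simp: topspace_VRC fin_probs_def)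
  have d: "circle_dist x y \<le> r" if "x \<in> ?A" "y \<in> ?A" for x y using \<mu> that by (auto simp: topspace_VRC)
  have e: "pi < (2 * real k + 3) * (pi - r)" using r by (simp add: field_simps)
  have rpi: "r < pi"
  proof -
    have "(2 * real k + 2) * pi / (2 * real k + 3) < pi" by (simp add: field_simps)
    then show ?thesis using r by simp
  qed
  have "\<exists>c. \<forall>x. cis x \<in> ?A \<longrightarrow> 0 < trig_form k c (cis (id x))"
  proof (rule positive_trig_form_exists[OF A, of id id "pi - r"])
    show "- z \<notin> ?A" if "z \<in> ?A" for z
    proof
      assume "- z \<in> ?A"
      from d[OF that this] have "circle_dist z (- z) \<le> r" .
      moreover have "z / (- z) = - 1" using that A(3) by (force simp: divide_eq_eq)
      ultimately show False using rpi Arg_minus_1 by (simp add: circle_dist_def)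
    qed
    show "id x < id y \<and> pi - r \<le> id y - id x" if "x < y" "cis x \<in> ?A" "- cis y \<in> ?A" for x y
      using that antipodal_gap[OF d] by simp
  qed (use e rpi in \<open>auto simp: mono_def\<close>)
  then obtain c where c: "\<And>x. cis x \<in> ?A \<Longrightarrow> 0 < trig_form k c (cis x)" by auto
  have pos: "0 < trig_form k c z" if "z \<in> ?A" for z
    using c[of "Arg z"] cis_Arg_circle[of z] that A(3) by auto
  obtain z where "z \<in> ?A" using A(2) by blast
  then have "0 < fexp \<mu> (trig_form k c)"
    using A(1) pos by (intro fexp_pos) (auto simp: less_imp_le)
  then show ?thesis using moment_punctured A(1) by blast
qed

section \<open>The roots of an odd trigonometric polynomial\<close>

text \<open>On the circle this is \<open>z ^ (2 * k + 1)\<close> times the form, written as a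
  polynomial in \<open>z\<^sup>2\<close>: antipodal zeros become one root, and the degree is at most
  \<open>2 * k + 1\<close>.\<close>

definition trig_poly :: "nat \<Rightarrow> (nat \<Rightarrow> real) \<Rightarrow> complex poly" where
  "trig_poly k c = (\<Sum>j\<le>k. Polynomial.monom (cnj (Complex (c (2 * j)) (c (2 * j + 1))) / 2) (k + j + 1)
                        + Polynomial.monom (Complex (c (2 * j)) (c (2 * j + 1)) / 2) (k - j))"

lemma trig_form_complex:
  "trig_form k c z = (\<Sum>j\<le>k. Re (cnj (Complex (c (2 * j)) (c (2 * j + 1))) * z ^ (2 * j + 1)))"
proof (induction k)
  case (Suc k)
  have "trig_form (Suc k) c z = trig_form k c z + c (2 * Suc k) * trig_basis (2 * Suc k) z
      + c (2 * Suc k + 1) * trig_basis (2 * Suc k + 1) z"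
    by (simp add: trig_form_def)
  then show ?case using Suc by (simp add: trig_basis_def)
qed (simp add: trig_form_def trig_basis_def numeral_2_eq_2)

lemma poly_trig_poly:
  assumes z: "z \<in> circle"
  shows "poly (trig_poly k c) (z\<^sup>2) = z ^ (2 * k + 1) * of_real (trig_form k c z)"
proof -
  have zz: "z * cnj z = 1" using z by (simp add: complex_norm_square[symmetric])
  have "cnj \<gamma> / 2 * (z\<^sup>2) ^ (k + j + 1) + \<gamma> / 2 * (z\<^sup>2) ^ (k - j) =
        z ^ (2 * k + 1) * of_real (Re (cnj \<gamma> * z ^ (2 * j + 1)))" if j: "j \<le> k" for \<gamma> j
  proof -
    have 1: "of_real (Re (cnj \<gamma> * z ^ (2 * j + 1))) = (cnj \<gamma> * z ^ (2 * j + 1) + \<gamma> * cnj z ^ (2 * j + 1)) / 2"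
      using complex_add_cnj[of "cnj \<gamma> * z ^ (2 * j + 1)"] by simp
    have 2: "2 * k + 1 = 2 * (k - j) + (2 * j + 1)" using j by simp
    have "z ^ (2 * k + 1) * cnj z ^ (2 * j + 1) = z ^ (2 * (k - j)) * (z * cnj z) ^ (2 * j + 1)"
      unfolding 2 power_add power_mult_distrib by (simp add: mult_ac)
    then have 3: "z ^ (2 * k + 1) * cnj z ^ (2 * j + 1) = (z\<^sup>2) ^ (k - j)"
      using zz by (simp add: power_mult)
    have 4: "z ^ (2 * k + 1) * z ^ (2 * j + 1) = (z\<^sup>2) ^ (k + j + 1)"
      by (simp flip: power_mult power_add add: algebra_simps)
    have "z ^ (2 * k + 1) * of_real (Re (cnj \<gamma> * z ^ (2 * j + 1))) =
        cnj \<gamma> / 2 * (z ^ (2 * k + 1) * z ^ (2 * j + 1)) + \<gamma> / 2 * (z ^ (2 * k + 1) * cnj z ^ (2 * j + 1))"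
      unfolding 1 by (simp add: field_simps)
    then show ?thesis unfolding 3 4 by simp
  qed
  then show ?thesis
    unfolding trig_poly_def trig_form_complex
    by (simp add: poly_sum poly_monom sum_distrib_left)
qed

lemma degree_trig_poly: "Polynomial.degree (trig_poly k c) \<le> 2 * k + 1"
  unfolding trig_poly_def
  by (intro degree_sum_le degree_add_le order_trans[OF degree_monom_le]) auto

text \<open>The exponents \<open>k - j\<close> and \<open>k + j + 1\<close> are all distinct, so
  each pair of coefficients of the form can be read off from a single coefficient of the
  polynomial.\<close>

lemma trig_poly_nonzero:
  assumes "c \<in> punctured_set (Suc (2 * k + 1))" shows "trig_poly k c \<noteq> 0"
proof -
  obtain i where i: "c i \<noteq> 0" using assms by (auto simp: punctured_set_def)
  have "i < 2 * k + 2"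
  proof (rule ccontr)
    assume "\<not> i < 2 * k + 2"
    then have "c i = 0" using assms by (simp add: punctured_set_def)
    then show False using i by simp
  qed
  then have j: "i div 2 \<le> k" by simp
  let ?j = "i div 2"
  have "i = 2 * ?j \<or> i = 2 * ?j + 1" by presburger
  then have nz: "Complex (c (2 * ?j)) (c (2 * ?j + 1)) \<noteq> 0" using i by (auto simp: complex_eq_iff)
  have eq: "k - x = k - ?j \<longleftrightarrow> x = ?j" if "x \<le> k" for x using that j by arith
  have "Polynomial.coeff (trig_poly k c) (k - ?j) = (\<Sum>j'\<le>k. if j' = ?j then Complex (c (2 * ?j)) (c (2 * ?j + 1)) / 2 else 0)"
    unfolding trig_poly_def coeff_sum using j by (intro sum.cong) (auto simp: eq)
  also have "\<dots> = Complex (c (2 * ?j)) (c (2 * ?j + 1)) / 2" using j by simp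
  finally have e: "Polynomial.coeff (trig_poly k c) (k - ?j) = Complex (c (2 * ?j)) (c (2 * ?j + 1)) / 2" .
  have "Polynomial.coeff (trig_poly k c) (k - ?j) \<noteq> 0" unfolding e using nz by simp
  then show ?thesis by auto
qed

text \<open>Linear factors are normalised so that roots at infinity need no separate treatment.\<close>

definition linear_factors :: "(complex \<times> complex) set" where
  "linear_factors = sphere 0 1 \<times> cball 0 1 \<union> cball 0 1 \<times> sphere 0 1"

definition factor_poly :: "complex \<times> complex \<Rightarrow> complex poly" where
  "factor_poly p = [:fst p, - snd p:]"

text \<open>The value of \<open>disc_point\<close> at the root, as an expression that stays
  continuous in \<open>p\<close> when the root crosses the circle or goes to infinity.\<close>

definition factor_point :: "complex \<times> complex \<Rightarrow> complex" where
  "factor_point p = snd p * cnj (fst p)"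

text \<open>On the unit circle, a linear factor with root \<open>a\<close> has modulus proportional to that of
  \<open>1 - disc_point a * z\<close>.\<close>

definition disc_point :: "complex \<Rightarrow> complex" where
  "disc_point a = (if 1 \<le> norm a then inverse a else cnj a)"

section \<open>Factorization into normalised linear factors\<close>

lemma compact_linear_factors: "compact linear_factors"
  unfolding linear_factors_def by (intro compact_Un compact_Times) auto

lemma factor_poly_nonzero: "p \<in> linear_factors \<Longrightarrow> factor_poly p \<noteq> 0"
  by (auto simp: linear_factors_def factor_poly_def)

lemma norm_factor_point: "p \<in> linear_factors \<Longrightarrow> norm (factor_point p) \<le> 1"
  by (auto simp: linear_factors_def factor_point_def norm_mult mult_le_one)

lemma poly_factorization:
  assumes "q \<noteq> 0" "Polynomial.degree q \<le> n"
  shows "\<exists>C p. C \<noteq> 0 \<and> (\<forall>i. p i \<in> linear_factors) \<and> q = Polynomial.smult C (\<Prod>i<n. factor_poly (p i))"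
proof -
  obtain a where a: "Polynomial.smult (Polynomial.lead_coeff q) (\<Prod>i<Polynomial.degree q. [:- a i, 1:]) = q"
    using complex_poly_decompose' by blast
  \<comment> \<open>Degrees missing up to \<open>n\<close> are filled with the constant factor
    \<open>(1, 0)\<close>, a root at infinity.\<close>
  define p where "p i = (if i < Polynomial.degree q then if 1 \<le> norm (a i) then (1, inverse (a i)) else (a i, 1) else (1, 0))" for i
  define s where "s i = (if 1 \<le> norm (a i) then - a i else - 1)" for i
  have f: "[:- a i, 1:] = Polynomial.smult (s i) (factor_poly (p i))" if "i < Polynomial.degree q" for i
  proof -
    have "a i \<noteq> 0" if "1 \<le> norm (a i)" using that by auto
    then show ?thesis using that by (auto simp: s_def p_def factor_poly_def)
  qed
  have "(\<Prod>i<Polynomial.degree q. [:- a i, 1:]) = Polynomial.smult (\<Prod>i<Polynomial.degree q. s i) (\<Prod>i<Polynomial.degree q. factor_poly (p i))"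
    by (subst prod_smult[symmetric]) (simp add: f)
  also have "(\<Prod>i<Polynomial.degree q. factor_poly (p i)) = (\<Prod>i<n. factor_poly (p i))"
    using assms(2) by (intro prod.mono_neutral_left) (auto simp: p_def factor_poly_def)
  finally have "q = Polynomial.smult (Polynomial.lead_coeff q * (\<Prod>i<Polynomial.degree q. s i)) (\<Prod>i<n. factor_poly (p i))"
    using a by simp
  moreover have "s i \<noteq> 0" for i by (auto simp: s_def)
  moreover have "p i \<in> linear_factors" for i
    by (auto simp: p_def linear_factors_def norm_inverse inverse_le_1_iff)
  ultimately show ?thesis using assms(1) by (intro exI[of _ "Polynomial.lead_coeff q * (\<Prod>i<Polynomial.degree q. s i)"] exI[of _ p]) auto
qed

text \<open>A factor with its root at infinity contributes nothing to \<open>proots\<close> but has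
  \<open>factor_point\<close> 0; the condition \<open>g 0 = 0\<close> makes the two sides
  agree.\<close>

lemma sum_proots_factor:
  fixes g :: "complex \<Rightarrow> real"
  assumes g: "g 0 = 0" and p: "p \<in> linear_factors"
  shows "(\<Sum>a\<in>#proots (factor_poly p). g (disc_point a)) = g (factor_point p)"
proof (cases "snd p = 0")
  case True
  then show ?thesis using g by (simp add: factor_poly_def factor_point_def)
next
  case False
  have "factor_poly p = Polynomial.smult (- snd p) [:- (fst p / snd p), 1:]"
    using False by (simp add: factor_poly_def)
  then have pr: "proots (factor_poly p) = {#fst p / snd p#}"
    using False by (metis (no_types, lifting) add.inverse_inverse neg_equal_0_iff_equal proots_linear_factor proots_smult)
  obtain u v where uv: "p = (u, v)" by (cases p)
  have "disc_point (u / v) = v * cnj u"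
  proof (cases "norm u = 1")
    case True
    then have "cnj u = inverse u" by (metis complex_norm_square inverse_unique of_real_1 one_power2)
    moreover have "norm v \<le> 1" using p uv by (auto simp: linear_factors_def)
    ultimately show ?thesis using False True uv by (simp add: disc_point_def norm_divide field_simps)
  next
    case u: False
    then have "norm v = 1" "norm u < 1" using p uv by (auto simp: linear_factors_def)
    moreover from this have "cnj v = inverse v" by (metis complex_norm_square inverse_unique of_real_1 one_power2)
    ultimately show ?thesis using False uv by (simp add: disc_point_def norm_divide field_simps)
  qed
  then show ?thesis using pr by (simp add: uv factor_point_def)
qed

lemma prod_factor_poly_nonzero:
  fixes n :: nat
  shows "(\<And>i. p i \<in> linear_factors) \<Longrightarrow> (\<Prod>i<n. factor_poly (p i)) \<noteq> 0"
  using factor_poly_nonzero by (induction n) auto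

lemma sum_proots_factorization:
  fixes g :: "complex \<Rightarrow> real" and n :: nat
  assumes g: "g 0 = 0" and p: "\<And>i. p i \<in> linear_factors" and C: "C \<noteq> 0"
  shows "(\<Sum>a\<in>#proots (Polynomial.smult C (\<Prod>i<n. factor_poly (p i))). g (disc_point a)) = (\<Sum>i<n. g (factor_point (p i)))"
proof -
  have "(\<Sum>a\<in>#proots (\<Prod>i<n. factor_poly (p i)). g (disc_point a)) = (\<Sum>i<n. g (factor_point (p i)))"
  proof (induction n)
    case (Suc n)
    show ?case
      unfolding prod.lessThan_Suc
      using prod_factor_poly_nonzero[of p n, OF p] factor_poly_nonzero[OF p, of n] Suc sum_proots_factor[of g "p n", OF g p]
      by (simp add: proots_mult)
  qed simp
  then show ?thesis using C by simp
qed

section \<open>The collapsing map\<close>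

text \<open>Summing over the multiset of roots makes the shift a function of the coefficients, with
  no ordering of the roots. A root at infinity would contribute \<open>Arg 1 = 0\<close>.\<close>

definition collapse_shift :: "nat \<Rightarrow> (nat \<Rightarrow> real) \<Rightarrow> complex \<Rightarrow> real" where
  "collapse_shift k c z =
     - (\<Sum>a\<in>#proots (trig_poly k c). Arg (1 - disc_point a * z\<^sup>2)) / (2 * real k + 1)"

text \<open>Up to scaling a primitive of the Poisson kernel. If the kernel degenerates to a point mass, then
  \<open>Arg 0 = 0\<close> gives the midpoint of the jump.\<close>

definition root_angle :: "complex \<Rightarrow> real \<Rightarrow> real" where
  "root_angle w x = x - Arg (1 - w * cis (2 * x))"

lemma root_angle_half_turn: "root_angle w (x + pi) = root_angle w x + pi"
  using cis_multiple_2pi[of 1] by (simp add: root_angle_def distrib_left flip: cis_mult)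

lemma not_nonpos_Real:
  fixes \<zeta> :: complex
  assumes "norm \<zeta> \<le> 1" "\<zeta> \<noteq> 1" shows "1 - \<zeta> \<notin> \<real>\<^sub>\<le>\<^sub>0"
proof
  assume "1 - \<zeta> \<in> \<real>\<^sub>\<le>\<^sub>0"
  then have "Re \<zeta> \<ge> 1" "Im \<zeta> = 0" by (auto simp: complex_nonpos_Reals_iff)
  moreover have "Re \<zeta> \<le> 1" using assms(1) complex_Re_le_cmod order_trans by blast
  ultimately show False using assms(2) by (simp add: complex_eq_iff)
qed

text \<open>With \<open>\<zeta> = w * cis (2 * x)\<close> the derivative is the Poisson kernel
  \<open>(1 - (norm \<zeta>)\<^sup>2) / (norm (1 - \<zeta>))\<^sup>2\<close>, which is
  nonnegative.\<close>

lemma mono_root_angle_interior: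
  assumes w: "norm w < 1" shows "mono (root_angle w)"
proof (rule monoI)
  fix a b :: real assume ab: "a \<le> b"
  have "\<exists>y. (root_angle w has_real_derivative y) (at x) \<and> 0 \<le> y" for x
  proof -
    define \<zeta> where "\<zeta> = w * cis (2 * x)"
    have nz: "norm \<zeta> < 1" using w by (simp add: \<zeta>_def norm_mult)
    then have ne: "1 - \<zeta> \<noteq> 0" by auto
    have np: "1 - \<zeta> \<notin> \<real>\<^sub>\<le>\<^sub>0" using nz by (intro not_nonpos_Real) auto
    have npx: "1 - w * exp (\<i> * (2 * of_real y)) \<notin> \<real>\<^sub>\<le>\<^sub>0" for y
    proof (rule not_nonpos_Real)
      show "norm (w * exp (\<i> * (2 * of_real y))) \<le> 1" using w by (simp add: norm_mult)
      then show "w * exp (\<i> * (2 * of_real y)) \<noteq> 1" using w by (metis norm_mult norm_one norm_exp_i_times mult.right_neutral of_real_mult of_real_numeral less_irrefl)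
    qed
    have "((\<lambda>y. Ln (1 - w * exp (\<i> * (2 * y)))) has_field_derivative - (2 * \<i> * \<zeta>) / (1 - \<zeta>)) (at (of_real x))"
      using np by (auto intro!: derivative_eq_intros simp: \<zeta>_def cis_conv_exp divide_inverse mult_ac)
    from has_vector_derivative_real_field[OF this]
    have "((\<lambda>y. Ln (1 - w * exp (\<i> * (2 * of_real y)))) has_vector_derivative - (2 * \<i> * \<zeta>) / (1 - \<zeta>)) (at x)" by simp
    from bounded_linear.has_vector_derivative[OF bounded_linear_Im this]
    have "((\<lambda>y. Im (Ln (1 - w * exp (\<i> * (2 * of_real y))))) has_real_derivative Im (- (2 * \<i> * \<zeta>) / (1 - \<zeta>))) (at x)"
      by (simp add: has_real_derivative_iff_has_vector_derivative)
    moreover have "Im (Ln (1 - w * exp (\<i> * (2 * of_real y)))) = Arg (1 - w * cis (2 * y))" for y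
      using npx[of y] by (subst Arg_eq_Im_Ln) (auto simp: cis_conv_exp)
    ultimately have D: "(root_angle w has_real_derivative 1 - Im (- (2 * \<i> * \<zeta>) / (1 - \<zeta>))) (at x)"
      unfolding root_angle_def by (auto intro!: derivative_eq_intros)
    have "Im (- (2 * \<i> * \<zeta>) / (1 - \<zeta>)) = - 2 * (Re \<zeta> - (norm \<zeta>)\<^sup>2) / (norm (1 - \<zeta>))\<^sup>2"
      unfolding cmod_power2 Im_divide by (simp add: power2_eq_square algebra_simps minus_divide_left)
    also have "\<dots> \<le> 1"
    proof -
      have "(norm (1 - \<zeta>))\<^sup>2 = 1 - 2 * Re \<zeta> + (norm \<zeta>)\<^sup>2"
        unfolding cmod_power2 by (simp add: power2_eq_square algebra_simps)
      moreover have "(norm \<zeta>)\<^sup>2 \<le> 1" using nz by (simp add: power_le_one)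
      ultimately have "- 2 * (Re \<zeta> - (norm \<zeta>)\<^sup>2) \<le> (norm (1 - \<zeta>))\<^sup>2" by simp
      then show ?thesis using ne by (simp add: divide_le_eq)
    qed
    finally show ?thesis using D by force
  qed
  then show "root_angle w a \<le> root_angle w b"
    using DERIV_nonneg_imp_nondecreasing[OF ab, of "root_angle w"] by blast
qed

text \<open>Radial limit of the interior case. At a jump the values along the radius are constant:
  the argument of \<open>Arg\<close> is a positive real there, and \<open>Arg 0 = 0\<close> agrees
  with it in the limit.\<close>

lemma mono_root_angle:
  assumes w: "norm w \<le> 1" shows "mono (root_angle w)"
proof (rule monoI)
  fix x y :: real assume xy: "x \<le> y"
  have lim: "((\<lambda>r. root_angle (of_real r * w) x) \<longlongrightarrow> root_angle w x) (at_left 1)" for x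
  proof (cases "w * cis (2 * x) = 1")
    case True
    have "root_angle (of_real r * w) x = root_angle w x" if "r < 1" for r
    proof -
      have "1 - of_real r * w * cis (2 * x) = of_real (1 - r)" using True by (simp add: mult.assoc)
      then have "Arg (1 - of_real r * w * cis (2 * x)) = 0" using that by (simp only: Arg_of_real) simp
      then show ?thesis using True by (simp add: root_angle_def Arg_zero)
    qed
    then have "\<forall>\<^sub>F r in at_left 1. root_angle (of_real r * w) x = root_angle w x"
      by (intro eventually_at_leftI[of 0]) auto
    then show ?thesis by (simp add: tendsto_eventually)
  next
    case False
    have "1 - of_real 1 * w * cis (2 * x) \<notin> \<real>\<^sub>\<le>\<^sub>0"
      using not_nonpos_Real[of "w * cis (2 * x)"] False w by (simp add: norm_mult)
    then have "((\<lambda>r. root_angle (of_real r * w) x) \<longlongrightarrow> root_angle (of_real 1 * w) x) (at_left 1)"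
      unfolding root_angle_def by (intro tendsto_intros) auto
    then show ?thesis by simp
  qed
  have "root_angle (of_real r * w) x \<le> root_angle (of_real r * w) y" if "0 \<le> r" "r < 1" for r
  proof -
    have "norm (of_real r * w) \<le> r" using w that by (simp add: norm_mult mult_left_le)
    then have "norm (of_real r * w) < 1" using that by linarith
    then show ?thesis using mono_root_angle_interior xy by (simp add: monoD)
  qed
  then have "\<forall>\<^sub>F r in at_left 1. root_angle (of_real r * w) x \<le> root_angle (of_real r * w) y"
    by (intro eventually_at_leftI[of 0]) auto
  then show "root_angle w x \<le> root_angle w y" using tendsto_le[OF _ lim lim] by simp
qed

text \<open>For \<open>norm w = 1\<close> the graph is a staircase, equal to
  \<open>t + pi / 2\<close> on the half turn after \<open>t\<close>, with steps of height
  \<open>pi\<close>. Monotonicity extends the comparison to all \<open>x < t < y\<close>.\<close>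

lemma root_angle_jump:
  assumes w: "w * cis (2 * t) = 1" and xy: "x < t" "t < y"
  shows "pi \<le> root_angle w y - root_angle w x"
proof -
  have "norm (w * cis (2 * t)) = 1" using w by simp
  then have w1: "norm w = 1" by (simp add: norm_mult)
  have mono: "mono (root_angle w)" using w1 by (intro mono_root_angle) simp
  have right: "root_angle w s = t + pi / 2" if s: "t < s" "s < t + pi" for s
  proof -
    have "w * cis (2 * s) = w * cis (2 * t) * cis (2 * (s - t))" by (simp add: cis_mult algebra_simps)
    then have e: "w * cis (2 * s) = cis (2 * (s - t))" using w by simp
    have "sin (s - t) > 0" using s by (intro sin_gt_zero) auto
    \<comment> \<open>Where the sine is positive, this is a polar form and shows the argument
      \<open>y - pi / 2\<close>.\<close>
    moreover have "1 - cis (2 * y) = of_real (2 * sin y) * cis (y - pi / 2)" for y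
      by (simp add: complex_eq_iff cos_diff sin_diff sin_double cos_double_sin power2_eq_square)
    ultimately have "Arg (1 - cis (2 * (s - t))) = Arg (cis (s - t - pi / 2))" by (simp only: Arg_times_of_real)
    also have "\<dots> = s - t - pi / 2" using s by (intro cis_Arg_unique) auto
    finally show ?thesis by (simp add: root_angle_def e)
  qed
  have "t + pi / 2 \<le> root_angle w y"
  proof -
    have "root_angle w (min y (t + pi / 2)) \<le> root_angle w y" using mono by (simp add: monoD)
    then show ?thesis using right[of "min y (t + pi / 2)"] xy by (auto simp: min_def split: if_splits)
  qed
  moreover have "root_angle w x \<le> t - pi / 2"
  proof -
    have "root_angle w x \<le> root_angle w (max x (t - pi / 2))" using mono by (simp add: monoD)
    moreover have "root_angle w (max x (t - pi / 2) + pi) = t + pi / 2"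
      using xy by (intro right) (auto simp: max_def)
    ultimately show ?thesis by (simp add: root_angle_half_turn)
  qed
  ultimately show ?thesis by simp
qed

text \<open>The map \<open>\<rho>\<close> of the overview on angles. By
  \<open>collapse_lift_factorization\<close> it is the average of the \<open>root_angle\<close>
  functions of the \<open>2 * k + 1\<close> factors.\<close>

definition collapse_lift :: "nat \<Rightarrow> (nat \<Rightarrow> real) \<Rightarrow> real \<Rightarrow> real" where
  "collapse_lift k c x = x + collapse_shift k c (cis x)"

lemma trig_poly_factorization:
  assumes "c \<in> punctured_set (Suc (2 * k + 1))"
  obtains C p where "C \<noteq> 0" "\<And>i. p i \<in> linear_factors"
    "trig_poly k c = Polynomial.smult C (\<Prod>i<2 * k + 1. factor_poly (p i))"
  using poly_factorization[OF trig_poly_nonzero[OF assms] degree_trig_poly] by blast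

lemma collapse_shift_factorization:
  assumes "C \<noteq> 0" "\<And>i. p i \<in> linear_factors"
    "trig_poly k c = Polynomial.smult C (\<Prod>i<2 * k + 1. factor_poly (p i))"
  shows "collapse_shift k c z = - (\<Sum>i<2 * k + 1. Arg (1 - factor_point (p i) * z\<^sup>2)) / (2 * real k + 1)"
proof -
  have "(\<Sum>a\<in>#proots (trig_poly k c). Arg (1 - disc_point a * z\<^sup>2)) = (\<Sum>i<2 * k + 1. Arg (1 - factor_point (p i) * z\<^sup>2))"
    unfolding assms(3)
    by (rule sum_proots_factorization[of "\<lambda>w. Arg (1 - w * z\<^sup>2)"]) (use assms in auto)
  then show ?thesis by (simp add: collapse_shift_def)
qed

lemma collapse_lift_factorization:
  assumes "C \<noteq> 0" "\<And>i. p i \<in> linear_factors"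
    "trig_poly k c = Polynomial.smult C (\<Prod>i<2 * k + 1. factor_poly (p i))"
  shows "(2 * real k + 1) * collapse_lift k c x = (\<Sum>i<2 * k + 1. root_angle (factor_point (p i)) x)"
proof -
  have "(cis x)\<^sup>2 = cis (2 * x)" by (simp add: Complex.DeMoivre)
  then have "(2 * real k + 1) * collapse_lift k c x = (2 * real k + 1) * x - (\<Sum>i<2 * k + 1. Arg (1 - factor_point (p i) * cis (2 * x)))"
    unfolding collapse_lift_def collapse_shift_factorization[OF assms] by (simp add: field_simps)
  also have "\<dots> = (\<Sum>i<2 * k + 1. x - Arg (1 - factor_point (p i) * cis (2 * x)))"
    unfolding sum_subtractf by (simp add: algebra_simps)
  finally show ?thesis by (simp add: root_angle_def)
qed

text \<open>A factor \<open>u - v * z\<close> vanishing on the circle has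
  \<open>norm u = norm v\<close>, and the normalisation makes both equal to 1.\<close>

lemma factor_vanishes:
  assumes p: "p \<in> linear_factors" and z: "norm z = 1" and 0: "poly (factor_poly p) z = 0"
  shows "factor_point p * z = 1"
proof -
  obtain u v where uv: "p = (u, v)" by (cases p)
  have u: "u = v * z" using 0 by (simp add: factor_poly_def uv mult.commute)
  then have "norm u = norm v" using z by (simp add: norm_mult)
  then have "norm u = 1" using p by (auto simp: linear_factors_def uv)
  then have "u * cnj u = 1" by (simp add: complex_norm_square[symmetric])
  then show ?thesis using u by (simp add: factor_point_def uv mult_ac)
qed

context
  fixes k :: nat and c :: "nat \<Rightarrow> real"
  assumes c: "c \<in> punctured_set (Suc (2 * k + 1))"
begin

lemma mono_collapse_lift: "mono (collapse_lift k c)"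
proof (rule monoI)
  fix x y :: real assume xy: "x \<le> y"
  obtain C p where p: "C \<noteq> 0" "\<And>i. p i \<in> linear_factors"
    "trig_poly k c = Polynomial.smult C (\<Prod>i<2 * k + 1. factor_poly (p i))"
    using trig_poly_factorization[OF c] by blast
  have "(2 * real k + 1) * collapse_lift k c x \<le> (2 * real k + 1) * collapse_lift k c y"
    unfolding collapse_lift_factorization[OF p]
    by (intro sum_mono monoD[OF mono_root_angle] norm_factor_point p xy)
  then show "collapse_lift k c x \<le> collapse_lift k c y" by (simp add: mult_le_cancel_left_pos add_nonneg_pos)
qed

lemma collapse_lift_half_turn: "collapse_lift k c (x + pi) = collapse_lift k c x + pi"
proof -
  have "(- cis x)\<^sup>2 = (cis x)\<^sup>2" by simp
  then show ?thesis by (simp add: collapse_lift_def collapse_shift_def flip: cis_mult)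
qed

text \<open>The form has a zero between \<open>x\<close> and \<open>y\<close>; its factor
  contributes a jump of \<open>pi\<close> to a sum of \<open>2 * k + 1\<close> monotone
  terms.\<close>

lemma collapse_lift_jump:
  assumes xy: "x < y" and sign: "trig_form k c (cis x) * trig_form k c (cis y) < 0"
  shows "pi / (2 * real k + 1) \<le> collapse_lift k c y - collapse_lift k c x"
proof -
  obtain C p where p: "C \<noteq> 0" "\<And>i. p i \<in> linear_factors"
    "trig_poly k c = Polynomial.smult C (\<Prod>i<2 * k + 1. factor_poly (p i))"
    using trig_poly_factorization[OF c] by blast
  let ?f = "\<lambda>t. trig_form k c (cis t)"
  have cont: "continuous_on {x..y} ?f"
    unfolding trig_form_def
    by (intro continuous_intros continuous_on_compose2[OF continuous_on_trig_basis]) auto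
  have "\<exists>t. x \<le> t \<and> t \<le> y \<and> ?f t = 0"
    using IVT'[of ?f x 0 y] IVT2'[of ?f y 0 x] cont xy sign by (force simp: mult_less_0_iff)
  then obtain t where t: "x \<le> t" "t \<le> y" "?f t = 0" by blast
  then have t': "x < t" "t < y" using sign by (auto simp: order_less_le)
  have "(cis t)\<^sup>2 = cis (2 * t)" by (simp add: Complex.DeMoivre)
  then have "poly (trig_poly k c) (cis (2 * t)) = 0" using poly_trig_poly[of "cis t" k c] t(3) by simp
  then have "\<exists>i\<in>{..<2 * k + 1}. poly (factor_poly (p i)) (cis (2 * t)) = 0"
    using p(1) by (simp only: p(3) poly_smult poly_prod mult_eq_0_iff prod_zero_iff[OF finite_lessThan] simp_thms)
  then obtain i where i: "i < 2 * k + 1" "poly (factor_poly (p i)) (cis (2 * t)) = 0" by blast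
  have "factor_point (p i) * cis (2 * t) = 1" using factor_vanishes[OF p(2) _ i(2)] by simp
  from root_angle_jump[OF this t']
  have ji: "pi \<le> root_angle (factor_point (p i)) y - root_angle (factor_point (p i)) x" .
  also have "\<dots> \<le> (\<Sum>i<2 * k + 1. root_angle (factor_point (p i)) y - root_angle (factor_point (p i)) x)"
    using i(1) xy monoD[OF mono_root_angle[OF norm_factor_point[OF p(2)]]]
    by (intro member_le_sum[of i _ "\<lambda>i. root_angle (factor_point (p i)) y - root_angle (factor_point (p i)) x"]) auto
  also have "\<dots> = (2 * real k + 1) * (collapse_lift k c y - collapse_lift k c x)"
    unfolding right_diff_distrib collapse_lift_factorization[OF p] by (simp add: sum_subtractf)
  finally show ?thesis by (simp add: field_simps)
qed

end

lemma norm_factor_point_circle: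
  assumes "p \<in> linear_factors" "z \<in> circle" shows "norm (factor_point p * z\<^sup>2) \<le> 1"
  using norm_factor_point[OF assms(1)] assms(2) by (simp add: norm_mult norm_power)

text \<open>Supplies convergent subsequences of factorizations, with one coordinate per linear
  factor.\<close>

lemma compact_function_space:
  fixes K :: "'b::topological_space set"
  assumes "compact K" shows "compact {f :: nat \<Rightarrow> 'b. \<forall>i. f i \<in> K}"
proof -
  have "compactin (product_topology (\<lambda>i::nat. euclidean :: 'b topology) UNIV) (PiE UNIV (\<lambda>_. K))"
    using assms by (simp add: compactin_PiE)
  then show ?thesis by (simp add: euclidean_product_topology PiE_UNIV_domain Pi_def)
qed

lemma tendsto_coordinate:
  fixes f :: "'a \<Rightarrow> nat \<Rightarrow> 'b::metric_space"
  assumes "(f \<longlongrightarrow> l) F" shows "((\<lambda>x. f x i) \<longlongrightarrow> l i) F"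
proof -
  have "isCont (\<lambda>f :: nat \<Rightarrow> 'b. f i) l"
    using continuous_on_eq_continuous_at[THEN iffD1, OF open_UNIV continuous_on_product_coordinates[of i]] by blast
  then show ?thesis using assms isCont_tendsto_compose by blast
qed

text \<open>The roots depend continuously on the coefficients: limits of factorizations along
  subsequences are factorizations of the limit.\<close>

theorem continuous_on_collapse_shift:
  "continuous_on {(c, z). c \<in> punctured_set (Suc (2 * k + 1)) \<and> z \<in> circle \<and> trig_form k c z \<noteq> 0}
     (\<lambda>(c, z). collapse_shift k c z)"
  (is "continuous_on ?S ?f")
  unfolding continuous_on_sequentially
proof (intro allI ballI impI)
  fix x :: "nat \<Rightarrow> (nat \<Rightarrow> real) \<times> complex" and a
  assume a: "a \<in> ?S" and x: "(\<forall>n. x n \<in> ?S) \<and> x \<longlonglongrightarrow> a"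
  let ?n = "2 * k + 1"
  have xS: "fst (x j) \<in> punctured_set (Suc ?n)" "snd (x j) \<in> circle" for j using x by (auto simp: case_prod_unfold)
  have aS: "fst a \<in> punctured_set (Suc ?n)" "snd a \<in> circle" "trig_form k (fst a) (snd a) \<noteq> 0"
    using a by (auto simp: case_prod_unfold)
  have xlim: "(\<lambda>j. fst (x j)) \<longlonglongrightarrow> fst a" "(\<lambda>j. snd (x j)) \<longlonglongrightarrow> snd a"
    using x by (auto intro: tendsto_intros)
  have "\<forall>j. \<exists>C p. C \<noteq> 0 \<and> (\<forall>i. p i \<in> linear_factors) \<and> trig_poly k (fst (x j)) = Polynomial.smult C (\<Prod>i<?n. factor_poly (p i))"
    using trig_poly_factorization[OF xS(1)] by metis
  then obtain C p where Cp: "\<And>j. C j \<noteq> 0" "\<And>j i. p j i \<in> linear_factors"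
      "\<And>j. trig_poly k (fst (x j)) = Polynomial.smult (C j) (\<Prod>i<?n. factor_poly (p j i))" by metis
  show "(?f \<circ> x) \<longlonglongrightarrow> ?f a"
  proof (rule ccontr)
    assume "\<not> (?f \<circ> x) \<longlonglongrightarrow> ?f a"
    then obtain e where e: "e > 0" "\<not> (\<forall>\<^sub>F n in sequentially. dist (?f (x n)) (?f a) < e)"
      by (auto simp: tendsto_iff)
    then have "infinite {n. e \<le> dist (?f (x n)) (?f a)}"
      unfolding infinite_nat_iff_unbounded_le eventually_sequentially by (auto simp: not_less)
    then obtain r :: "nat \<Rightarrow> nat" where r: "strict_mono r" "\<And>n. e \<le> dist (?f (x (r n))) (?f a)"
      using infinite_enumerate by (metis mem_Collect_eq)
    have "seq_compact {f :: nat \<Rightarrow> complex \<times> complex. \<forall>i. f i \<in> linear_factors}"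
      using compact_function_space[OF compact_linear_factors] compact_eq_seq_compact_metric by blast
    moreover have "\<forall>j. p (r j) \<in> {f. \<forall>i. f i \<in> linear_factors}" using Cp(2) by simp
    ultimately obtain q s where "q \<in> {f. \<forall>i. f i \<in> linear_factors}"
        and s: "strict_mono s" "((\<lambda>j. p (r j)) \<circ> s) \<longlonglongrightarrow> q"
      by (rule seq_compactE)
    then have q: "\<And>i. q i \<in> linear_factors" by simp
    define t where "t = r \<circ> s"
    have t: "strict_mono t" using r s by (simp add: t_def strict_mono_o)
    have plim: "(\<lambda>j. p (t j) i) \<longlonglongrightarrow> q i" for i
      using tendsto_coordinate[OF s(2)] by (simp add: t_def o_def)
    have tlim: "(\<lambda>j. fst (x (t j))) \<longlonglongrightarrow> fst a" "(\<lambda>j. snd (x (t j))) \<longlonglongrightarrow> snd a"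
      using LIMSEQ_subseq_LIMSEQ[OF xlim(1) t] LIMSEQ_subseq_LIMSEQ[OF xlim(2) t] by (auto simp: o_def)
    have polylim: "(\<lambda>j. poly (trig_poly k (fst (x (t j)))) y) \<longlonglongrightarrow> poly (trig_poly k (fst a)) y" for y
      unfolding trig_poly_def poly_sum poly_add poly_monom Complex_eq
      by (intro tendsto_intros tendsto_coordinate[OF tlim(1)]) auto
    have faclim: "(\<lambda>j. \<Prod>i<?n. poly (factor_poly (p (t j) i)) y) \<longlonglongrightarrow> (\<Prod>i<?n. poly (factor_poly (q i)) y)" for y
      unfolding factor_poly_def using plim by (auto intro!: tendsto_intros)
    have nz: "(\<Prod>i<?n. factor_poly (q i)) \<noteq> 0" using prod_factor_poly_nonzero[of q] q by blast
    \<comment> \<open>At a point where the limit product does not vanish, the scalars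
      \<open>C\<close> are recovered by division. So they converge too, and the limit is again a
      factorization.\<close>
    obtain y0 where y0: "(\<Prod>i<?n. poly (factor_poly (q i)) y0) \<noteq> 0"
    proof -
      have "\<exists>y0. poly (\<Prod>i<?n. factor_poly (q i)) y0 \<noteq> 0"
        using nz poly_all_0_iff_0 by blast
      then show thesis using that by (auto simp: poly_prod)
    qed
    have px: "poly (trig_poly k (fst (x j))) y = C j * (\<Prod>i<?n. poly (factor_poly (p j i)) y)" for j y
      by (simp only: Cp(3) poly_smult poly_prod)
    define C0 where "C0 = poly (trig_poly k (fst a)) y0 / (\<Prod>i<?n. poly (factor_poly (q i)) y0)"
    have "(\<lambda>j. poly (trig_poly k (fst (x (t j)))) y0 / (\<Prod>i<?n. poly (factor_poly (p (t j) i)) y0)) \<longlonglongrightarrow> C0"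
      unfolding C0_def by (intro tendsto_divide polylim faclim y0)
    moreover have "\<forall>\<^sub>F j in sequentially. (\<Prod>i<?n. poly (factor_poly (p (t j) i)) y0) \<noteq> 0"
      using tendsto_imp_eventually_ne[OF faclim y0] .
    then have "\<forall>\<^sub>F j in sequentially. poly (trig_poly k (fst (x (t j)))) y0 / (\<Prod>i<?n. poly (factor_poly (p (t j) i)) y0) = C (t j)"
      by eventually_elim (simp add: px)
    ultimately have Clim: "(\<lambda>j. C (t j)) \<longlonglongrightarrow> C0" by (rule Lim_transform_eventually)
    have "poly (trig_poly k (fst a)) y = C0 * (\<Prod>i<?n. poly (factor_poly (q i)) y)" for y
    proof -
      have "(\<lambda>j. poly (trig_poly k (fst (x (t j)))) y) \<longlonglongrightarrow> C0 * (\<Prod>i<?n. poly (factor_poly (q i)) y)"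
        unfolding px by (intro tendsto_mult Clim faclim)
      from LIMSEQ_unique[OF polylim this] show ?thesis .
    qed
    then have fac: "trig_poly k (fst a) = Polynomial.smult C0 (\<Prod>i<?n. factor_poly (q i))"
      by (simp add: poly_eq_poly_eq_iff[symmetric] fun_eq_iff poly_prod)
    then have C0: "C0 \<noteq> 0" using trig_poly_nonzero[OF aS(1)] by auto
    \<comment> \<open>If this product were 1, the form would vanish at \<open>snd a\<close>. Away
      from zeros \<open>Arg\<close> is therefore evaluated off its branch cut, where it is
      continuous.\<close>
    have ne: "factor_point (q i) * (snd a)\<^sup>2 \<noteq> 1" if i: "i < ?n" for i
    proof
      assume 1: "factor_point (q i) * (snd a)\<^sup>2 = 1"
      obtain u v where uv: "q i = (u, v)" by (cases "q i")
      have z1: "norm ((snd a)\<^sup>2) = 1" using aS(2) by (simp add: norm_power)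
      have "norm (factor_point (q i)) * norm ((snd a)\<^sup>2) = 1" using 1 by (metis norm_mult norm_one)
      then have "norm v * norm u = 1" using z1 by (simp add: factor_point_def uv norm_mult)
      moreover have "norm u \<le> 1" "norm v \<le> 1" using q[of i] by (auto simp: uv linear_factors_def)
      ultimately have "norm u = 1" by (smt (verit) mult_left_le_one_le norm_ge_zero)
      then have "u * cnj u = 1" by (simp add: complex_norm_square[symmetric])
      moreover have "v * cnj u * (snd a)\<^sup>2 = 1" using 1 by (simp add: factor_point_def uv)
      ultimately have "u = v * (snd a)\<^sup>2" by (metis mult.left_commute mult.assoc mult_1_right mult_1_left)
      then have "poly (factor_poly (q i)) ((snd a)\<^sup>2) = 0" by (simp add: factor_poly_def uv mult.commute)
      then have "poly (trig_poly k (fst a)) ((snd a)\<^sup>2) = 0"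
        using i by (simp only: fac poly_smult poly_prod mult_eq_0_iff prod_zero_iff[OF finite_lessThan] lessThan_iff) blast
      then show False using poly_trig_poly[OF aS(2), of k "fst a"] aS by auto
    qed
    have "(\<lambda>j. - (\<Sum>i<?n. Arg (1 - factor_point (p (t j) i) * (snd (x (t j)))\<^sup>2)) / (2 * real k + 1))
       \<longlonglongrightarrow> - (\<Sum>i<?n. Arg (1 - factor_point (q i) * (snd a)\<^sup>2)) / (2 * real k + 1)"
    proof (intro tendsto_divide tendsto_minus tendsto_sum tendsto_Arg tendsto_const)
      fix i assume i: "i \<in> {..<?n}"
      show "(\<lambda>j. 1 - factor_point (p (t j) i) * (snd (x (t j)))\<^sup>2) \<longlonglongrightarrow> 1 - factor_point (q i) * (snd a)\<^sup>2"
        unfolding factor_point_def by (intro tendsto_intros plim tlim)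
      show "1 - factor_point (q i) * (snd a)\<^sup>2 \<notin> \<real>\<^sub>\<le>\<^sub>0"
        using not_nonpos_Real[OF norm_factor_point_circle[OF q aS(2)] ne] i by simp
    qed auto
    then have "(\<lambda>j. ?f (x (t j))) \<longlonglongrightarrow> ?f a"
      unfolding case_prod_unfold using collapse_shift_factorization[OF Cp] collapse_shift_factorization[OF C0 q fac]
      by simp
    then have "\<forall>\<^sub>F j in sequentially. dist (?f (x (t j))) (?f a) < e" using e(1) by (simp add: tendsto_iff)
    then show False using r(2) by (auto simp: t_def eventually_sequentially not_less[symmetric])
  qed
qed

text \<open>The identity at \<open>s = 0\<close> and the full collapse at \<open>s = 1\<close>; in
  between, \<open>collapse_cis\<close> shows a straight line on lifted angles.\<close>

definition collapse :: "nat \<Rightarrow> (nat \<Rightarrow> real) \<Rightarrow> real \<Rightarrow> complex \<Rightarrow> complex" where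
  "collapse k c s z = z * cis (s * collapse_shift k c z)"

section \<open>Continuity of the collapsing map under the weight\<close>

lemma collapse_cis: "collapse k c s (cis x) = cis ((1 - s) * x + s * collapse_lift k c x)"
  by (simp add: collapse_def collapse_lift_def cis_mult algebra_simps)

lemma collapse_circle: "z \<in> circle \<Longrightarrow> collapse k c s z \<in> circle"
  by (simp add: collapse_def norm_mult)

lemma collapse_0 [simp]: "collapse k c 0 z = z"
  by (simp add: collapse_def)

lemma continuous_on_trig_form: "continuous_on UNIV (\<lambda>(c, z). trig_form k c z)"
proof -
  have "continuous_on UNIV (\<lambda>q::(nat \<Rightarrow> real) \<times> complex. fst q i)" for i
    by (rule continuous_on_product_then_coordinatewise[OF continuous_on_fst[OF continuous_on_id]])
  moreover have "continuous_on UNIV (\<lambda>q::(nat \<Rightarrow> real) \<times> complex. trig_basis i (snd q))" for i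
    by (rule continuous_on_compose2[OF continuous_on_trig_basis]) (auto intro!: continuous_intros)
  ultimately show ?thesis unfolding case_prod_unfold trig_form_def by (intro continuous_intros)
qed

text \<open>The collapsing map jumps at the zeros of the form, where the weight vanishes.\<close>

lemma continuous_on_weighted_collapse:
  assumes g: "continuous_on circle g"
  shows "continuous_on ((punctured_set (Suc (2 * k + 1)) \<times> UNIV) \<times> circle)
     (\<lambda>((c, s), z). max 0 (trig_form k c z) * g (collapse k c s z) :: real)"
  (is "continuous_on ?D ?h")
proof -
  let ?D1 = "?D \<inter> {((c, s), z). trig_form k c z \<noteq> 0}"
  let ?w = "\<lambda>q::((nat \<Rightarrow> real) \<times> real) \<times> complex. trig_form k (fst (fst q)) (snd q)"
  have cc: "continuous_on S (\<lambda>q::((nat \<Rightarrow> real) \<times> real) \<times> complex. (fst (fst q), snd q))" for S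
    by (intro continuous_intros)
  have cw: "continuous_on UNIV ?w"
    using continuous_on_compose2[OF continuous_on_trig_form[of k] cc[of UNIV]] by (simp add: case_prod_unfold)
  have "continuous_on ?D1 (\<lambda>q. collapse_shift k (fst (fst q)) (snd q))"
    using continuous_on_compose2[OF continuous_on_collapse_shift[of k] cc[of ?D1]] by (force simp: case_prod_unfold)
  then have "continuous_on ?D1 (\<lambda>q. collapse k (fst (fst q)) (snd (fst q)) (snd q))"
    unfolding collapse_def by (intro continuous_intros)
  then have "continuous_on ?D1 (\<lambda>q. g (collapse k (fst (fst q)) (snd (fst q)) (snd q)))"
    by (rule continuous_on_compose2[OF g]) (use collapse_circle in auto)
  then have c1: "continuous_on ?D1 ?h"
    using continuous_on_subset[OF cw] unfolding case_prod_unfold by (intro continuous_intros) auto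
  have "bounded (g ` circle)" using compact_continuous_image[OF g compact_circle] by (rule compact_imp_bounded)
  then obtain M where M: "0 < M" "\<And>x. x \<in> circle \<Longrightarrow> \<bar>g x\<bar> \<le> M" by (auto simp: bounded_pos)
  have op: "open (?w -` (- {0}))" using cw by (intro open_vimage) auto
  show ?thesis
    unfolding continuous_on_eq_continuous_within
  proof
    fix q assume q: "q \<in> ?D"
    show "continuous (at q within ?D) ?h"
    proof (cases "?w q = 0")
      case True
      have "continuous_on ?D (\<lambda>q. M * max 0 (?w q))"
        by (intro continuous_intros continuous_on_subset[OF cw]) auto
      then have "((\<lambda>q. M * max 0 (?w q)) \<longlongrightarrow> M * max 0 (?w q)) (at q within ?D)"
        using q unfolding continuous_on_def by blast
      then have "((\<lambda>q. M * max 0 (?w q)) \<longlongrightarrow> 0) (at q within ?D)" using True by simp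
      moreover have "\<forall>\<^sub>F q in at q within ?D. norm (?h q) \<le> M * max 0 (?w q)"
        unfolding eventually_at_filter
      proof (intro always_eventually allI impI)
        fix q assume "q \<in> ?D"
        then have "snd q \<in> circle" by auto
        then have "\<bar>g (collapse k (fst (fst q)) (snd (fst q)) (snd q))\<bar> \<le> M" using M(2) collapse_circle by blast
        then have "max 0 (?w q) * \<bar>g (collapse k (fst (fst q)) (snd (fst q)) (snd q))\<bar> \<le> max 0 (?w q) * M"
          by (intro mult_left_mono) auto
        then show "norm (?h q) \<le> M * max 0 (?w q)"
          by (simp add: case_prod_unfold abs_mult mult.commute)
      qed
      ultimately have "(?h \<longlongrightarrow> 0) (at q within ?D)" by (rule Lim_null_comparison[rotated])
      moreover have "?h q = 0" using True by (auto simp: case_prod_unfold)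
      ultimately show ?thesis by (simp add: continuous_within)
    next
      case False
      then have "q \<in> ?D1" using q by (auto simp: case_prod_unfold)
      then have "continuous (at q within ?D1) ?h" using c1 unfolding continuous_on_eq_continuous_within by blast
      moreover have "at q within ?D1 = at q within ?D"
        using False by (intro at_within_nhd[OF _ op]) auto
      ultimately show ?thesis by (simp add: continuous_within)
    qed
  qed
qed

section \<open>The homotopy equivalence\<close>

lemma continuous_map_Pair_euclidean:
  "continuous_map T euclidean f \<Longrightarrow> continuous_map T euclidean g \<Longrightarrow> continuous_map T euclidean (\<lambda>t. (f t, g t))"
  by (simp add: continuous_map_atin tendsto_Pair)

lemma continuous_map_punctured_euclidean:
  "continuous_map T (punctured_space m) f \<longleftrightarrow> continuous_map T euclidean f \<and> f \<in> topspace T \<rightarrow> punctured_set m"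
  by (simp add: continuous_map_in_subtopology euclidean_product_topology)

lemma continuous_map_moment: 
  assumes "continuous_map T wass_top m" shows "continuous_map T euclidean (\<lambda>t. moment k (m t))"
proof -
  have "continuous_map T (powertop_real UNIV) (\<lambda>t. moment k (m t))"
    unfolding continuous_map_componentwise_UNIV
  proof
    fix i
    show "continuous_map T euclideanreal (\<lambda>t. moment k (m t) i)"
      using continuous_map_compose[OF assms continuous_map_fexp[OF continuous_on_trig_basis[of circle i]]]
      by (simp add: moment_def o_def)
  qed
  then show ?thesis by (simp add: euclidean_product_topology)
qed

text \<open>With \<open>g = 1\<close> and \<open>s = 0\<close> this is the mass of the positive part
  before normalisation; integrals against collapsed positive parts are quotients of two such
  terms.\<close>

definition collapsed_integral ::
  "nat \<Rightarrow> (complex \<Rightarrow> real) \<Rightarrow> complex pmf \<Rightarrow> (nat \<Rightarrow> real) \<Rightarrow> real \<Rightarrow> real" where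
  "collapsed_integral k g \<mu> c s = fexp \<mu> (\<lambda>z. max 0 (trig_form k c z) * g (collapse k c s z))"

lemma continuous_map_collapsed_integral:
  assumes "continuous_on circle g" "continuous_map T wass_top m" "continuous_map T (punctured_space (Suc (2 * k + 1))) c"
    "continuous_map T euclideanreal s"
  shows "continuous_map T euclideanreal (\<lambda>t. collapsed_integral k g (m t) (c t) (s t))"
proof -
  have c: "continuous_map T euclidean c" "c \<in> topspace T \<rightarrow> punctured_set (Suc (2 * k + 1))"
    using assms(3) by (auto simp: continuous_map_punctured_euclidean)
  have "continuous_map T euclideanreal (\<lambda>t. fexp (m t) ((\<lambda>(c, s) z. max 0 (trig_form k c z) * g (collapse k c s z)) (c t, s t)))"
  proof (rule continuous_map_fexp_param[OF assms(2), where Q = "punctured_set (Suc (2 * k + 1)) \<times> UNIV"])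
    show "continuous_map T euclidean (\<lambda>t. (c t, s t))" using c(1) assms(4) by (rule continuous_map_Pair_euclidean)
    show "(c t, s t) \<in> punctured_set (Suc (2 * k + 1)) \<times> UNIV" if "t \<in> topspace T" for t using c(2) that by auto
    show "continuous_on ((punctured_set (Suc (2 * k + 1)) \<times> UNIV) \<times> circle)
       (\<lambda>(q, x). (\<lambda>(c, s) z. max 0 (trig_form k c z) * g (collapse k c s z)) q x)"
      using continuous_on_weighted_collapse[OF assms(1), of k] by (simp add: case_prod_unfold)
  qed
  then show ?thesis by (simp add: collapsed_integral_def)
qed

definition positive_part :: "nat \<Rightarrow> (nat \<Rightarrow> real) \<Rightarrow> complex pmf \<Rightarrow> complex pmf" where
  "positive_part k c \<mu> = reweight \<mu> (\<lambda>z. max 0 (trig_form k c z))"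

text \<open>The condition under which the positive part has mass and can be normalised.\<close>

definition charges :: "nat \<Rightarrow> (nat \<Rightarrow> real) \<Rightarrow> complex pmf \<Rightarrow> bool" where
  "charges k c \<mu> \<longleftrightarrow> \<mu> \<in> fin_probs circle \<and> (\<exists>z\<in>set_pmf \<mu>. 0 < trig_form k c z)"

lemma charges_pos: "charges k c \<mu> \<Longrightarrow> 0 < fexp \<mu> (\<lambda>z. max 0 (trig_form k c z))"
  by (auto simp: charges_def fin_probs_def intro: fexp_pos)

lemma set_positive_part:
  assumes "charges k c \<mu>"
  shows "set_pmf (positive_part k c \<mu>) = {z \<in> set_pmf \<mu>. 0 < trig_form k c z}"
proof -
  have "finite (set_pmf \<mu>)" using assms by (simp add: charges_def fin_probs_def)
  then have "set_pmf (positive_part k c \<mu>) = {z \<in> set_pmf \<mu>. max 0 (trig_form k c z) \<noteq> 0}"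
    unfolding positive_part_def using charges_pos[OF assms] by (intro set_pmf_reweight) auto
  moreover have "max 0 a \<noteq> 0 \<longleftrightarrow> 0 < a" for a :: real by auto
  ultimately show ?thesis by presburger
qed

lemma positive_part_fin_probs: "charges k c \<mu> \<Longrightarrow> positive_part k c \<mu> \<in> fin_probs circle"
  by (auto simp: fin_probs_def set_positive_part) (auto simp: charges_def fin_probs_def)

lemma fexp_positive_part:
  assumes "charges k c \<mu>"
  shows "fexp (map_pmf (collapse k c s) (positive_part k c \<mu>)) g =
     collapsed_integral k g \<mu> c s / collapsed_integral k (\<lambda>_. 1) \<mu> c 0"
proof -
  have f: "finite (set_pmf (positive_part k c \<mu>))" "finite (set_pmf \<mu>)"
    using positive_part_fin_probs[OF assms] assms by (auto simp: fin_probs_def charges_def)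
  show ?thesis
    unfolding fexp_map[OF f(1)] unfolding positive_part_def using charges_pos[OF assms] f
    by (subst fexp_reweight) (auto simp: collapsed_integral_def)
qed

lemma collapsed_integral_1_pos: "charges k c \<mu> \<Longrightarrow> 0 < collapsed_integral k (\<lambda>_. 1) \<mu> c 0"
  using charges_pos by (simp add: collapsed_integral_def)

lemma continuous_map_collapsed_positive_part:
  assumes m: "continuous_map T wass_top m" and c: "continuous_map T (punctured_space (Suc (2 * k + 1))) c"
    and s: "continuous_map T euclideanreal s"
    and ch: "\<And>t. t \<in> topspace T \<Longrightarrow> charges k (c t) (m t)" and g: "continuous_on circle g"
  shows "continuous_map T euclideanreal (\<lambda>t. fexp (map_pmf (collapse k (c t) (s t)) (positive_part k (c t) (m t))) g)"
proof (rule continuous_map_eq)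
  show "continuous_map T euclideanreal (\<lambda>t. collapsed_integral k g (m t) (c t) (s t) / collapsed_integral k (\<lambda>_. 1) (m t) (c t) 0)"
  proof (rule continuous_map_real_divide)
    show "collapsed_integral k (\<lambda>_. 1) (m t) (c t) 0 \<noteq> 0" if "t \<in> topspace T" for t
      using collapsed_integral_1_pos[OF ch[OF that]] by simp
  qed (intro continuous_map_collapsed_integral g m c s; simp)+
qed (simp add: fexp_positive_part ch)

lemma collapse_map_fin_probs:
  "\<mu> \<in> fin_probs circle \<Longrightarrow> map_pmf (collapse k c s) \<mu> \<in> fin_probs circle"
  using collapse_circle[of _ k c s] by (auto simp: fin_probs_def)

text \<open>On the way from \<open>z\<close> to the antipode of \<open>w\<close>, in either
  direction, the form changes sign, so the lift grows by at least \<open>pi / (2 * k + 1)\<close>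
  each way. The collapsed points are then within \<open>pi - pi / (2 * k + 1)\<close> of each other,
  wherever they came from; hence the alternative \<open>s = 1\<close>, which allows points of two
  different measures.\<close>

lemma collapse_dist:
  assumes c: "c \<in> punctured_set (Suc (2 * k + 1))" and z: "z \<in> circle" "0 < trig_form k c z"
    and w: "w \<in> circle" "0 < trig_form k c w" and s: "0 \<le> s" "s \<le> 1"
    and r: "2 * real k * pi / (2 * real k + 1) \<le> r" "s = 1 \<or> circle_dist z w \<le> r"
  shows "circle_dist (collapse k c s z) (collapse k c s w) \<le> r"
proof -
  define \<alpha> where "\<alpha> = Arg z"
  \<comment> \<open>A lift of \<open>w\<close> within a half turn of the lift
    \<open>\<alpha>\<close> of \<open>z\<close>, so that the difference of the angles is the arc
    length.\<close>
  define \<gamma> where "\<gamma> = \<alpha> + Arg (w / z)"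
  let ?h = "collapse_lift k c"
  have z\<alpha>: "cis \<alpha> = z" unfolding \<alpha>_def by (rule cis_Arg_circle[OF z(1)])
  have "w / z \<in> circle" using z w by (simp add: norm_divide)
  then have w\<gamma>: "cis \<gamma> = w" unfolding \<gamma>_def using z\<alpha> cis_Arg_circle[of "w / z"] z(1) by (auto simp flip: cis_mult)
  have d: "\<bar>\<alpha> - \<gamma>\<bar> \<le> pi" using Arg_bounded[of "w / z"] by (simp add: \<gamma>_def abs_le_iff)
  have minus: "trig_form k c (- cis \<gamma>) < 0" using w w\<gamma> by (simp add: trig_form_minus)
  have ne: "cis \<alpha> \<noteq> - cis \<gamma>"
  proof
    assume "cis \<alpha> = - cis \<gamma>"
    then have "trig_form k c (cis \<alpha>) < 0" using minus by simp
    then show False using z z\<alpha> by simp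
  qed
  have p: "cis (\<gamma> + pi) = - cis \<gamma>" "cis (\<gamma> - pi) = - cis \<gamma>" by (simp_all flip: cis_mult cis_divide)
  have lt: "\<alpha> < \<gamma> + pi" "\<gamma> - pi < \<alpha>" using d ne p by (auto simp: order_less_le)
  have "trig_form k c (cis \<alpha>) * trig_form k c (cis (\<gamma> + pi)) < 0"
    "trig_form k c (cis (\<gamma> - pi)) * trig_form k c (cis \<alpha>) < 0"
    unfolding p using minus z z\<alpha> by (auto simp: mult_less_0_iff)
  from collapse_lift_jump[OF c lt(1) this(1)] collapse_lift_jump[OF c lt(2) this(2)]
  have j: "pi / (2 * real k + 1) \<le> ?h (\<gamma> + pi) - ?h \<alpha>" "pi / (2 * real k + 1) \<le> ?h \<alpha> - ?h (\<gamma> - pi)" .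
  have "?h (\<gamma> + pi) = ?h \<gamma> + pi" "?h \<gamma> = ?h (\<gamma> - pi) + pi"
    using collapse_lift_half_turn[OF c, of \<gamma>] collapse_lift_half_turn[OF c, of "\<gamma> - pi"] by auto
  then have "\<bar>?h \<alpha> - ?h \<gamma>\<bar> \<le> pi - pi / (2 * real k + 1)" using j by (auto simp: abs_le_iff)
  also have e: "pi - pi / (2 * real k + 1) = 2 * real k * pi / (2 * real k + 1)" by (simp add: field_simps)
  finally have hd: "\<bar>?h \<alpha> - ?h \<gamma>\<bar> \<le> r" "\<bar>?h \<alpha> - ?h \<gamma>\<bar> \<le> pi"
    using r(1) e by (auto intro: order_trans[of _ "2 * real k * pi / (2 * real k + 1)"] simp: field_simps)
  let ?x = "\<lambda>t. (1 - s) * t + s * ?h t"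
  have diff: "?x \<alpha> - ?x \<gamma> = (1 - s) * (\<alpha> - \<gamma>) + s * (?h \<alpha> - ?h \<gamma>)" by (simp add: algebra_simps)
  have le: "\<bar>?x \<alpha> - ?x \<gamma>\<bar> \<le> M" if "s = 1 \<or> \<bar>\<alpha> - \<gamma>\<bar> \<le> M" "\<bar>?h \<alpha> - ?h \<gamma>\<bar> \<le> M" for M
  proof (cases "s = 1")
    case False
    have "\<bar>?x \<alpha> - ?x \<gamma>\<bar> \<le> (1 - s) * \<bar>\<alpha> - \<gamma>\<bar> + s * \<bar>?h \<alpha> - ?h \<gamma>\<bar>"
      unfolding diff using s abs_triangle_ineq[of "(1 - s) * (\<alpha> - \<gamma>)" "s * (?h \<alpha> - ?h \<gamma>)"] by (simp add: abs_mult)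
    also have "\<dots> \<le> (1 - s) * M + s * M"
      using that s False by (intro add_mono mult_left_mono) auto
    finally show ?thesis by (simp add: algebra_simps)
  qed (use that diff in simp)
  have "circle_dist z w = \<bar>\<alpha> - \<gamma>\<bar>" using circle_dist_cis[OF d] z\<alpha> w\<gamma> by simp
  then have "\<bar>?x \<alpha> - ?x \<gamma>\<bar> \<le> r" using le hd r(2) by simp
  moreover have "\<bar>?x \<alpha> - ?x \<gamma>\<bar> \<le> pi" using le d hd by simp
  ultimately show ?thesis
    using circle_dist_cis[of "?x \<alpha>" "?x \<gamma>"] z\<alpha> w\<gamma> collapse_cis[of k c s] by metis
qed

text \<open>A fixed measure with antipodally symmetric support, from which a measure on the positive
  set of any form is cut out. The squares of its points are the roots of unity of order
  \<open>2 * k + 2\<close>, one more than the possible number of roots of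
  \<open>trig_poly k c\<close>.\<close>

definition grid_measure :: "nat \<Rightarrow> complex pmf" where
  "grid_measure k = pmf_of_set {z. z ^ (4 * k + 4) = 1}"

lemma set_grid_measure: "set_pmf (grid_measure k) = {z. z ^ (4 * k + 4) = 1}"
  unfolding grid_measure_def by (rule set_pmf_of_set) (auto intro!: exI[of _ 1] finite_roots_unity)

lemma grid_measure_fin_probs: "grid_measure k \<in> fin_probs circle"
proof -
  have "norm z = 1" if "z ^ (4 * k + 4) = 1" for z :: complex
    using that by (metis add_eq_0_iff_both_eq_0 norm_one norm_power power_eq_1_iff zero_neq_numeral norm_ge_zero)
  moreover have "finite {z::complex. z ^ (4 * k + 4) = 1}" by (intro finite_roots_unity) simp
  ultimately show ?thesis by (auto simp: fin_probs_def set_grid_measure)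
qed

text \<open>There are more grid points than a form of degree \<^term>\<open>2 * k + 1\<close> has zeros.\<close>

lemma charges_grid_measure:
  assumes c: "c \<in> punctured_set (Suc (2 * k + 1))"
  shows "charges k c (grid_measure k)"
proof -
  let ?G = "{z::complex. z ^ (4 * k + 4) = 1}"
  have "\<exists>z\<in>?G. 0 < trig_form k c z"
  proof (rule ccontr)
    assume "\<not> (\<exists>z\<in>?G. 0 < trig_form k c z)"
    then have le: "trig_form k c z \<le> 0" if "z \<in> ?G" for z using that by force
    \<comment> \<open>The grid is symmetric and the form is odd, so nonpositive on the grid means
      zero on it.\<close>
    have zero: "trig_form k c z = 0" if z: "z \<in> ?G" for z
    proof -
      have "- z \<in> ?G" using z by simp
      then show ?thesis using le[OF z] le[of "- z"] by (simp add: trig_form_minus)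
    qed
    have "{w::complex. w ^ (2 * k + 2) = 1} \<subseteq> {w. poly (trig_poly k c) w = 0}"
    proof clarify
      fix w :: complex assume w: "w ^ (2 * k + 2) = 1"
      have "4 * k + 4 = 2 * (2 * k + 2)" by simp
      then have e: "csqrt w ^ (4 * k + 4) = ((csqrt w)\<^sup>2) ^ (2 * k + 2)" by (simp only: power_mult)
      then have G: "csqrt w \<in> ?G" using w by simp
      then have "csqrt w \<in> circle" using grid_measure_fin_probs[of k] by (auto simp: fin_probs_def set_grid_measure)
      from poly_trig_poly[OF this, of k c] show "poly (trig_poly k c) w = 0" using zero[OF G] by simp
    qed
    then have "card {w::complex. w ^ (2 * k + 2) = 1} \<le> card {w. poly (trig_poly k c) w = 0}"
      using poly_roots_finite[OF trig_poly_nonzero[OF c]] by (rule card_mono[rotated])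
    also have "\<dots> \<le> 2 * k + 1" using card_poly_roots_bound[OF trig_poly_nonzero[OF c]] degree_trig_poly[of k c] by simp
    finally show False using card_roots_unity_eq[of "2 * k + 2"] by simp
  qed
  then show ?thesis using grid_measure_fin_probs by (auto simp: charges_def set_grid_measure)
qed

text \<open>The homotopy inverse of \<open>moment k\<close>. Collapsing fully makes the diameter
  small, although the positive part of the grid is widely spread.\<close>

definition form_measure :: "nat \<Rightarrow> (nat \<Rightarrow> real) \<Rightarrow> complex pmf" where
  "form_measure k c = map_pmf (collapse k c 1) (positive_part k c (grid_measure k))"

lemma VRC_fin_probs: "\<mu> \<in> topspace (VRC r) \<Longrightarrow> \<mu> \<in> fin_probs circle"
  by (simp add: topspace_VRC)

lemma map_collapse_VRC:
  assumes c: "c \<in> punctured_set (Suc (2 * k + 1))" and \<mu>: "\<mu> \<in> fin_probs circle"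
    and pos: "\<And>z. z \<in> set_pmf \<mu> \<Longrightarrow> 0 < trig_form k c z" and s: "0 \<le> s" "s \<le> 1"
    and r: "2 * real k * pi / (2 * real k + 1) \<le> r" "s = 1 \<or> \<mu> \<in> topspace (VRC r)"
  shows "map_pmf (collapse k c s) \<mu> \<in> topspace (VRC r)"
proof -
  have "circle_dist (collapse k c s z) (collapse k c s w) \<le> r" if zw: "z \<in> set_pmf \<mu>" "w \<in> set_pmf \<mu>" for z w
  proof (rule collapse_dist[OF c _ pos[OF zw(1)] _ pos[OF zw(2)] s r(1)])
    show "z \<in> circle" "w \<in> circle" using zw fin_probsD(2)[OF \<mu>] by auto
    show "s = 1 \<or> circle_dist z w \<le> r" using r(2) zw by (auto simp: topspace_VRC)
  qed
  then show ?thesis using collapse_map_fin_probs[OF \<mu>] by (auto simp: topspace_VRC)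
qed

lemma form_measure_VRC:
  assumes c: "c \<in> punctured_set (Suc (2 * k + 1))" and r: "2 * real k * pi / (2 * real k + 1) \<le> r"
  shows "form_measure k c \<in> topspace (VRC r)"
  unfolding form_measure_def
  using set_positive_part[OF charges_grid_measure[OF c]] positive_part_fin_probs[OF charges_grid_measure[OF c]]
  by (intro map_collapse_VRC[OF c _ _ _ _ r]) auto

lemma continuous_map_grid_measure: "continuous_map T wass_top (\<lambda>_. grid_measure k)"
  by (simp add: topspace_wass_top grid_measure_fin_probs)

lemma continuous_map_form_measure:
  assumes r: "2 * real k * pi / (2 * real k + 1) \<le> r"
  shows "continuous_map (punctured_space (Suc (2 * k + 1))) (VRC r) (form_measure k)"
proof (rule continuous_map_into_VRC)
  show "continuous_map (punctured_space (Suc (2 * k + 1))) wass_top (form_measure k)"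
    unfolding form_measure_def
  proof (rule continuous_map_into_wass_top)
    fix c assume "c \<in> topspace (punctured_space (Suc (2 * k + 1)))"
    then have "c \<in> punctured_set (Suc (2 * k + 1))" by simp
    then show "map_pmf (collapse k c 1) (positive_part k c (grid_measure k)) \<in> fin_probs circle"
      by (intro collapse_map_fin_probs positive_part_fin_probs charges_grid_measure)
  next
    fix g :: "complex \<Rightarrow> real" assume "continuous_on circle g"
    then show "continuous_map (punctured_space (Suc (2 * k + 1))) euclideanreal
         (\<lambda>c. fexp (map_pmf (collapse k c 1) (positive_part k c (grid_measure k))) g)"
      using continuous_map_collapsed_positive_part[of "punctured_space (Suc (2 * k + 1))" "\<lambda>_. grid_measure k" k "\<lambda>c. c" "\<lambda>_. 1" g]
        continuous_map_grid_measure[of "punctured_space (Suc (2 * k + 1))" k] charges_grid_measure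
      by simp
  qed
  show "form_measure k t \<in> topspace (VRC r)" if "t \<in> topspace (punctured_space (Suc (2 * k + 1)))" for t
    using that form_measure_VRC[OF _ r] by simp
qed

lemma charges_moment:
  assumes "\<mu> \<in> fin_probs circle" "moment k \<mu> \<in> punctured_set (Suc (2 * k + 1))"
  shows "charges k (moment k \<mu>) \<mu>"
proof (rule ccontr)
  assume "\<not> charges k (moment k \<mu>) \<mu>"
  then have "trig_form k (moment k \<mu>) z \<le> 0" if "z \<in> set_pmf \<mu>" for z
    using assms(1) that by (force simp: charges_def)
  then have "fexp \<mu> (trig_form k (moment k \<mu>)) \<le> fexp \<mu> (\<lambda>_. 0)" by (intro fexp_mono)
  then show False using fexp_trig_form_moment_pos[OF assms(2)] by (simp add: fexp_def)
qed

lemma mix_VRC: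
  assumes "\<mu> \<in> fin_probs circle" "\<nu> \<in> fin_probs circle" "0 \<le> t" "t \<le> 1"
    and "\<And>z w. z \<in> set_pmf \<mu> \<union> set_pmf \<nu> \<Longrightarrow> w \<in> set_pmf \<mu> \<union> set_pmf \<nu> \<Longrightarrow> circle_dist z w \<le> r"
  shows "mix t \<mu> \<nu> \<in> topspace (VRC r)"
proof -
  note sub = set_pmf_mix[OF assms(3,4), of \<mu> \<nu>]
  have "finite (set_pmf (mix t \<mu> \<nu>))" using sub assms(1,2) by (auto simp: fin_probs_def intro: finite_subset)
  moreover have "set_pmf (mix t \<mu> \<nu>) \<subseteq> circle" using sub assms(1,2) by (auto simp: fin_probs_def)
  ultimately show ?thesis using sub assms(5) unfolding topspace_VRC fin_probs_def by blast
qed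

lemma homotopic_mix:
  assumes f: "continuous_map X wass_top f" and g: "continuous_map X wass_top g"
    and d: "\<And>x z w. x \<in> topspace X \<Longrightarrow> z \<in> set_pmf (f x) \<union> set_pmf (g x) \<Longrightarrow> w \<in> set_pmf (f x) \<union> set_pmf (g x)
        \<Longrightarrow> circle_dist z w \<le> r"
  shows "homotopic_with (\<lambda>h. True) X (VRC r) f g"
proof -
  let ?T = "prod_topology unit_top X" and ?h = "\<lambda>(t, x). mix t (f x) (g x)"
  have fp: "f x \<in> fin_probs circle" "g x \<in> fin_probs circle" if "x \<in> topspace X" for x
    using continuous_map_image_subset_topspace[OF f] continuous_map_image_subset_topspace[OF g] that topspace_wass_top by auto
  have V: "?h z \<in> topspace (VRC r)" if "z \<in> topspace ?T" for z
    using that fp d by (auto simp: case_prod_unfold intro!: mix_VRC)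
  have 1: "continuous_map ?T euclideanreal fst"
    using continuous_map_fst continuous_map_into_fulltopology by blast
  have c: "continuous_map ?T wass_top (\<lambda>z. f (snd z))" "continuous_map ?T wass_top (\<lambda>z. g (snd z))"
    using continuous_map_compose[OF continuous_map_snd f] continuous_map_compose[OF continuous_map_snd g] by (simp_all add: o_def)
  have "continuous_map ?T wass_top ?h"
  proof (rule continuous_map_into_wass_top)
    show "?h z \<in> fin_probs circle" if "z \<in> topspace ?T" for z using V[OF that] by (rule VRC_fin_probs)
    fix u :: "complex \<Rightarrow> real" assume u: "continuous_on circle u"
    show "continuous_map ?T euclideanreal (\<lambda>z. fexp (?h z) u)"
    proof (rule continuous_map_eq)
      show "continuous_map ?T euclideanreal (\<lambda>z. (1 - fst z) * fexp (f (snd z)) u + fst z * fexp (g (snd z)) u)"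
        using 1 continuous_map_compose[OF c(1) continuous_map_fexp[OF u]] continuous_map_compose[OF c(2) continuous_map_fexp[OF u]]
        by (intro continuous_intros) (simp_all add: o_def)
      show "(1 - fst z) * fexp (f (snd z)) u + fst z * fexp (g (snd z)) u = fexp (?h z) u" if "z \<in> topspace ?T" for z
        using that fp by (auto simp: fexp_mix fin_probs_def)
    qed
  qed
  then have "continuous_map ?T (VRC r) ?h" using V by (rule continuous_map_into_VRC)
  then show ?thesis
    unfolding homotopic_with_def by (intro exI[of _ ?h]) (auto simp: mix_0 mix_1)
qed

text \<open>The identity is moved linearly to the positive part, then collapsed, then moved linearly
  to \<open>form_measure\<close>. The last stage stays in the thickening because both measures sit
  in the collapsed positive set of the same form; it removes all dependence on \<open>\<mu>\<close>
  beyond its moments.\<close>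

theorem form_measure_moment_homotopic:
  assumes r: "2 * real k * pi / (2 * real k + 1) \<le> r" "r < (2 * real k + 2) * pi / (2 * real k + 3)"
  shows "homotopic_with (\<lambda>h. True) (VRC r) (VRC r) (form_measure k \<circ> moment k) id"
proof -
  let ?V = "VRC r" and ?P = "punctured_set (Suc (2 * k + 1))"
  let ?core = "\<lambda>\<mu>. positive_part k (moment k \<mu>) \<mu>"
  let ?R = "\<lambda>s \<mu>. map_pmf (collapse k (moment k \<mu>) s) (?core \<mu>)"
  have idc: "continuous_map ?V wass_top (\<lambda>\<mu>. \<mu>)"
    unfolding VR_thickening_def by (intro continuous_map_from_subtopology) simp
  have P: "moment k \<mu> \<in> ?P" if "\<mu> \<in> topspace ?V" for \<mu> using moment_VRC[OF that r(2)] .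
  have mc: "continuous_map ?V (punctured_space (Suc (2 * k + 1))) (moment k)"
    using continuous_map_moment[OF idc] P by (auto simp: continuous_map_punctured_euclidean)
  have ch: "charges k (moment k \<mu>) \<mu>" if "\<mu> \<in> topspace ?V" for \<mu>
    using charges_moment[OF VRC_fin_probs P] that by blast
  have core_V: "?core \<mu> \<in> topspace ?V" if "\<mu> \<in> topspace ?V" for \<mu>
    using positive_part_fin_probs[OF ch[OF that]] set_positive_part[OF ch[OF that]] that by (auto simp: topspace_VRC)
  have pos: "0 < trig_form k (moment k \<mu>) z" if "\<mu> \<in> topspace ?V" "z \<in> set_pmf (?core \<mu>)" for \<mu> z
    using set_positive_part[OF ch[OF that(1)]] that(2) by simp
  have R_V: "?R s \<mu> \<in> topspace ?V" if "\<mu> \<in> topspace ?V" "0 \<le> s" "s \<le> 1" for s \<mu>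
    using that core_V[OF that(1)] pos[OF that(1)] VRC_fin_probs
    by (intro map_collapse_VRC[OF P _ _ _ _ r(1)]) auto
  let ?T = "prod_topology unit_top ?V"
  have Rc: "continuous_map ?T ?V (\<lambda>(s, \<mu>). ?R s \<mu>)"
  proof (rule continuous_map_into_VRC)
    show RV: "(\<lambda>(s, \<mu>). ?R s \<mu>) t \<in> topspace ?V" if "t \<in> topspace ?T" for t using that R_V by auto
    have s: "continuous_map ?T euclideanreal fst"
      using continuous_map_fst continuous_map_into_fulltopology by blast
    have m: "continuous_map ?T wass_top snd" "continuous_map ?T (punctured_space (Suc (2 * k + 1))) (\<lambda>z. moment k (snd z))"
      using continuous_map_compose[OF continuous_map_snd idc] continuous_map_compose[OF continuous_map_snd mc] by (simp_all add: o_def)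
    show "continuous_map ?T wass_top (\<lambda>(s, \<mu>). ?R s \<mu>)"
    proof (rule continuous_map_into_wass_top)
      show "(\<lambda>(s, \<mu>). ?R s \<mu>) t \<in> fin_probs circle" if "t \<in> topspace ?T" for t using RV[OF that] by (rule VRC_fin_probs)
      fix g :: "complex \<Rightarrow> real" assume g: "continuous_on circle g"
      show "continuous_map ?T euclideanreal (\<lambda>z. fexp ((\<lambda>(s, \<mu>). ?R s \<mu>) z) g)"
        using continuous_map_collapsed_positive_part[OF m(1) m(2) s _ g] ch by (auto simp: case_prod_unfold)
    qed
  qed
  have R_slice: "continuous_map ?V ?V (\<lambda>\<mu>. ?R s \<mu>)" if "0 \<le> s" "s \<le> 1" for s
  proof -
    have "continuous_map ?V ?T (\<lambda>\<mu>. (s, \<mu>))" using that by (simp add: continuous_map_pairwise o_def)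
    from continuous_map_compose[OF this Rc] show ?thesis by (simp add: o_def)
  qed
  have R0: "?R 0 \<mu> = ?core \<mu>" for \<mu> by (simp add: map_pmf_def bind_return_pmf')
  have h1: "homotopic_with (\<lambda>h. True) ?V ?V id ?core"
  proof (rule homotopic_mix)
    show "continuous_map ?V wass_top id" using idc by (simp add: id_def)
    show "continuous_map ?V wass_top ?core" using continuous_map_VRC_wass[OF R_slice[of 0]] by (simp add: R0)
    show "circle_dist z w \<le> r" if "\<mu> \<in> topspace ?V" "z \<in> set_pmf (id \<mu>) \<union> set_pmf (?core \<mu>)" "w \<in> set_pmf (id \<mu>) \<union> set_pmf (?core \<mu>)" for \<mu> z w
      using that set_positive_part[OF ch[OF that(1)]] by (auto simp: topspace_VRC)
  qed
  have h2: "homotopic_with (\<lambda>h. True) ?V ?V ?core (?R 1)"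
    unfolding homotopic_with_def using Rc by (intro exI[of _ "\<lambda>(s, \<mu>). ?R s \<mu>"]) (simp add: R0)
  have h3: "homotopic_with (\<lambda>h. True) ?V ?V (?R 1) (form_measure k \<circ> moment k)"
  proof (rule homotopic_mix)
    show "continuous_map ?V wass_top (?R 1)" using continuous_map_VRC_wass[OF R_slice[of 1]] by simp
    show "continuous_map ?V wass_top (form_measure k \<circ> moment k)"
      using continuous_map_compose[OF mc continuous_map_form_measure[OF r(1)]] by (rule continuous_map_VRC_wass)
    fix \<mu> z w assume \<mu>: "\<mu> \<in> topspace ?V"
      and zw: "z \<in> set_pmf (?R 1 \<mu>) \<union> set_pmf ((form_measure k \<circ> moment k) \<mu>)" "w \<in> set_pmf (?R 1 \<mu>) \<union> set_pmf ((form_measure k \<circ> moment k) \<mu>)"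
    let ?S = "{z \<in> circle. 0 < trig_form k (moment k \<mu>) z}"
    have "set_pmf (?core \<mu>) \<subseteq> ?S"
      using pos[OF \<mu>] VRC_fin_probs[OF core_V[OF \<mu>]] by (auto simp: fin_probs_def)
    moreover have "set_pmf (positive_part k (moment k \<mu>) (grid_measure k)) \<subseteq> ?S"
      using set_positive_part[OF charges_grid_measure[OF P[OF \<mu>]]] fin_probsD(2)[OF grid_measure_fin_probs] by auto
    ultimately obtain z' w' where "z' \<in> ?S" "w' \<in> ?S" "z = collapse k (moment k \<mu>) 1 z'" "w = collapse k (moment k \<mu>) 1 w'"
      using zw by (auto simp: form_measure_def)
    then show "circle_dist z w \<le> r"
      using collapse_dist[OF P[OF \<mu>], of z' w' 1 r] r(1) by simp
  qed
  have "homotopic_with (\<lambda>h. True) ?V ?V id (form_measure k \<circ> moment k)"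
    using homotopic_with_trans[OF homotopic_with_trans[OF h1 h2] h3] .
  then show ?thesis by (simp only: homotopic_with_sym)
qed

text \<open>Undoing the collapse leads from the moments of \<open>form_measure k c\<close> to those
  of the weighted grid, and a segment leads from there to \<open>c\<close>. The work is to show that
  neither path meets the origin.\<close>

theorem moment_form_measure_homotopic:
  "homotopic_with (\<lambda>h. True) (punctured_space (Suc (2 * k + 1))) (punctured_space (Suc (2 * k + 1))) (moment k \<circ> form_measure k) id"
proof -
  let ?X = "punctured_space (Suc (2 * k + 1))" and ?P = "punctured_set (Suc (2 * k + 1))"
  let ?\<nu> = "\<lambda>c. positive_part k c (grid_measure k)"
  let ?R = "\<lambda>s c. map_pmf (collapse k c s) (?\<nu> c)"
  let ?T = "prod_topology unit_top ?X"
  have s: "continuous_map ?T euclideanreal fst"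
    using continuous_map_fst continuous_map_into_fulltopology by blast
  have R_fin: "?R s c \<in> fin_probs circle" if "c \<in> ?P" for s c
    using that by (intro collapse_map_fin_probs positive_part_fin_probs charges_grid_measure)
  have Rc: "continuous_map ?T wass_top (\<lambda>z. ?R (fst z) (snd z))"
  proof (rule continuous_map_into_wass_top)
    show "?R (fst z) (snd z) \<in> fin_probs circle" if "z \<in> topspace ?T" for z using that R_fin by auto
    fix g :: "complex \<Rightarrow> real" assume g: "continuous_on circle g"
    show "continuous_map ?T euclideanreal (\<lambda>z. fexp (?R (fst z) (snd z)) g)"
      by (rule continuous_map_collapsed_positive_part[OF continuous_map_grid_measure continuous_map_snd s _ g])
        (auto intro: charges_grid_measure)
  qed
  have nonzero: "moment k (?R s c) \<in> ?P" if c: "c \<in> ?P" and s: "0 \<le> s" "s \<le> 1" for s c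
  proof -
    let ?A = "set_pmf (?\<nu> c)" and ?h = "collapse_lift k c"
    have \<nu>: "?\<nu> c \<in> fin_probs circle" using c by (intro positive_part_fin_probs charges_grid_measure)
    have A: "finite ?A" "?A \<noteq> {}" "?A \<subseteq> circle" using \<nu> set_pmf_not_empty[of "?\<nu> c"] by (auto simp: fin_probs_def)
    have pos: "0 < trig_form k c z" if "z \<in> ?A" for z
      using that set_positive_part[OF charges_grid_measure[OF c]] by simp
    \<comment> \<open>Positions follow the partly collapsed angles, but the spread is measured by
      the full collapse \<open>?h\<close>, whose jumps are at least \<open>pi / (2 * k + 1)\<close>
      whatever \<open>s\<close> is.\<close>
    have "\<exists>d. \<forall>x. cis x \<in> ?A \<longrightarrow> 0 < trig_form k d (cis ((1 - s) * x + s * ?h x))"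
    proof (rule positive_trig_form_exists[OF A, of "\<lambda>x. (1 - s) * x + s * ?h x" ?h "pi / (2 * real k + 1)"])
      show "- z \<notin> ?A" if "z \<in> ?A" for z using pos[OF that] pos[of "- z"] by (auto simp: trig_form_minus)
      show "mono (\<lambda>x. (1 - s) * x + s * ?h x)"
        using s mono_collapse_lift[OF c] by (auto simp: mono_def intro!: add_mono mult_left_mono)
      show "(1 - s) * (x + pi) + s * ?h (x + pi) = (1 - s) * x + s * ?h x + pi" for x
        using collapse_lift_half_turn[OF c, of x] by (simp add: algebra_simps)
      show "(1 - s) * x + s * ?h x < (1 - s) * y + s * ?h y \<and> pi / (2 * real k + 1) \<le> ?h y - ?h x"
        if xy: "x < y" "cis x \<in> ?A" "- cis y \<in> ?A" for x y
      proof
        have "trig_form k c (cis x) * trig_form k c (cis y) < 0"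
          using pos[OF xy(2)] pos[OF xy(3)] by (simp add: trig_form_minus mult_less_0_iff)
        then show j: "pi / (2 * real k + 1) \<le> ?h y - ?h x" using collapse_lift_jump[OF c xy(1)] by blast
        have "0 < pi / (2 * real k + 1)" by (simp add: add_nonneg_pos)
        then have h: "?h x < ?h y" using j by linarith
        show "(1 - s) * x + s * ?h x < (1 - s) * y + s * ?h y"
        proof (cases "s = 0")
          case False
          then have "s * ?h x < s * ?h y" using h s by simp
          moreover have "(1 - s) * x \<le> (1 - s) * y" using xy(1) s by (intro mult_left_mono) auto
          ultimately show ?thesis by linarith
        qed (use xy in simp)
      qed
      show "pi < (2 * real k + 3) * (pi / (2 * real k + 1))" by (simp add: field_simps)
    qed (use mono_collapse_lift[OF c] collapse_lift_half_turn[OF c] in \<open>auto intro: divide_pos_pos add_nonneg_pos\<close>)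
    then obtain d where d: "\<And>x. cis x \<in> ?A \<Longrightarrow> 0 < trig_form k d (collapse k c s (cis x))"
      unfolding collapse_cis by blast
    have dA: "0 < trig_form k d (collapse k c s z)" if "z \<in> ?A" for z
      using d[of "Arg z"] cis_Arg_circle[of z] that A(3) by auto
    obtain z where "z \<in> ?A" using A(2) by blast
    then have "0 < fexp (?\<nu> c) (\<lambda>z. trig_form k d (collapse k c s z))"
      using A(1) dA by (intro fexp_pos) (auto simp: less_imp_le)
    then have "0 < fexp (?R s c) (trig_form k d)" by (simp only: fexp_map[OF A(1)])
    then show ?thesis using moment_punctured R_fin[OF c, of s] by (auto simp: fin_probs_def)
  qed
  have h1: "homotopic_with (\<lambda>h. True) ?X ?X (\<lambda>c. moment k (?R 0 c)) (moment k \<circ> form_measure k)"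
    unfolding homotopic_with_def
  proof (intro exI[of _ "\<lambda>z. moment k (?R (fst z) (snd z))"] conjI allI)
    show "continuous_map ?T ?X (\<lambda>z. moment k (?R (fst z) (snd z)))"
      using continuous_map_moment[OF Rc] nonzero by (auto simp: continuous_map_punctured_euclidean)
  qed (auto simp: form_measure_def)
  let ?m = "\<lambda>c. moment k (?R 0 c)"
  have h2: "homotopic_with (\<lambda>h. True) ?X ?X ?m id"
  proof -
    let ?h = "\<lambda>z i. fst z * snd z i + (1 - fst z) * ?m (snd z) i"
    have mc: "continuous_map ?X ?X ?m" using homotopic_with_imp_continuous_maps[OF h1] by blast
    have coord: "continuous_map ?X euclideanreal (\<lambda>c. c i)" for i
      by (intro continuous_map_from_subtopology continuous_map_product_projection) auto
    have "continuous_map ?T (powertop_real UNIV) ?h"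
      unfolding continuous_map_componentwise_UNIV
    proof
      fix i
      have "continuous_map ?T euclideanreal (\<lambda>z. snd z i)" "continuous_map ?T euclideanreal (\<lambda>z. ?m (snd z) i)"
        using continuous_map_compose[OF continuous_map_snd coord] continuous_map_compose[OF continuous_map_compose[OF continuous_map_snd mc] coord]
        by (simp_all add: o_def)
      then show "continuous_map ?T euclideanreal (\<lambda>z. ?h z i)" using s by (intro continuous_intros)
    qed
    moreover have "?h z \<in> ?P" if z: "z \<in> topspace ?T" for z
    proof -
      obtain t c where tc: "z = (t, c)" "0 \<le> t" "t \<le> 1" "c \<in> ?P" using z by (cases z) auto
      have out: "c i = 0" if "i \<ge> Suc (2 * k + 1)" for i using tc(4) that by (simp add: punctured_set_def)
      obtain j where j: "c j \<noteq> 0" using tc(4) by (auto simp: punctured_set_def)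
      then have jk: "j < 2 * k + 2" using out[of j] by (cases "j < 2 * k + 2") auto
      have cc: "0 < (\<Sum>i<2 * k + 2. c i * c i)"
        using j jk by (intro sum_pos2[of _ j]) (auto simp: zero_less_mult_iff linorder_neq_iff)
      have \<nu>: "?R 0 c = ?\<nu> c" by (simp add: map_pmf_def bind_return_pmf')
      have "0 < fexp (?\<nu> c) (trig_form k c)"
      proof -
        have fin: "finite (set_pmf (?\<nu> c))" using R_fin[OF tc(4), of 0] by (simp add: \<nu> fin_probs_def)
        obtain y where "y \<in> set_pmf (?\<nu> c)" using set_pmf_not_empty[of "?\<nu> c"] by blast
        then show ?thesis using fin set_positive_part[OF charges_grid_measure[OF tc(4)]]
          by (intro fexp_pos) (auto simp: less_imp_le)
      qed
      \<comment> \<open>Pairing with \<open>c\<close> is positive at both ends of the segment, hence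
        along all of it.\<close>
      then have cm: "0 < (\<Sum>i<2 * k + 2. c i * ?m c i)" by (simp only: fexp_trig_form \<nu>)
      have "(\<Sum>i<2 * k + 2. c i * ?h z i) = t * (\<Sum>i<2 * k + 2. c i * c i) + (1 - t) * (\<Sum>i<2 * k + 2. c i * ?m c i)"
        unfolding tc(1) sum_distrib_left sum.distrib[symmetric] by (intro sum.cong refl) (simp add: algebra_simps)
      also have "\<dots> > 0"
        using cc cm tc(2,3) by (cases "t = 0") (auto intro: add_pos_nonneg)
      finally have sp: "0 < (\<Sum>i<2 * k + 2. c i * ?h z i)" .
      have "\<exists>i. ?h z i \<noteq> 0"
      proof (rule ccontr)
        assume "\<nexists>i. ?h z i \<noteq> 0"
        then have "(\<Sum>i<2 * k + 2. c i * ?h z i) = 0" by (intro sum.neutral) simp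
        then show False using sp by linarith
      qed
      then show ?thesis using out tc(1) by (auto simp: punctured_set_def moment_def)
    qed
    ultimately have "continuous_map ?T ?X ?h" by (auto simp: continuous_map_in_subtopology)
    then show ?thesis
      unfolding homotopic_with_def by (intro exI[of _ ?h]) (auto simp: id_def)
  qed
  from homotopic_with_symD[OF h1] show ?thesis using h2 by (rule homotopic_with_trans)
qed

section \<open>Persistent homology of the thickenings\<close>

lemma continuous_map_VRC_moment:
  assumes "r < (2 * real k + 2) * pi / (2 * real k + 3)"
  shows "continuous_map (VRC r) (punctured_space (Suc (2 * k + 1))) (moment k)"
  using continuous_map_moment[of "VRC r" "\<lambda>\<mu>. \<mu>" k] continuous_map_VRC_wass[of "VRC r" r id] moment_VRC[OF _ assms]
  by (auto simp: continuous_map_punctured_euclidean id_def)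

lemma sphere_like_VRC:
  assumes r: "2 * real k * pi / (2 * real k + 1) \<le> r" "r < (2 * real k + 2) * pi / (2 * real k + 3)"
  shows "sphere_like TYPE('k::field) (2 * k + 1) (VRC r)"
  by (rule sphere_like_homotopy_equivalent[OF sphere_like_punctured continuous_map_form_measure[OF r(1)]
        continuous_map_VRC_moment[OF r(2)] moment_form_measure_homotopic form_measure_moment_homotopic[OF r]])

text \<open>The right endpoint for \<open>k\<close> is the left endpoint for \<open>k + 1\<close>,
  and these endpoints approach \<open>pi\<close>; so the least \<open>k\<close> whose right endpoint
  exceeds \<open>r\<close> is the one sought.\<close>

lemma critical_interval_exists:
  assumes "0 \<le> r" "r < pi"
  obtains k where "2 * real k * pi / (2 * real k + 1) \<le> r" "r < (2 * real k + 2) * pi / (2 * real k + 3)"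
proof -
  let ?P = "\<lambda>k::nat. r < (2 * real k + 2) * pi / (2 * real k + 3)"
  obtain j :: nat where j: "pi / (pi - r) < real j" using reals_Archimedean2 by blast
  have "pi < real j * (pi - r)" using j assms(2) by (simp add: field_simps)
  also have "\<dots> \<le> (2 * real j + 3) * (pi - r)" using assms(2) by (intro mult_right_mono) auto
  finally have "?P j" by (simp add: field_simps)
  then have least: "?P (LEAST k. ?P k)" by (rule LeastI)
  let ?k = "LEAST k. ?P k"
  have "2 * real ?k * pi / (2 * real ?k + 1) \<le> r"
  proof (cases ?k)
    case 0
    then show ?thesis using assms(1) by simp
  next
    case (Suc i)
    then have "\<not> ?P i" using not_less_Least[of i ?P] by simp
    then show ?thesis using Suc by (simp add: algebra_simps)
  qed
  then show thesis using least that by blast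
qed

text \<open>For \<open>r\<close> in \<open>[0, pi)\<close> the thickening has the homology of a
  sphere of dimension \<open>2 * j + 1\<close>, with \<open>j\<close> from the critical interval of
  \<open>r\<close>; otherwise it is empty or contractible. The conditions exclude
  \<open>p = 2 * j + 1\<close>.\<close>

lemma rcycles_VRC_other:
  assumes p: "p \<noteq> 2 * k + 1 \<or> r \<notin> {2 * real k * pi / (2 * real k + 1) ..< (2 * real k + 2) * pi / (2 * real k + 3)}"
    and odd: "p = 0 \<or> even p \<or> p = 2 * k + 1"
  shows "rcycles p (VRC r) \<subseteq> (fboundaries p (VRC r) :: (complex pmf, 'k::field) fchain set)"
proof (cases "r < 0 \<or> pi \<le> r")
  case True
  then have "contractible_space (VRC r)"
    using contractible_VRC VRC_empty[of r] by (auto simp: contractible_space_empty)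
  then show ?thesis using rcycles_contractible by blast
next
  case False
  then obtain j where j: "2 * real j * pi / (2 * real j + 1) \<le> r" "r < (2 * real j + 2) * pi / (2 * real j + 3)"
    using critical_interval_exists[of r] by force
  have "p \<noteq> 2 * j + 1"
  proof
    assume "p = 2 * j + 1"
    then have "p = 2 * k + 1" "j = k" using odd by auto
    then show False using p j by auto
  qed
  then show ?thesis using sphere_like_VRC[OF j] unfolding sphere_like_def by blast
qed

lemma fcycles_eq_rcycles: "0 < p \<Longrightarrow> fcycles p X = rcycles p X"
  by (simp add: rcycles_def)

text \<open>All spheres that occur have positive dimension, so for every \<open>r \<ge> 0\<close>
  degree 0 has only the class detected by the augmentation.\<close>

lemma has_bars_VRC_0: "has_bars (persistent_homology TYPE('k::field) 0 VRC) {()} (\<lambda>_. {0..})"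
proof (rule has_bars_single[where L = "\<lambda>_. augmentation"])
  show "is_interval {0::real..}" "{0::real..} \<noteq> {}" by (auto simp: is_interval_ci)
  show "continuous_map (VRC r) (VRC s) id" if "r \<le> s" for r s using that by (rule continuous_map_VRC_mono)
  show "fcycles 0 (VRC r) \<subseteq> (fboundaries 0 (VRC r) :: (complex pmf, 'k) fchain set)" if "r \<notin> {0..}" for r
  proof
    fix z :: "(complex pmf, 'k) fchain" assume z: "z \<in> fcycles 0 (VRC r)"
    have "singular_simplex_set 0 (VRC r) = {}"
      using singular_simplex_empty[of "VRC r" 0] VRC_empty[of r] that by auto
    then have "Poly_Mapping.keys z \<subseteq> {}" using z unfolding fcycles_def fchain_set_def by blast
    then show "z \<in> fboundaries 0 (VRC r)" by (simp add: fboundaries_closed)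
  qed
  show "augmentation (x + y) = augmentation x + augmentation y" for x y :: "(complex pmf, 'k) fchain"
    by (rule augmentation_add)
  show "augmentation (fchain_smult a x) = a * augmentation x" for a and x :: "(complex pmf, 'k) fchain"
    by (rule augmentation_smult)
  show "augmentation x = 0 \<longleftrightarrow> x \<in> fboundaries 0 (VRC r)" if "x \<in> fcycles 0 (VRC r)" for r and x :: "(complex pmf, 'k) fchain"
    using rcycles_VRC_other[of 0 0 r] fboundaries_subset_rcycles[of 0 "VRC r"] that by (auto simp: rcycles_def)
  show "\<exists>x\<in>fcycles 0 (VRC r). augmentation x = (1::'k)" if "r \<in> {0..}" for r
    using const_simplex_in_fchain_set[OF VRC_nonempty, of r 0 1] that
    by (intro bexI[of _ "Poly_Mapping.single (const_simplex 0 (return_pmf 1)) 1"])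
      (auto simp: fcycles_def fchain_boundary_def)
qed simp

lemma has_bars_VRC_odd:
  "has_bars (persistent_homology TYPE('k::field) (2 * k + 1) VRC) {()}
     (\<lambda>_. {2 * real k * pi / (2 * real k + 1) ..< (2 * real k + 2) * pi / (2 * real k + 3)})"
proof -
  let ?p = "2 * k + 1" and ?X = "punctured_space (Suc (2 * k + 1))"
  let ?J = "{2 * real k * pi / (2 * real k + 1) ..< (2 * real k + 2) * pi / (2 * real k + 3)}"
  let ?B = "fboundaries ?p ?X :: (nat \<Rightarrow> real, 'k) fchain set"
  obtain z0 where z0: "z0 \<in> rcycles ?p ?X" "z0 \<notin> ?B"
     "\<And>z. z \<in> rcycles ?p ?X \<Longrightarrow> \<exists>a. z - fchain_smult a z0 \<in> ?B"
    using sphere_like_punctured[of ?p, where 'k = 'k] unfolding sphere_like_def by blast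
  have uniq: "a = b" if "z - fchain_smult a z0 \<in> ?B" "z - fchain_smult b z0 \<in> ?B" for z a b
  proof (rule ccontr)
    assume "a \<noteq> b"
    have "(z - fchain_smult b z0) - (z - fchain_smult a z0) \<in> ?B" by (rule fboundaries_closed(3)[OF that(2,1)])
    then have "fchain_smult a z0 - fchain_smult b z0 \<in> ?B" by simp
    then have "fchain_smult (inverse (a - b)) (fchain_smult a z0 - fchain_smult b z0) \<in> ?B" by (rule fboundaries_closed)
    moreover have "fchain_smult a z0 - fchain_smult b z0 = fchain_smult (a - b) z0"
      using fchain_smult_add_left[of "a - b" b z0] by simp
    ultimately show False using z0(2) \<open>a \<noteq> b\<close> by (simp add: fchain_smult_smult)
  qed
  \<comment> \<open>The coefficient with respect to one fixed generator of punctured space. As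
    neither \<open>z0\<close> nor \<open>moment k\<close> depends on \<open>r\<close>, the
    functional \<open>L\<close> below is the same along the whole bar.\<close>
  define deg where "deg z = (THE a. z - fchain_smult a z0 \<in> ?B)" for z
  have deg: "deg z = a" if "z - fchain_smult a z0 \<in> ?B" for z a
    unfolding deg_def using that uniq by blast
  have deg': "z - fchain_smult (deg z) z0 \<in> ?B" if "z \<in> rcycles ?p ?X" for z
    using z0(3)[OF that] deg by blast
  define L where "L z = deg (fchain_map ?p (moment k) z)" for z :: "(complex pmf, 'k) fchain"
  have mom: "continuous_map (VRC r) ?X (moment k)" if "r \<in> ?J" for r
    using that by (intro continuous_map_VRC_moment) auto
  have im: "fchain_map ?p (moment k) z \<in> rcycles ?p ?X" if "r \<in> ?J" "z \<in> fcycles ?p (VRC r)" for r and z :: "(complex pmf, 'k) fchain"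
    using rcycles_map[OF _ mom[OF that(1)]] that(2) by (simp add: fcycles_eq_rcycles)
  have \<Psi>: "continuous_map ?X (VRC r) (form_measure k)" if "r \<in> ?J" for r
    using that by (intro continuous_map_form_measure) auto
  have ner: "2 * real k * pi / (2 * real k + 1) < (2 * real k + 2) * pi / (2 * real k + 3)"
    by (simp add: field_simps)
  show ?thesis
  proof (rule has_bars_single[where L = "\<lambda>_. L"])
    show "is_interval ?J" by (simp add: is_interval_co)
    show "?J \<noteq> {}" using ner by simp
    show "continuous_map (VRC r) (VRC s) id" if "r \<le> s" for r s using that by (rule continuous_map_VRC_mono)
    show "fcycles ?p (VRC r) \<subseteq> (fboundaries ?p (VRC r) :: (complex pmf, 'k) fchain set)" if "r \<notin> ?J" for r
      using rcycles_VRC_other[of ?p k r] that by (simp add: fcycles_eq_rcycles)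
    fix r and x :: "(complex pmf, 'k) fchain" and a :: 'k assume r: "r \<in> ?J" and x: "x \<in> fcycles ?p (VRC r)"
    show "L (fchain_smult a x) = a * L x"
      unfolding L_def
    proof (rule deg)
      have "fchain_smult a (fchain_map ?p (moment k) x - fchain_smult (deg (fchain_map ?p (moment k) x)) z0) \<in> ?B"
        by (intro fboundaries_closed deg' im[OF r x])
      then show "fchain_map ?p (moment k) (fchain_smult a x) - fchain_smult (a * deg (fchain_map ?p (moment k) x)) z0 \<in> ?B"
        by (simp add: fchain_map_linear fchain_smult_diff fchain_smult_smult)
    qed
    show "L x = 0 \<longleftrightarrow> x \<in> fboundaries ?p (VRC r)"
    proof
      assume "L x = 0"
      then have "fchain_map ?p (moment k) x \<in> ?B" using deg'[OF im[OF r x]] by (simp add: L_def)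
      then have "fchain_map ?p (form_measure k) (fchain_map ?p (moment k) x) \<in> fboundaries ?p (VRC r)"
        using fboundaries_map \<Psi>[OF r] by blast
      moreover have "x - fchain_map ?p (form_measure k) (fchain_map ?p (moment k) x) \<in> fboundaries ?p (VRC r)"
        using form_measure_moment_homotopic[of k r] r x by (intro fchain_map_homotopic_id) auto
      ultimately show "x \<in> fboundaries ?p (VRC r)" using fboundaries_closed(2) by fastforce
    next
      assume "x \<in> fboundaries ?p (VRC r)"
      then have "fchain_map ?p (moment k) x \<in> ?B" using fboundaries_map mom[OF r] by blast
      then show "L x = 0" unfolding L_def by (intro deg) simp
    qed
    fix y :: "(complex pmf, 'k) fchain" assume y: "y \<in> fcycles ?p (VRC r)"
    show "L (x + y) = L x + L y"
      unfolding L_def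
    proof (rule deg)
      have "(fchain_map ?p (moment k) x - fchain_smult (deg (fchain_map ?p (moment k) x)) z0) +
            (fchain_map ?p (moment k) y - fchain_smult (deg (fchain_map ?p (moment k) y)) z0) \<in> ?B"
        by (intro fboundaries_closed deg' im[OF r x] im[OF r y])
      then show "fchain_map ?p (moment k) (x + y) - fchain_smult (deg (fchain_map ?p (moment k) x) + deg (fchain_map ?p (moment k) y)) z0 \<in> ?B"
        by (simp add: fchain_map_linear fchain_smult_add_left algebra_simps)
    qed
  next
    fix r assume r: "r \<in> ?J"
    have z0c: "z0 \<in> fcycles ?p ?X" using z0(1) by (simp add: rcycles_def)
    have "z0 - fchain_map ?p (moment k) (fchain_map ?p (form_measure k) z0) \<in> ?B"
      by (rule fchain_map_homotopic_id[OF moment_form_measure_homotopic z0c])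
    from fboundaries_closed(4)[OF this]
    have "L (fchain_map ?p (form_measure k) z0) = 1" unfolding L_def by (intro deg) simp
    then show "\<exists>x\<in>fcycles ?p (VRC r). L x = 1" using fcycles_map[OF z0c \<Psi>[OF r]] by blast
  qed simp
qed

lemma has_bars_VRC_even:
  assumes "p \<noteq> 0" "even p"
  shows "has_bars (persistent_homology TYPE('k::field) p VRC) ({} :: unit set) (\<lambda>_. {})"
proof (rule has_bars_none)
  show "fcycles p (VRC r) \<subseteq> (fboundaries p (VRC r) :: (complex pmf, 'k) fchain set)" for r
  proof -
    have "p \<noteq> 2 * 0 + 1" using assms by auto
    then show ?thesis using rcycles_VRC_other[of p 0 r] assms by (simp add: fcycles_eq_rcycles)
  qed
qed

theorem theorem3:
  "has_bars (persistent_homology TYPE('k::field) 0 (VR_thickening circle circle_dist))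
     {()} (\<lambda>_. {0..}) \<and>
   (\<forall>k::nat.
      has_bars (persistent_homology TYPE('k) (2 * k + 1) (VR_thickening circle circle_dist))
        {()} (\<lambda>_. {2 * real k * pi / (2 * real k + 1) ..<
                   (2 * real k + 2) * pi / (2 * real k + 3)})) \<and>
   (\<forall>n::nat. n \<noteq> 0 \<and> (\<nexists>k. n = 2 * k + 1) \<longrightarrow>
      has_bars (persistent_homology TYPE('k) n (VR_thickening circle circle_dist))
        ({} :: unit set) (\<lambda>_. {}))"
proof (intro conjI allI impI)
  show "has_bars (persistent_homology TYPE('k) n VRC) ({} :: unit set) (\<lambda>_. {})"
    if "n \<noteq> 0 \<and> (\<nexists>k. n = 2 * k + 1)" for n :: nat
  proof (rule has_bars_VRC_even)
    show "n \<noteq> 0" using that by simp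
    show "even n" using that oddE by blast
  qed
qed (rule has_bars_VRC_0 has_bars_VRC_odd)+

end
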